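(* Let $X$ be a complete, Ahlfors $n$-regular metric space, $Y$ a complete, doubling metric space, and $Z$ a compact subset of $X$. Suppose that there is a Lipschitz map $g\colon Z\to Y$ such that $\mathcal{H}^n(g(Z))>0$. Then there are a weak tangent $(\hat X,\hat x)$ of $X$ and a weak tangent $(\hat Y,\hat y)$ of $Y$ such that $\dim_L(\hat X)\le\dim_L(\hat Y)$. In particular, if $\dim_L(Y)\le m$, then $X$ has a weak tangent with Lipschitz dimension at most $m$.
   Context: $\mathcal{H}^n$ is $n$-dimensional Hausdorff measure. $X$ is Ahlfors $n$-regular if there is $C>0$ with $C^{-1}r^n\le\mathcal{H}^n(\overline{B}(x,r))\le Cr^n$ for all $x\in X$ and $0<r\le\mathrm{diam}(X)$. Doubling: a metric space is doubling if there is $N$ such that every ball can be covered by $N$ balls of half the radius. Lipschitz dimension: for $r>0$, an $r$-path in a metric space $X$ is a finite sequence $(x_1,\dots,x_k)$ in $X$ with $d(x_i,x_{i+1})\le r$ for $1\le i\le k-1$. Two points are in the same $r$-component of $X$ if some $r$-path in $X$ contains both. The $r$-components of a subset are those of the subset as a metric space. A map $f\colon X\to Y$ is Lipschitz light if there is $C>0$ such that $f$ is $C$-Lipschitz and, for every $r>0$ and every $W\subset Y$ with $\mathrm{diam}(W)\le r$, the $r$-components of $f^{-1}(W)$ have diameter at most $Cr$. $\dim_L(X)$ is the minimal integer $k\ge0$ such that there is a Lipschitz light map $X\to\mathbb{R}^k$ (with $\mathbb{R}^0$ a one-point space), or $\infty$ if there is none. Convergence of sets: non-empty closed sets $F_j\subseteq\mathbb{R}^N$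 converge to a non-empty closed set $F\subseteq\mathbb{R}^N$ if for all $R>0$, $\lim_{j}\sup_{x\in F_j\cap B(0,R)}\mathrm{dist}(x,F)=0$ and $\lim_j\sup_{y\in F\cap B(0,R)}\mathrm{dist}(y,F_j)=0$. Convergence of maps: if $F_j\to F$ in this sense and $f_j\colon F_j\to S$, $f\colon F\to S$ are maps into a metric space $S$, then $f_j$ converges to $f$ if $f_j(x_j)\to f(x)$ whenever $x_j\in F_j$ and $x_j\to x\in F$. Convergence of pointed spaces: $(X_j,d_j,p_j)$ converges to $(X,d,p)$ if there exist $\alpha\in(0,1]$, $N\in\mathbb{N}$, $L\ge 1$ and $L$-bi-Lipschitz embeddings $e_j\colon(X_j,d_j^\alpha)\to\mathbb{R}^N$, $e\colon(X,d^\alpha)\to\mathbb{R}^N$ with $e_j(p_j)=e(p)=0$, such that $e_j(X_j)$ converges to $e(X)$ as non-empty closed subsets of $\mathbb{R}^N$, i.e. for all $R>0$, $\lim_j\sup_{x\in e_j(X_j)\cap B(0,R)}\mathrm{dist}(x,e(X))=0$ and $\lim_j\sup_{y\in e(X)\cap B(0,R)}\mathrm{dist}(y,e_j(X_j))=0$ (in particular these images are closed) and the functions $(x,y)\mapsto d_j(e_j^{-1}(x),e_j^{-1}(y))$ on $e_j(X_j)\times e_j(X_j)$ converge to $(x,y)\mapsto d(e^{-1}(x),e^{-1}(y))$ on $e(X)\times e(X)$. Weak tangent: a weak tangent of $(X,d)$ is any limit, in this sense, of pointed metric spaces of the form $(X,\lambda_kd,x_k)$ with $\lambda_k>0$ and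 $x_k\in X$. *)

theory Defs
  imports "HOL-Analysis.Analysis"
begin

section \<open>Metrics derived from a given metric\<close>

text \<open>Metric spaces are elements of the type \<^typ>\<open>'a metric\<close> (a carrier with a distance), since weak
  tangents require several metrics on one set and Euclidean spaces of varying dimension.
  As \<^const>\<open>metric\<close> is the abstraction function of a typedef, each construction comes with the
  proof that it has the intended carrier and distance.\<close>

definition scaled_metric :: "real \<Rightarrow> 'a metric \<Rightarrow> 'a metric" where
  "scaled_metric c X = metric (mspace X, \<lambda>x y. c * mdist X x y)"

lemma Metric_space_scaled:
  assumes "c > 0"
  shows "Metric_space (mspace X) (\<lambda>x y. c * mdist X x y)"
proof -
  interpret Metric_space "mspace X" "mdist X" by simp
  show ?thesis
  proof
    fix x y z assume "x \<in> mspace X" "y \<in> mspace X" "z \<in> mspace X"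
    then have "mdist X x z \<le> mdist X x y + mdist X y z" by (rule triangle)
    then show "c * mdist X x z \<le> c * mdist X x y + c * mdist X y z"
      using assms by (simp flip: distrib_left)
  qed (use assms commute in auto)
qed

lemma mspace_scaled_metric [simp]: "c > 0 \<Longrightarrow> mspace (scaled_metric c X) = mspace X"
  and mdist_scaled_metric [simp]: "c > 0 \<Longrightarrow> mdist (scaled_metric c X) x y = c * mdist X x y"
  by (simp_all add: scaled_metric_def Metric_space_scaled Metric_space.mspace_metric
      Metric_space.mdist_metric)

definition snowflake_metric :: "real \<Rightarrow> 'a metric \<Rightarrow> 'a metric" where
  "snowflake_metric \<alpha> X = metric (mspace X, \<lambda>x y. mdist X x y powr \<alpha>)"

lemma powr_subadditive:
  fixes a b \<alpha> :: real
  assumes "0 \<le> a" "0 \<le> b" "0 < \<alpha>" "\<alpha> \<le> 1"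
  shows "(a + b) powr \<alpha> \<le> a powr \<alpha> + b powr \<alpha>"
proof (cases "a + b = 0")
  case True
  then show ?thesis by simp
next
  case False
  define s where "s = a + b"
  have s: "s > 0" using False assms by (simp add: s_def)
  have le: "t / s \<le> (t / s) powr \<alpha>" if "0 \<le> t" "t \<le> s" for t
  proof (cases "t = 0")
    case False
    then have "(t / s) powr 1 \<le> (t / s) powr \<alpha>"
      using that s assms by (intro powr_mono') auto
    then show ?thesis using that s by simp
  qed simp
  have "1 = a / s + b / s"
    using s by (simp add: s_def flip: add_divide_distrib)
  also have "\<dots> \<le> (a / s) powr \<alpha> + (b / s) powr \<alpha>"
    using assms by (intro add_mono le) (auto simp: s_def)
  also have "\<dots> = (a powr \<alpha> + b powr \<alpha>) / s powr \<alpha>"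
    using assms s by (simp add: powr_divide add_divide_distrib)
  finally show ?thesis
    using s by (simp add: s_def field_simps)
qed

lemma Metric_space_snowflake:
  assumes "0 < \<alpha>" "\<alpha> \<le> 1"
  shows "Metric_space (mspace X) (\<lambda>x y. mdist X x y powr \<alpha>)"
proof -
  interpret Metric_space "mspace X" "mdist X" by simp
  show ?thesis
  proof
    fix x y z assume "x \<in> mspace X" "y \<in> mspace X" "z \<in> mspace X"
    then have "mdist X x z powr \<alpha> \<le> (mdist X x y + mdist X y z) powr \<alpha>"
      using assms triangle by (intro powr_mono2) auto
    also have "\<dots> \<le> mdist X x y powr \<alpha> + mdist X y z powr \<alpha>"
      using assms by (intro powr_subadditive) auto
    finally show "mdist X x z powr \<alpha> \<le> mdist X x y powr \<alpha> + mdist X y z powr \<alpha>" .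
  qed (use assms commute in auto)
qed

lemma mspace_snowflake_metric [simp]:
    "0 < \<alpha> \<Longrightarrow> \<alpha> \<le> 1 \<Longrightarrow> mspace (snowflake_metric \<alpha> X) = mspace X"
  and mdist_snowflake_metric [simp]:
    "0 < \<alpha> \<Longrightarrow> \<alpha> \<le> 1 \<Longrightarrow> mdist (snowflake_metric \<alpha> X) x y = mdist X x y powr \<alpha>"
  by (simp_all add: snowflake_metric_def Metric_space_snowflake Metric_space.mspace_metric
      Metric_space.mdist_metric)

text \<open>\<open>\<real>\<^sup>N\<close>, with a point represented by its coordinate sequence extended by \<open>0\<close>
  (the same carrier as \<^const>\<open>Euclidean_space\<close>). The case \<open>N = 0\<close> is a one-point space.\<close>

definition Euclidean_metric :: "nat \<Rightarrow> (nat \<Rightarrow> real) metric" where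
  "Euclidean_metric N = metric ({x. \<forall>i\<ge>N. x i = 0}, \<lambda>x y. L2_set (\<lambda>i. x i - y i) {..<N})"

lemma Metric_space_Euclidean:
  fixes N :: nat
  shows "Metric_space {x. \<forall>i\<ge>N. x i = 0} (\<lambda>x y. L2_set (\<lambda>i. x i - y i) {..<N})"
proof
  fix x y z :: "nat \<Rightarrow> real"
  show "L2_set (\<lambda>i. x i - y i) {..<N} = L2_set (\<lambda>i. y i - x i) {..<N}"
    by (simp add: L2_set_def power2_commute)
  show "L2_set (\<lambda>i. x i - z i) {..<N} \<le> L2_set (\<lambda>i. x i - y i) {..<N} + L2_set (\<lambda>i. y i - z i) {..<N}"
    using L2_set_triangle_ineq [of "\<lambda>i. x i - y i" "\<lambda>i. y i - z i" "{..<N}"] by simp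
  assume "x \<in> {x. \<forall>i\<ge>N. x i = 0}" "y \<in> {x. \<forall>i\<ge>N. x i = 0}"
  then have "(\<forall>i<N. x i = y i) \<longleftrightarrow> x = y"
    by (auto simp: fun_eq_iff) (metis not_le)
  then show "L2_set (\<lambda>i. x i - y i) {..<N} = 0 \<longleftrightarrow> x = y"
    by (auto simp: L2_set_eq_0_iff)
qed auto

lemma mspace_Euclidean_metric [simp]: "mspace (Euclidean_metric N) = {x. \<forall>i\<ge>N. x i = 0}"
  and mdist_Euclidean_metric [simp]:
    "mdist (Euclidean_metric N) x y = L2_set (\<lambda>i. x i - y i) {..<N}"
  by (simp_all add: Euclidean_metric_def Metric_space_Euclidean Metric_space.mspace_metric
      Metric_space.mdist_metric)


section \<open>Diameter, Hausdorff measure, Ahlfors regularity, doubling\<close>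

definition ediam :: "'a metric \<Rightarrow> 'a set \<Rightarrow> ennreal" where
  "ediam X A = (SUP x\<in>A. SUP y\<in>A. ennreal (mdist X x y))"

text \<open>The summand \<open>diam(U)\<^sup>s\<close> in the Hausdorff sums, with the conventions that the empty set
  contributes \<open>0\<close> and, for \<open>s = 0\<close>, every non-empty set contributes \<open>1\<close>. It is only used for
  sets of finite diameter. The measure below is not multiplied by a dimensional constant;
  such a constant affects neither Ahlfors regularity nor the positivity of the measure.\<close>

definition hausdorff_weight :: "'a metric \<Rightarrow> real \<Rightarrow> 'a set \<Rightarrow> ennreal" where
  "hausdorff_weight X s U =
     (if U = {} then 0 else if s = 0 then 1 else ennreal (enn2real (ediam X U) powr s))"

definition hausdorff_content :: "'a metric \<Rightarrow> real \<Rightarrow> real \<Rightarrow> 'a set \<Rightarrow> ennreal" where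
  "hausdorff_content X s \<delta> A =
     (INF U \<in> {U :: nat \<Rightarrow> 'a set. (\<forall>i. U i \<subseteq> mspace X \<and> ediam X (U i) \<le> ennreal \<delta>) \<and> A \<subseteq> (\<Union>i. U i)}.
        \<Sum>i. hausdorff_weight X s (U i))"

definition hausdorff_measure :: "'a metric \<Rightarrow> real \<Rightarrow> 'a set \<Rightarrow> ennreal" where
  "hausdorff_measure X s A = (SUP \<delta>\<in>{0<..}. hausdorff_content X s \<delta> A)"

definition ahlfors_regular :: "real \<Rightarrow> 'a metric \<Rightarrow> bool" where
  "ahlfors_regular s X \<longleftrightarrow>
     (\<exists>C>0. \<forall>x\<in>mspace X. \<forall>r>0. ennreal r \<le> ediam X (mspace X) \<longrightarrow>
        ennreal (r powr s / C) \<le> hausdorff_measure X s (mcball_of X x r) \<and>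
        hausdorff_measure X s (mcball_of X x r) \<le> ennreal (C * r powr s))"

definition doubling_metric :: "'a metric \<Rightarrow> bool" where
  "doubling_metric X \<longleftrightarrow>
     (\<exists>N. \<forall>x\<in>mspace X. \<forall>r>0. \<exists>S\<subseteq>mspace X. finite S \<and> card S \<le> N \<and>
        mball_of X x r \<subseteq> (\<Union>y\<in>S. mball_of X y (r / 2)))"


section \<open>Lipschitz dimension\<close>

definition is_rpath :: "'a metric \<Rightarrow> real \<Rightarrow> 'a list \<Rightarrow> bool" where
  "is_rpath X r xs \<longleftrightarrow> set xs \<subseteq> mspace X \<and>
     (\<forall>i. Suc i < length xs \<longrightarrow> mdist X (xs ! i) (xs ! Suc i) \<le> r)"

definition same_rcomponent :: "'a metric \<Rightarrow> real \<Rightarrow> 'a \<Rightarrow> 'a \<Rightarrow> bool" where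
  "same_rcomponent X r x y \<longleftrightarrow> (\<exists>xs. is_rpath X r xs \<and> x \<in> set xs \<and> y \<in> set xs)"

definition rcomponents :: "'a metric \<Rightarrow> real \<Rightarrow> 'a set set" where
  "rcomponents X r = {{y. same_rcomponent X r x y} | x. x \<in> mspace X}"

definition lipschitz_light :: "'a metric \<Rightarrow> 'b metric \<Rightarrow> ('a \<Rightarrow> 'b) \<Rightarrow> bool" where
  "lipschitz_light X Y f \<longleftrightarrow> f \<in> mspace X \<rightarrow> mspace Y \<and>
     (\<exists>C>0. (\<forall>x\<in>mspace X. \<forall>y\<in>mspace X. mdist Y (f x) (f y) \<le> C * mdist X x y) \<and>
       (\<forall>r>0. \<forall>W\<subseteq>mspace Y. ediam Y W \<le> ennreal r \<longrightarrow>
         (\<forall>K\<in>rcomponents (submetric X (f -` W)) r. ediam X K \<le> ennreal (C * r))))"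

text \<open>The infimum of the empty set in \<^typ>\<open>enat\<close> is \<open>\<infinity>\<close>.\<close>

definition lipschitz_dim :: "'a metric \<Rightarrow> enat" where
  "lipschitz_dim X = (INF k \<in> {k. \<exists>f. lipschitz_light X (Euclidean_metric k) f}. enat k)"


section \<open>Convergence of sets, maps and pointed spaces; weak tangents\<close>

text \<open>Extended distances are used so that suprema over empty sets are \<open>0\<close>.\<close>

definition dist_to_set :: "'a metric \<Rightarrow> 'a \<Rightarrow> 'a set \<Rightarrow> ennreal" where
  "dist_to_set X x A = (INF y\<in>A. ennreal (mdist X x y))"

definition sets_converge ::
    "nat \<Rightarrow> (nat \<Rightarrow> (nat \<Rightarrow> real) set) \<Rightarrow> (nat \<Rightarrow> real) set \<Rightarrow> bool" where
  "sets_converge N F F' \<longleftrightarrow>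
     (let E = Euclidean_metric N in
       (\<forall>j. F j \<noteq> {} \<and> closedin (mtopology_of E) (F j)) \<and>
       F' \<noteq> {} \<and> closedin (mtopology_of E) F' \<and>
       (\<forall>R>0. (\<lambda>j. SUP x\<in>F j \<inter> mball_of E (\<lambda>_. 0) R. dist_to_set E x F') \<longlonglongrightarrow> 0) \<and>
       (\<forall>R>0. (\<lambda>j. SUP y\<in>F' \<inter> mball_of E (\<lambda>_. 0) R. dist_to_set E y (F j)) \<longlonglongrightarrow> 0))"

definition maps_converge ::
    "'a metric \<Rightarrow> 'b metric \<Rightarrow> (nat \<Rightarrow> 'a set) \<Rightarrow> (nat \<Rightarrow> 'a \<Rightarrow> 'b) \<Rightarrow> 'a set \<Rightarrow> ('a \<Rightarrow> 'b) \<Rightarrow> bool" where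
  "maps_converge P S F f F' f' \<longleftrightarrow>
     (\<forall>x x'. (\<forall>j. x j \<in> F j) \<and> x' \<in> F' \<and> limitin (mtopology_of P) x x' sequentially \<longrightarrow>
        limitin (mtopology_of S) (\<lambda>j. f j (x j)) (f' x') sequentially)"

definition bilipschitz_embedding :: "real \<Rightarrow> 'a metric \<Rightarrow> 'b metric \<Rightarrow> ('a \<Rightarrow> 'b) \<Rightarrow> bool" where
  "bilipschitz_embedding L X Y e \<longleftrightarrow> e \<in> mspace X \<rightarrow> mspace Y \<and>
     (\<forall>x\<in>mspace X. \<forall>y\<in>mspace X.
        mdist X x y / L \<le> mdist Y (e x) (e y) \<and> mdist Y (e x) (e y) \<le> L * mdist X x y)"

text \<open>The distance of \<open>X\<close> transported to the image of the injective map \<open>e\<close>; the product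
  \<open>\<real>\<^sup>N \<times> \<real>\<^sup>N\<close> on which these functions live below carries its Euclidean product metric.\<close>

definition transported_dist :: "'a metric \<Rightarrow> ('a \<Rightarrow> 'b) \<Rightarrow> 'b \<times> 'b \<Rightarrow> real" where
  "transported_dist X e = (\<lambda>(u, v). mdist X (inv_into (mspace X) e u) (inv_into (mspace X) e v))"

definition pointed_spaces_converge ::
    "(nat \<Rightarrow> 'a metric) \<Rightarrow> (nat \<Rightarrow> 'a) \<Rightarrow> 'b metric \<Rightarrow> 'b \<Rightarrow> bool" where
  "pointed_spaces_converge X p X' p' \<longleftrightarrow>
     (\<forall>j. p j \<in> mspace (X j)) \<and> p' \<in> mspace X' \<and>
     (\<exists>\<alpha> N L e e'. 0 < \<alpha> \<and> \<alpha> \<le> 1 \<and> 1 \<le> L \<and>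
        (\<forall>j. bilipschitz_embedding L (snowflake_metric \<alpha> (X j)) (Euclidean_metric N) (e j) \<and>
             e j (p j) = (\<lambda>_. 0)) \<and>
        bilipschitz_embedding L (snowflake_metric \<alpha> X') (Euclidean_metric N) e' \<and>
        e' p' = (\<lambda>_. 0) \<and>
        sets_converge N (\<lambda>j. e j ` mspace (X j)) (e' ` mspace X') \<and>
        maps_converge
          (prod_metric (Euclidean_metric N) (Euclidean_metric N)) (euclidean_metric :: real metric)
          (\<lambda>j. e j ` mspace (X j) \<times> e j ` mspace (X j)) (\<lambda>j. transported_dist (X j) (e j))
          (e' ` mspace X' \<times> e' ` mspace X') (transported_dist X' e'))"

definition weak_tangent :: "'a metric \<Rightarrow> 'b metric \<Rightarrow> 'b \<Rightarrow> bool" where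
  "weak_tangent X T t \<longleftrightarrow>
     (\<exists>c p. (\<forall>k. 0 < c k \<and> p k \<in> mspace X) \<and>
        pointed_spaces_converge (\<lambda>k. scaled_metric (c k) X) p T t)"

text \<open>Every weak tangent embeds injectively into some \<open>\<real>\<^sup>N\<close>, so up to a pointed isometry it has
  its carrier in \<^typ>\<open>nat \<Rightarrow> real\<close>. Asserting the existence of weak tangents with carrier in that
  type is therefore no restriction.\<close>

lemma weak_tangent_concrete:
  assumes "weak_tangent X T t"
  obtains T' :: "(nat \<Rightarrow> real) metric" and t' h where
    "weak_tangent X T' t'" "bij_betw h (mspace T) (mspace T')" "h t = t'"
    "\<And>x y. x \<in> mspace T \<Longrightarrow> y \<in> mspace T \<Longrightarrow> mdist T' (h x) (h y) = mdist T x y"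
proof -
  obtain c p \<alpha> N L e e' where c: "\<forall>k. 0 < c k \<and> p k \<in> mspace X"
    and p: "\<forall>j. p j \<in> mspace (scaled_metric (c j) X)" and t: "t \<in> mspace T"
    and \<alpha>: "0 < \<alpha>" "\<alpha> \<le> 1" and L: "1 \<le> L"
    and e: "\<forall>j. bilipschitz_embedding L (snowflake_metric \<alpha> (scaled_metric (c j) X)) (Euclidean_metric N) (e j) \<and>
             e j (p j) = (\<lambda>_. 0)"
    and e': "bilipschitz_embedding L (snowflake_metric \<alpha> T) (Euclidean_metric N) e'"
    and e'0: "e' t = (\<lambda>_. 0)"
    and sc: "sets_converge N (\<lambda>j. e j ` mspace (scaled_metric (c j) X)) (e' ` mspace T)"
    and mc: "maps_converge
          (prod_metric (Euclidean_metric N) (Euclidean_metric N)) (euclidean_metric :: real metric)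
          (\<lambda>j. e j ` mspace (scaled_metric (c j) X) \<times> e j ` mspace (scaled_metric (c j) X))
          (\<lambda>j. transported_dist (scaled_metric (c j) X) (e j))
          (e' ` mspace T \<times> e' ` mspace T) (transported_dist T e')"
    using assms unfolding weak_tangent_def pointed_spaces_converge_def
    by (elim exE conjE) (rule that; assumption)
  interpret T: Metric_space "mspace T" "mdist T" by simp
  have inj: "inj_on e' (mspace T)"
  proof (rule inj_onI)
    fix x y assume xy: "x \<in> mspace T" "y \<in> mspace T" "e' x = e' y"
    have "mdist T x y powr \<alpha> / L \<le> mdist (Euclidean_metric N) (e' x) (e' y)"
      using e' xy(1,2) \<alpha> unfolding bilipschitz_embedding_def
      by (simp del: mdist_Euclidean_metric)
    also have "\<dots> = 0"
      using xy(3) by (simp add: L2_set_def)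
    finally have "mdist T x y powr \<alpha> \<le> 0"
      using L by (simp add: divide_le_0_iff)
    then show "x = y" using xy by simp
  qed
  define d where "d u v = transported_dist T e' (u, v)" for u v
  have dd: "d (e' x) (e' y) = mdist T x y" if "x \<in> mspace T" "y \<in> mspace T" for x y
    using that inj by (simp add: d_def transported_dist_def)
  have M: "Metric_space (e' ` mspace T) d"
  proof
    show "0 \<le> d u v" and "d u v = d v u" for u v
      by (simp_all add: d_def transported_dist_def T.commute)
    show "d u v = 0 \<longleftrightarrow> u = v" if "u \<in> e' ` mspace T" "v \<in> e' ` mspace T" for u v
      using that by (auto simp: dd)
    show "d u w \<le> d u v + d v w"
      if "u \<in> e' ` mspace T" "v \<in> e' ` mspace T" "w \<in> e' ` mspace T" for u v w
      using that T.triangle by (auto simp: dd)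
  qed
  define T' where "T' = metric (e' ` mspace T, d)"
  have T': "mspace T' = e' ` mspace T" "mdist T' = d"
    by (simp_all add: T'_def M Metric_space.mspace_metric Metric_space.mdist_metric)
  have 1: "bilipschitz_embedding L (snowflake_metric \<alpha> T') (Euclidean_metric N) (\<lambda>u. u)"
    using e' \<alpha> unfolding bilipschitz_embedding_def
    by (auto simp: T' dd simp del: mdist_Euclidean_metric mspace_Euclidean_metric)
  have tr: "transported_dist T' (\<lambda>u. u) z = transported_dist T e' z"
    if "z \<in> e' ` mspace T \<times> e' ` mspace T" for z
  proof -
    have "inv_into (e' ` mspace T) (\<lambda>u. u) u = u" if "u \<in> e' ` mspace T" for u
      using that by (intro inv_into_f_eq) auto
    then show ?thesis using that by (auto simp: transported_dist_def T' d_def)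
  qed
  have 2: "maps_converge
          (prod_metric (Euclidean_metric N) (Euclidean_metric N)) (euclidean_metric :: real metric)
          (\<lambda>j. e j ` mspace (scaled_metric (c j) X) \<times> e j ` mspace (scaled_metric (c j) X))
          (\<lambda>j. transported_dist (scaled_metric (c j) X) (e j))
          (e' ` mspace T \<times> e' ` mspace T) (transported_dist T' (\<lambda>u. u))"
    using mc unfolding maps_converge_def by (simp add: tr del: mspace_scaled_metric)
  have "pointed_spaces_converge (\<lambda>k. scaled_metric (c k) X) p T' (\<lambda>_. 0)"
    unfolding pointed_spaces_converge_def
  proof (intro conjI)
    show "\<forall>j. p j \<in> mspace (scaled_metric (c j) X)" by (rule p)
    show "(\<lambda>_. 0) \<in> mspace T'"
      using t e'0 unfolding T' by force
    show "\<exists>\<alpha> N L e e'. 0 < \<alpha> \<and> \<alpha> \<le> 1 \<and> 1 \<le> L \<and>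
        (\<forall>j. bilipschitz_embedding L (snowflake_metric \<alpha> (scaled_metric (c j) X)) (Euclidean_metric N) (e j) \<and>
             e j (p j) = (\<lambda>_. 0)) \<and>
        bilipschitz_embedding L (snowflake_metric \<alpha> T') (Euclidean_metric N) e' \<and>
        e' (\<lambda>_. 0) = (\<lambda>_. 0) \<and>
        sets_converge N (\<lambda>j. e j ` mspace (scaled_metric (c j) X)) (e' ` mspace T') \<and>
        maps_converge
          (prod_metric (Euclidean_metric N) (Euclidean_metric N)) (euclidean_metric :: real metric)
          (\<lambda>j. e j ` mspace (scaled_metric (c j) X) \<times> e j ` mspace (scaled_metric (c j) X))
          (\<lambda>j. transported_dist (scaled_metric (c j) X) (e j))
          (e' ` mspace T' \<times> e' ` mspace T') (transported_dist T' e')"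
      apply (rule exI[of _ \<alpha>], rule exI[of _ N], rule exI[of _ L], rule exI[of _ e], rule exI[of _ "\<lambda>u. u"])
      using \<alpha> L e 1 sc 2 by (simp only: T' image_ident simp_thms)
  qed
  then have "weak_tangent X T' (\<lambda>_. 0)"
    using c unfolding weak_tangent_def by blast
  moreover have "bij_betw e' (mspace T) (mspace T')"
    using inj by (simp add: T' bij_betw_def)
  ultimately show thesis
    using that e'0 dd T' by metis
qed

end

theory Submission
  imports Defs
begin

text \<open>
  A blow-up of \<open>g\<close> is a map from a weak tangent of \<open>X\<close> to a weak tangent of \<open>Y\<close>. If this map is
  Lipschitz light, then composing it with a Lipschitz light map from the tangent of \<open>Y\<close> to a
  Euclidean space shows that the tangent of \<open>X\<close> has at most the Lipschitz dimension of the tangent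
  of \<open>Y\<close>. The latter is at most the Lipschitz dimension of \<open>Y\<close>, because light maps survive
  blowing up (\<open>light_map_to_ultralimit\<close>); this gives the second assertion.

  A blow-up is light as soon as it is everywhere defined and its multiplicity is bounded at every
  scale: a long path over a small set contains many separated points with nearby images
  (\<open>rpath_separated_points\<close>, \<open>light_ultralimit_map\<close>). The heart of the matter is therefore to find
  locations and scales at which \<open>Z\<close> is nearly dense and \<open>g\<close> has bounded multiplicity
  (\<open>good_scales_exist\<close>). Where this fails, \<open>Z\<close> has a hole or \<open>g\<close> folds many disjoint balls onto
  one set, and in either case a piece of \<open>g ` Z\<close> is covered more cheaply than the measure of the
  corresponding piece of \<open>X\<close> would suggest. If it failed everywhere for every
  bound on the multiplicity, the savings would exhaust \<open>Z\<close>
  and \<open>g ` Z\<close> would have arbitrarily small content, against \<open>hausdorff_measure Y n (g ` Z) > 0\<close>.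

  Weak tangents are built from Assouad's theorem (\<open>assouad_embedding\<close>), which embeds the square
  root of a doubling metric in a Euclidean space. The rescaled images have a limit along a free
  ultrafilter on the indices, and a sequence of indices can be chosen along which they converge in
  the ordinary sense (\<open>weak_tangent_T\<close>). The same ultrafilter is used for both spaces and for the
  maps.
\<close>

section \<open>Hausdorff measure of separated sets\<close>

lemma mdist_self [simp]: "x \<in> mspace X \<Longrightarrow> mdist X x x = 0"
  by simp

lemma ediam_le_iff:
  assumes "0 \<le> D"
  shows "ediam X A \<le> ennreal D \<longleftrightarrow> (\<forall>x\<in>A. \<forall>y\<in>A. mdist X x y \<le> D)"
  using assms by (auto simp: ediam_def SUP_le_iff ennreal_le_iff)

lemma hausdorff_weight_le:
  assumes "0 \<le> s" "0 < D" "\<And>x y. x \<in> A \<Longrightarrow> y \<in> A \<Longrightarrow> mdist X x y \<le> D"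
  shows "hausdorff_weight X s A \<le> ennreal (D powr s)"
proof -
  have "ediam X A \<le> ennreal D"
    using assms by (simp add: ediam_le_iff)
  then have "enn2real (ediam X A) \<le> D"
    using assms(2) by (simp add: enn2real_leI)
  then have "enn2real (ediam X A) powr s \<le> D powr s"
    by (intro powr_mono2 assms) auto
  then show ?thesis
    using assms by (auto simp: hausdorff_weight_def ennreal_leI)
qed

lemma hausdorff_weight_empty [simp]: "hausdorff_weight X s {} = 0"
  by (simp add: hausdorff_weight_def)

lemma hausdorff_content_mono: "A \<subseteq> B \<Longrightarrow> hausdorff_content X s \<delta> A \<le> hausdorff_content X s \<delta> B"
  unfolding hausdorff_content_def by (rule INF_superset_mono) auto

lemma hausdorff_content_antimono:
  "\<delta> \<le> \<delta>' \<Longrightarrow> hausdorff_content X s \<delta>' A \<le> hausdorff_content X s \<delta> A"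
  unfolding hausdorff_content_def
  by (rule INF_superset_mono) (auto intro: order_trans ennreal_leI)

lemma hausdorff_measure_mono: "A \<subseteq> B \<Longrightarrow> hausdorff_measure X s A \<le> hausdorff_measure X s B"
  unfolding hausdorff_measure_def by (intro SUP_mono') (rule hausdorff_content_mono)

lemma hausdorff_content_le_finite_cover:
  assumes "0 \<le> s" "finite I" "A \<subseteq> (\<Union>i\<in>I. V i)"
    and V: "\<And>i. i \<in> I \<Longrightarrow> V i \<subseteq> mspace X"
    and D: "\<And>i. i \<in> I \<Longrightarrow> 0 < D i \<and> D i \<le> \<delta>"
    and VD: "\<And>i x y. i \<in> I \<Longrightarrow> x \<in> V i \<Longrightarrow> y \<in> V i \<Longrightarrow> mdist X x y \<le> D i"
  shows "hausdorff_content X s \<delta> A \<le> ennreal (\<Sum>i\<in>I. D i powr s)"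
proof -
  obtain h where h: "bij_betw h {..<card I} I"
    using \<open>finite I\<close> by (metis atLeast0LessThan ex_bij_betw_nat_finite)
  define U where "U k = (if k < card I then V (h k) else {})" for k
  have hI: "h k \<in> I" if "k < card I" for k
    using h that by (auto simp: bij_betw_def)
  have "A \<subseteq> (\<Union>k. U k)"
  proof
    fix x assume "x \<in> A"
    then obtain i where i: "i \<in> I" "x \<in> V i" using assms(3) by auto
    then obtain k where "k < card I" "i = h k"
      using h by (auto simp: bij_betw_def)
    with i show "x \<in> (\<Union>k. U k)" by (auto simp: U_def)
  qed
  moreover have "U k \<subseteq> mspace X \<and> ediam X (U k) \<le> ennreal \<delta>" for k
  proof (cases "k < card I")
    case True
    have "mdist X x y \<le> \<delta>" if "x \<in> V (h k)" "y \<in> V (h k)" for x y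
      using VD[OF hI[OF True] that] D[OF hI[OF True]] by linarith
    moreover have "0 \<le> \<delta>" using D[OF hI[OF True]] by linarith
    ultimately show ?thesis using V[OF hI[OF True]] True by (auto simp: U_def ediam_le_iff)
  qed (auto simp: U_def ediam_def)
  ultimately have "hausdorff_content X s \<delta> A \<le> (\<Sum>k. hausdorff_weight X s (U k))"
    unfolding hausdorff_content_def by (intro INF_lower) auto
  also have "\<dots> = (\<Sum>k<card I. hausdorff_weight X s (U k))"
    by (rule suminf_finite) (auto simp: U_def)
  also have "\<dots> \<le> (\<Sum>k<card I. ennreal (D (h k) powr s))"
    using D V VD hI assms(1) by (intro sum_mono) (auto simp: U_def intro!: hausdorff_weight_le)
  also have "\<dots> = (\<Sum>i\<in>I. ennreal (D i powr s))"
    by (rule sum.reindex_bij_betw[OF h])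
  also have "\<dots> = ennreal (\<Sum>i\<in>I. D i powr s)"
    by (simp add: sum_ennreal)
  finally show ?thesis .
qed

text \<open>A set of diameter below the gap between \<open>A\<close> and \<open>B\<close> meets at most one of them, so a fine
  cover of the union splits into covers of the two parts. Below, this takes the role of additivity:
  measures of finitely many disjoint balls are compared with that of a ball containing them.\<close>

lemma hausdorff_measure_superadditive:
  assumes t: "0 < t" "\<And>a b. a \<in> A \<Longrightarrow> b \<in> B \<Longrightarrow> t \<le> mdist X a b"
  shows "hausdorff_measure X s A + hausdorff_measure X s B \<le> hausdorff_measure X s (A \<union> B)"
proof -
  let ?c = "hausdorff_content X s"
  have small: "?c \<delta> A + ?c \<delta> B \<le> ?c \<delta> (A \<union> B)" if \<delta>: "0 < \<delta>" "\<delta> < t" for \<delta>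
    unfolding hausdorff_content_def[of X s \<delta> "A \<union> B"]
  proof (rule INF_greatest, clarify)
    fix U assume U: "\<forall>i::nat. U i \<subseteq> mspace X \<and> ediam X (U i) \<le> ennreal \<delta>" "A \<union> B \<subseteq> (\<Union>i. U i)"
    define V where "V i = (if U i \<inter> A = {} then {} else U i)" for i
    define W where "W i = (if U i \<inter> B = {} then {} else U i)" for i
    have one: "U i \<inter> A = {} \<or> U i \<inter> B = {}" for i
    proof (rule ccontr)
      assume "\<not> ?thesis"
      then obtain a b where ab: "a \<in> U i" "a \<in> A" "b \<in> U i" "b \<in> B" by auto
      have "ediam X (U i) \<le> ennreal \<delta>" using U by blast
      with ab \<delta> have "mdist X a b \<le> \<delta>" by (subst (asm) ediam_le_iff) auto
      then show False using t(2)[of a b] ab \<delta> by linarith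
    qed
    have e: "ediam X {} \<le> ennreal \<delta>" by (simp add: ediam_def)
    have "?c \<delta> A \<le> (\<Sum>i. hausdorff_weight X s (V i))"
      unfolding hausdorff_content_def using U
      by (intro INF_lower) (auto simp: V_def e; blast)
    moreover have "?c \<delta> B \<le> (\<Sum>i. hausdorff_weight X s (W i))"
      unfolding hausdorff_content_def using U
      by (intro INF_lower) (auto simp: W_def e; blast)
    ultimately have "?c \<delta> A + ?c \<delta> B \<le>
        (\<Sum>i. hausdorff_weight X s (V i)) + (\<Sum>i. hausdorff_weight X s (W i))"
      by (rule add_mono)
    also have "\<dots> = (\<Sum>i. hausdorff_weight X s (V i) + hausdorff_weight X s (W i))"
      by (rule suminf_add) auto
    also have "\<dots> \<le> (\<Sum>i. hausdorff_weight X s (U i))"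
    proof (rule suminf_le)
      show "hausdorff_weight X s (V i) + hausdorff_weight X s (W i) \<le> hausdorff_weight X s (U i)" for i
        using one[of i] by (auto simp: V_def W_def)
    qed auto
    finally show "?c \<delta> A + ?c \<delta> B \<le> (\<Sum>i. hausdorff_weight X s (U i))" .
  qed
  have "?c \<delta> A + ?c \<delta>' B \<le> hausdorff_measure X s (A \<union> B)" if "0 < \<delta>" "0 < \<delta>'" for \<delta> \<delta>'
  proof -
    define \<epsilon> where "\<epsilon> = Min {\<delta>, \<delta>', t / 2}"
    have \<epsilon>: "0 < \<epsilon>" "\<epsilon> < t" "\<epsilon> \<le> \<delta>" "\<epsilon> \<le> \<delta>'"
      using that t by (auto simp: \<epsilon>_def min_def)
    have "?c \<delta> A + ?c \<delta>' B \<le> ?c \<epsilon> A + ?c \<epsilon> B"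
      using \<epsilon> by (intro add_mono hausdorff_content_antimono)
    also have "\<dots> \<le> ?c \<epsilon> (A \<union> B)" using \<epsilon> by (intro small)
    also have "\<dots> \<le> hausdorff_measure X s (A \<union> B)"
      unfolding hausdorff_measure_def using \<epsilon> by (intro SUP_upper) auto
    finally show ?thesis .
  qed
  moreover have "hausdorff_measure X s A + hausdorff_measure X s B =
      (SUP \<delta>\<in>{0<..}. SUP \<delta>'\<in>{0<..}. ?c \<delta> A + ?c \<delta>' B)"
    unfolding hausdorff_measure_def
    by (subst ennreal_SUP_add_left[symmetric], simp,
        intro SUP_cong refl, subst ennreal_SUP_add_right[symmetric]) auto
  ultimately show ?thesis
    by (auto intro!: SUP_least)
qed

lemma hausdorff_measure_sum_le:
  assumes "finite I"
    and "\<And>i j. i \<in> I \<Longrightarrow> j \<in> I \<Longrightarrow> i \<noteq> j \<Longrightarrow> \<exists>t>0. \<forall>a\<in>A i. \<forall>b\<in>A j. t \<le> mdist X a b"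
  shows "(\<Sum>i\<in>I. hausdorff_measure X s (A i)) \<le> hausdorff_measure X s (\<Union>i\<in>I. A i)"
  using assms
proof (induction I rule: finite_induct)
  case (insert i I)
  have "\<forall>j\<in>I. \<exists>t>0. \<forall>a\<in>A i. \<forall>b\<in>A j. t \<le> mdist X a b"
    using insert by (metis insertCI)
  then obtain t where t: "\<forall>j\<in>I. t j > 0 \<and> (\<forall>a\<in>A i. \<forall>b\<in>A j. t j \<le> mdist X a b)"
    by metis
  define T where "T = Min (insert 1 (t ` I))"
  have T: "0 < T" using t insert(1) by (auto simp: T_def)
  have Tj: "T \<le> t j" if "j \<in> I" for j using that insert(1) by (auto simp: T_def)
  have sep: "T \<le> mdist X a b" if ab: "a \<in> A i" "b \<in> (\<Union>j\<in>I. A j)" for a b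
  proof -
    from ab obtain j where j: "j \<in> I" "b \<in> A j" by auto
    with t ab Tj[OF j(1)] show ?thesis by force
  qed
  have "(\<Sum>j\<in>insert i I. hausdorff_measure X s (A j)) \<le>
      hausdorff_measure X s (A i) + hausdorff_measure X s (\<Union>j\<in>I. A j)"
    using insert by (auto intro!: add_left_mono)
  also have "\<dots> \<le> hausdorff_measure X s (A i \<union> (\<Union>j\<in>I. A j))"
    by (rule hausdorff_measure_superadditive[OF T sep])
  finally show ?case by simp
qed auto

text \<open>The pair \<open>(q, r)\<close> stands for the closed ball of radius \<open>r\<close> about \<open>q\<close>. Disjointness is asked
  for in the form \<open>r + r' < mdist X q q'\<close>, which makes the balls positively separated.\<close>

definition separated_balls :: "'a metric \<Rightarrow> ('a \<times> real) set \<Rightarrow> bool" where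
  "separated_balls X Q \<longleftrightarrow> finite Q \<and> (\<forall>(q, r)\<in>Q. q \<in> mspace X \<and> 0 < r) \<and>
     (\<forall>(q, r)\<in>Q. \<forall>(q', r')\<in>Q. (q, r) \<noteq> (q', r') \<longrightarrow> r + r' < mdist X q q')"

lemma ediam_mspace_zero:
  assumes "ediam X (mspace X) = 0" "x \<in> mspace X" "y \<in> mspace X"
  shows "x = y"
proof -
  have "ediam X (mspace X) \<le> ennreal 0" using assms by simp
  then have "mdist X x y \<le> 0" using assms by (subst (asm) ediam_le_iff) auto
  then show ?thesis using assms mdist_nonneg[of X x y] by (simp del: mdist_nonneg)
qed

text \<open>Disjoint balls inside a ball of radius \<open>R\<close> have total measure at most that of the big ball.
  Regularity bounds the measure of the small balls from below and that of the big one from above;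
  if \<open>R\<close> exceeds the diameter, the big ball is the whole space and the diameter takes its place.\<close>

lemma ahlfors_separated_balls_sum:
  assumes "ahlfors_regular n X" "0 \<le> n"
  obtains C where "C > 0"
    "\<And>Q x R. separated_balls X Q \<Longrightarrow> x \<in> mspace X \<Longrightarrow> 0 < R \<Longrightarrow>
       (\<And>q r. (q, r) \<in> Q \<Longrightarrow> mdist X x q + r \<le> R \<and> ennreal r \<le> ediam X (mspace X)) \<Longrightarrow>
       (\<Sum>(q, r)\<in>Q. r powr n) \<le> C * R powr n"
proof -
  obtain C where C: "C > 0" and reg: "\<And>x r. x \<in> mspace X \<Longrightarrow> 0 < r \<Longrightarrow> ennreal r \<le> ediam X (mspace X) \<Longrightarrow>
        ennreal (r powr n / C) \<le> hausdorff_measure X n (mcball_of X x r) \<and>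
        hausdorff_measure X n (mcball_of X x r) \<le> ennreal (C * r powr n)"
    using assms(1) unfolding ahlfors_regular_def by blast
  have "(\<Sum>(q, r)\<in>Q. r powr n) \<le> C * C * R powr n"
    if Q: "separated_balls X Q" and x: "x \<in> mspace X" and R: "0 < R"
      and QR: "\<And>q r. (q, r) \<in> Q \<Longrightarrow> mdist X x q + r \<le> R \<and> ennreal r \<le> ediam X (mspace X)"
    for Q x R
  proof (cases "Q = {}")
    case True
    then show ?thesis using C by simp
  next
    case False
    have fin: "finite Q" and Qp: "\<And>q r. (q, r) \<in> Q \<Longrightarrow> q \<in> mspace X \<and> 0 < r"
      and sep: "\<And>q r q' r'. (q, r) \<in> Q \<Longrightarrow> (q', r') \<in> Q \<Longrightarrow> (q, r) \<noteq> (q', r') \<Longrightarrow> r + r' < mdist X q q'"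
      using Q unfolding separated_balls_def by fast+
    have upper: "hausdorff_measure X n (mcball_of X x R) \<le> ennreal (C * R powr n)"
    proof (cases "ennreal R \<le> ediam X (mspace X)")
      case False
      then obtain D where D: "ediam X (mspace X) = ennreal D" "0 \<le> D" "D < R"
        by (metis ennreal_cases ennreal_less_iff not_le top_greatest)
      obtain q r where "(q, r) \<in> Q" using \<open>Q \<noteq> {}\<close> by auto
      then have "0 < D" using QR[of q r] Qp[of q r] D by (simp add: ennreal_le_iff)
      have "mdist X y z \<le> D" if "y \<in> mspace X" "z \<in> mspace X" for y z
        using D that ediam_le_iff[of D X "mspace X"] by auto
      then have "mcball_of X x R \<subseteq> mcball_of X x D" using x by auto
      then have "hausdorff_measure X n (mcball_of X x R) \<le> hausdorff_measure X n (mcball_of X x D)"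
        by (rule hausdorff_measure_mono)
      also have "\<dots> \<le> ennreal (C * D powr n)"
        using reg[OF x \<open>0 < D\<close>] D by simp
      also have "\<dots> \<le> ennreal (C * R powr n)"
        using C D assms(2) by (intro ennreal_leI mult_left_mono powr_mono2) auto
      finally show ?thesis .
    qed (use reg[OF x R] in auto)
    have "ennreal (\<Sum>(q, r)\<in>Q. r powr n / C) = (\<Sum>(q, r)\<in>Q. ennreal (r powr n / C))"
      using C by (subst sum_ennreal[symmetric]) (auto simp: case_prod_unfold)
    also have "\<dots> \<le> (\<Sum>z\<in>Q. hausdorff_measure X n (case z of (q, r) \<Rightarrow> mcball_of X q r))"
      using reg Qp QR by (intro sum_mono) (auto split: prod.splits)
    also have "\<dots> \<le> hausdorff_measure X n (\<Union>z\<in>Q. case z of (q, r) \<Rightarrow> mcball_of X q r)"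
    proof (rule hausdorff_measure_sum_le[OF fin])
      fix i j assume ij: "i \<in> Q" "j \<in> Q" "i \<noteq> j"
      obtain q r q' r' where [simp]: "i = (q, r)" "j = (q', r')" by fastforce
      have "mdist X q q' - (r + r') \<le> mdist X a b" if "a \<in> mcball_of X q r" "b \<in> mcball_of X q' r'" for a b
        using that mdist_triangle[of q X a q'] mdist_triangle[of a X b q'] mdist_commute[of X b q'] by auto
      then show "\<exists>t>0. \<forall>a\<in>case i of (q, r) \<Rightarrow> mcball_of X q r. \<forall>b\<in>case j of (q, r) \<Rightarrow> mcball_of X q r.
          t \<le> mdist X a b"
        using sep[of q r q' r'] ij by (intro exI[of _ "mdist X q q' - (r + r')"]) auto
    qed
    also have "\<dots> \<le> hausdorff_measure X n (mcball_of X x R)"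
    proof (rule hausdorff_measure_mono, clarsimp simp: x)
      fix y q r assume "(q, r) \<in> Q" "q \<in> mspace X" "y \<in> mspace X" "mdist X q y \<le> r"
      then show "mdist X x y \<le> R"
        using QR[of q r] mdist_triangle[of x X q y] x by linarith
    qed
    also note upper
    finally have "(\<Sum>(q, r)\<in>Q. r powr n / C) \<le> C * R powr n"
      using C by (simp add: ennreal_le_iff)
    then show ?thesis
      using C by (simp add: case_prod_unfold field_simps flip: sum_divide_distrib)
  qed
  then show thesis using that[of "C * C"] C by simp
qed

text \<open>The doubling condition for one fixed ratio of radii. The factor \<open>16\<close> is the ratio of the two
  distances \<open>4 * s\<close> and \<open>s / 4\<close> that occur in the colouring argument for the embedding theorem.\<close>

definition packing_bound :: "'a metric \<Rightarrow> nat \<Rightarrow> bool" where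
  "packing_bound X M \<longleftrightarrow>
     (\<forall>x\<in>mspace X. \<forall>r>0. \<forall>S\<subseteq>mball_of X x (16 * r).
        finite S \<and> (\<forall>v\<in>S. \<forall>w\<in>S. v \<noteq> w \<longrightarrow> r \<le> mdist X v w) \<longrightarrow> card S \<le> M)"

text \<open>Five halvings cover a ball of radius \<open>16 * r\<close> by balls of radius \<open>r / 2\<close>, and two points of the
  same small ball are less than \<open>r\<close> apart.\<close>

lemma doubling_imp_packing_bound:
  assumes "doubling_metric X"
  obtains M where "packing_bound X M"
proof -
  obtain N where N: "\<And>x r. x \<in> mspace X \<Longrightarrow> 0 < r \<Longrightarrow> \<exists>S\<subseteq>mspace X. finite S \<and> card S \<le> N \<and>
        mball_of X x r \<subseteq> (\<Union>y\<in>S. mball_of X y (r / 2))"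
    using assms unfolding doubling_metric_def by blast
  have iter: "\<exists>S\<subseteq>mspace X. finite S \<and> card S \<le> N ^ k \<and> mball_of X x r \<subseteq> (\<Union>y\<in>S. mball_of X y (r / 2 ^ k))"
    if "x \<in> mspace X" "0 < r" for x r k
    using that
  proof (induction k)
    case 0
    then show ?case by (intro exI[of _ "{x}"]) auto
  next
    case (Suc k)
    then obtain S where S: "S \<subseteq> mspace X" "finite S" "card S \<le> N ^ k"
        "mball_of X x r \<subseteq> (\<Union>y\<in>S. mball_of X y (r / 2 ^ k))" by blast
    have "\<forall>y\<in>S. \<exists>T\<subseteq>mspace X. finite T \<and> card T \<le> N \<and>
        mball_of X y (r / 2 ^ k) \<subseteq> (\<Union>z\<in>T. mball_of X z (r / 2 ^ k / 2))"
      using N S(1) Suc.prems by (intro ballI N) auto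
    then obtain T where T: "\<And>y. y \<in> S \<Longrightarrow> T y \<subseteq> mspace X \<and> finite (T y) \<and> card (T y) \<le> N \<and>
        mball_of X y (r / 2 ^ k) \<subseteq> (\<Union>z\<in>T y. mball_of X z (r / 2 ^ k / 2))"
      by metis
    have "card (\<Union>y\<in>S. T y) \<le> (\<Sum>y\<in>S. card (T y))"
      using S(2) by (rule card_UN_le)
    also have "\<dots> \<le> card S * N" using T by (intro sum_bounded_above[of S _ N, simplified]) auto
    also have "\<dots> \<le> N ^ Suc k" using S(3) by simp
    finally have "card (\<Union>y\<in>S. T y) \<le> N ^ Suc k" .
    moreover have "mball_of X x r \<subseteq> (\<Union>z\<in>\<Union>y\<in>S. T y. mball_of X z (r / 2 ^ Suc k))"
    proof
      fix z assume "z \<in> mball_of X x r"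
      then obtain y where y: "y \<in> S" "z \<in> mball_of X y (r / 2 ^ k)" using S(4) by auto
      then have "z \<in> (\<Union>w\<in>T y. mball_of X w (r / 2 ^ k / 2))" using T by blast
      then show "z \<in> (\<Union>z\<in>\<Union>y\<in>S. T y. mball_of X z (r / 2 ^ Suc k))"
        using y(1) by (auto simp: field_simps)
    qed
    ultimately show ?case
      using S(2) T by (intro exI[of _ "\<Union>y\<in>S. T y"]) blast
  qed
  have "packing_bound X (N ^ 5)"
    unfolding packing_bound_def
  proof (intro ballI allI impI, elim conjE)
    fix x r S assume x: "x \<in> mspace X" and r: "(0::real) < r" and S: "S \<subseteq> mball_of X x (16 * r)"
      "finite S" "\<forall>v\<in>S. \<forall>w\<in>S. v \<noteq> w \<longrightarrow> r \<le> mdist X v w"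
    obtain T where T: "finite T" "card T \<le> N ^ 5" "mball_of X x (16 * r) \<subseteq> (\<Union>y\<in>T. mball_of X y (16 * r / 2 ^ 5))"
      using iter[of x "16 * r" 5] x r by auto
    have "\<forall>v\<in>S. \<exists>y\<in>T. v \<in> mball_of X y (r / 2)" using S(1) T(3) by (fastforce simp: subset_iff)
    then obtain f where f: "\<And>v. v \<in> S \<Longrightarrow> f v \<in> T \<and> v \<in> mball_of X (f v) (r / 2)" by metis
    have "inj_on f S"
    proof (rule inj_onI)
      fix v w assume vw: "v \<in> S" "w \<in> S" "f v = f w"
      have "mdist X v w < r"
        using f[OF vw(1)] f[OF vw(2)] vw(3) mdist_triangle[of v X "f v" w] mdist_commute[of X v "f v"]
        by auto
      then show "v = w" using S(3) vw by force
    qed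
    then have "card S \<le> card T" using f T(1) by (intro card_inj_on_le) auto
    then show "card S \<le> N ^ 5" using T(2) by simp
  qed
  then show thesis by (rule that)
qed

text \<open>The balls of radius \<open>r / 3\<close> about \<open>r\<close>-separated points of a ball of radius \<open>16 * r\<close> are disjoint
  and lie in a ball of radius \<open>17 * r\<close>. If there are two such points, then \<open>r\<close> is at most the
  diameter, so regularity applies to these radii.\<close>

lemma ahlfors_imp_packing_bound:
  assumes "ahlfors_regular n X" "0 \<le> n"
  obtains M where "packing_bound X M"
proof -
  obtain C where C: "C > 0" and sum: "\<And>Q x R. separated_balls X Q \<Longrightarrow> x \<in> mspace X \<Longrightarrow> 0 < R \<Longrightarrow>
       (\<And>q r. (q, r) \<in> Q \<Longrightarrow> mdist X x q + r \<le> R \<and> ennreal r \<le> ediam X (mspace X)) \<Longrightarrow>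
       (\<Sum>(q, r)\<in>Q. r powr n) \<le> C * R powr n"
    using ahlfors_separated_balls_sum[OF assms] by blast
  define M where "M = max 1 (nat \<lceil>C * 51 powr n\<rceil>)"
  have "packing_bound X M"
    unfolding packing_bound_def
  proof (intro ballI allI impI, elim conjE)
    fix x r S assume x: "x \<in> mspace X" and r: "(0::real) < r" and S: "S \<subseteq> mball_of X x (16 * r)"
      "finite S" "\<forall>v\<in>S. \<forall>w\<in>S. v \<noteq> w \<longrightarrow> r \<le> mdist X v w"
    show "card S \<le> M"
    proof (cases "card S \<le> 1")
      case False
      then have "\<not> (\<forall>a\<in>S. \<forall>b\<in>S. a = b)"
        using card_le_Suc0_iff_eq[OF S(2)] by simp
      then obtain v w where vw: "v \<in> S" "w \<in> S" "v \<noteq> w" by blast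
      have vwX: "v \<in> mspace X" "w \<in> mspace X" using vw S(1) by auto
      have "ennreal r \<le> ennreal (mdist X v w)" using S(3) vw by (simp add: ennreal_leI)
      also have "\<dots> \<le> ediam X (mspace X)"
        unfolding ediam_def by (intro SUP_upper2[OF vwX(1)] SUP_upper[OF vwX(2)])
      finally have rd: "ennreal r \<le> ediam X (mspace X)" .
      have "(\<Sum>(q, r)\<in>(\<lambda>v. (v, r / 3)) ` S. r powr n) \<le> C * (17 * r) powr n"
      proof (rule sum[OF _ x])
        show "separated_balls X ((\<lambda>v. (v, r / 3)) ` S)"
          using S r by (force simp: separated_balls_def)
        fix q t assume "(q, t) \<in> (\<lambda>v. (v, r / 3)) ` S"
        then have "q \<in> S" "t = r / 3" by auto
        moreover have "ennreal (r / 3) \<le> ennreal r" using r by (intro ennreal_leI) auto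
        then have "ennreal (r / 3) \<le> ediam X (mspace X)" using rd by (rule order_trans)
        ultimately show "mdist X x q + t \<le> 17 * r \<and> ennreal t \<le> ediam X (mspace X)"
          using S(1) r by auto
      qed (use r in auto)
      also have "(\<Sum>(q, r)\<in>(\<lambda>v. (v, r / 3)) ` S. r powr n) = card S * (r / 3) powr n"
        by (subst sum.reindex) (auto simp: inj_on_def)
      also have "(17 * r) powr n = 51 powr n * (r / 3) powr n"
        using r by (simp flip: powr_mult)
      finally have "card S \<le> C * 51 powr n" using r by (simp add: powr_gt_zero mult.assoc[symmetric])
      then show ?thesis by (simp add: M_def) linarith
    qed (simp add: M_def)
  qed
  then show thesis by (rule that)
qed

section \<open>Separated sets and finite covers\<close>

lemma maximal_separated_subset:
  assumes "A \<subseteq> mspace X" "0 < r"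
  obtains S where "S \<subseteq> A" "\<And>v w. v \<in> S \<Longrightarrow> w \<in> S \<Longrightarrow> v \<noteq> w \<Longrightarrow> r \<le> mdist X v w"
    "\<And>x. x \<in> A \<Longrightarrow> \<exists>v\<in>S. mdist X x v < r"
proof -
  define \<A> where "\<A> = {S. S \<subseteq> A \<and> (\<forall>v\<in>S. \<forall>w\<in>S. v \<noteq> w \<longrightarrow> r \<le> mdist X v w)}"
  have "\<exists>S\<in>\<A>. \<forall>T\<in>\<A>. S \<subseteq> T \<longrightarrow> T = S"
  proof (rule subset_Zorn_nonempty)
    show "\<A> \<noteq> {}" by (auto simp: \<A>_def)
    fix \<C> assume C: "\<C> \<noteq> {}" "subset.chain \<A> \<C>"
    have "r \<le> mdist X v w" if "v \<in> S" "S \<in> \<C>" "w \<in> T" "T \<in> \<C>" "v \<noteq> w" for v w S T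
    proof -
      have C': "\<C> \<subseteq> \<A>" "\<forall>S\<in>\<C>. \<forall>T\<in>\<C>. S \<subseteq> T \<or> T \<subseteq> S"
        using C(2) unfolding subset_chain_def by (rule conjunct1, rule conjunct2)
      have "S \<in> \<A>" "T \<in> \<A>" using C'(1) that(2,4) by (auto dest: subsetD)
      moreover have "S \<subseteq> T \<or> T \<subseteq> S" using C'(2) that(2,4) by simp
      ultimately show ?thesis using that(1,3,5) unfolding \<A>_def by blast
    qed
    moreover have "\<Union>\<C> \<subseteq> A" using C(2) unfolding subset_chain_def \<A>_def by blast
    ultimately show "\<Union>\<C> \<in> \<A>" unfolding \<A>_def by blast
  qed
  then obtain S where S: "S \<in> \<A>" "\<And>T. T \<in> \<A> \<Longrightarrow> S \<subseteq> T \<Longrightarrow> T = S" by blast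
  have "\<exists>v\<in>S. mdist X x v < r" if "x \<in> A" for x
  proof (rule ccontr)
    assume "\<not> ?thesis"
    then have far: "\<forall>v\<in>S. r \<le> mdist X x v" by force
    then have "insert x S \<in> \<A>" using S(1) that by (auto simp: \<A>_def mdist_commute)
    then have "x \<in> S" using S(2)[of "insert x S"] by auto
    then have "r \<le> mdist X x x" using far by simp
    moreover have "x \<in> mspace X" using assms that by blast
    ultimately show False using assms by simp
  qed
  with S(1) show thesis by (intro that[of S]) (auto simp: \<A>_def)
qed

lemma separated_subset_of_compact_finite:
  assumes "compactin (mtopology_of X) Z" "S \<subseteq> Z" "0 < r"
    and "\<And>v w. v \<in> S \<Longrightarrow> w \<in> S \<Longrightarrow> v \<noteq> w \<Longrightarrow> r \<le> mdist X v w"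
  shows "finite S"
proof -
  interpret Metric_space "mspace X" "mdist X" by simp
  have "mtotally_bounded Z"
    using assms(1) compactin_imp_mtotally_bounded by (simp add: mtopology_of_def)
  then obtain K where K: "finite K" "Z \<subseteq> (\<Union>x\<in>K. mball x (r / 2))"
    unfolding mtotally_bounded_def using assms(3) by (meson half_gt_zero)
  then have "\<forall>v\<in>S. \<exists>x\<in>K. v \<in> mball x (r / 2)" using assms(2) by blast
  then obtain f where f: "\<And>v. v \<in> S \<Longrightarrow> f v \<in> K \<and> v \<in> mball (f v) (r / 2)" by metis
  have "inj_on f S"
  proof (rule inj_onI)
    fix v w assume vw: "v \<in> S" "w \<in> S" "f v = f w"
    have "mdist X v w < r"
      using f[OF vw(1)] f[OF vw(2)] vw(3) triangle[of v "f v" w] commute[of v "f v"] by auto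
    then show "v = w" using assms(4) vw by force
  qed
  then show ?thesis using f K(1) by (meson finite_imageD finite_subset image_subsetI)
qed

text \<open>A finite form of the Hausdorff content: \<open>A\<close> has a finite cover whose total cost is at most \<open>c\<close>.
  Each covering set carries a positive upper bound \<open>D\<close> of its diameter, so that the
  exponent \<open>0\<close> and one-point sets need no separate treatment.\<close>

definition cover_cost :: "'a metric \<Rightarrow> real \<Rightarrow> real \<Rightarrow> 'a set \<Rightarrow> real \<Rightarrow> bool" where
  "cover_cost Y s \<delta> A c \<longleftrightarrow> (\<exists>\<V>. finite \<V> \<and> A \<subseteq> (\<Union>(V, D)\<in>\<V>. V) \<and> (\<Sum>(V, D)\<in>\<V>. D powr s) \<le> c \<and>
     (\<forall>(V, D)\<in>\<V>. V \<subseteq> mspace Y \<and> 0 < D \<and> D \<le> \<delta> \<and> (\<forall>x\<in>V. \<forall>y\<in>V. mdist Y x y \<le> D)))"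

lemma cover_cost_single:
  assumes "A \<subseteq> mspace Y" "0 < D" "D \<le> \<delta>" "\<And>x y. x \<in> A \<Longrightarrow> y \<in> A \<Longrightarrow> mdist Y x y \<le> D" "D powr s \<le> c"
  shows "cover_cost Y s \<delta> A c"
  unfolding cover_cost_def using assms by (intro exI[of _ "{(A, D)}"]) auto

lemma cover_cost_empty: "0 \<le> c \<Longrightarrow> cover_cost Y s \<delta> {} c"
  unfolding cover_cost_def by (intro exI[of _ "{}"]) auto

lemma cover_cost_Un:
  assumes "cover_cost Y s \<delta> A a" "cover_cost Y s \<delta> B b"
  shows "cover_cost Y s \<delta> (A \<union> B) (a + b)"
proof -
  obtain \<V> where V: "finite \<V>" "A \<subseteq> (\<Union>(V, D)\<in>\<V>. V)" "(\<Sum>(V, D)\<in>\<V>. D powr s) \<le> a"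
    "\<forall>(V, D)\<in>\<V>. V \<subseteq> mspace Y \<and> 0 < D \<and> D \<le> \<delta> \<and> (\<forall>x\<in>V. \<forall>y\<in>V. mdist Y x y \<le> D)"
    using assms(1) unfolding cover_cost_def by blast
  obtain \<W> where W: "finite \<W>" "B \<subseteq> (\<Union>(V, D)\<in>\<W>. V)" "(\<Sum>(V, D)\<in>\<W>. D powr s) \<le> b"
    "\<forall>(V, D)\<in>\<W>. V \<subseteq> mspace Y \<and> 0 < D \<and> D \<le> \<delta> \<and> (\<forall>x\<in>V. \<forall>y\<in>V. mdist Y x y \<le> D)"
    using assms(2) unfolding cover_cost_def by blast
  have "(\<Sum>(V, D)\<in>\<V> \<union> \<W>. D powr s) \<le> (\<Sum>(V, D)\<in>\<V>. D powr s) + (\<Sum>(V, D)\<in>\<W>. D powr s)"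
    using V(1) W(1) by (subst sum_Un) (auto intro!: sum_nonneg)
  then show ?thesis
    unfolding cover_cost_def using V W by (intro exI[of _ "\<V> \<union> \<W>"] conjI ballI) (auto; blast)+
qed

lemma cover_cost_UN:
  assumes "finite I" "\<And>i. i \<in> I \<Longrightarrow> cover_cost Y s \<delta> (A i) (c i)"
  shows "cover_cost Y s \<delta> (\<Union>i\<in>I. A i) (\<Sum>i\<in>I. c i)"
  using assms by (induction I rule: finite_induct) (auto intro: cover_cost_empty cover_cost_Un)

lemma cover_cost_mono:
  "cover_cost Y s \<delta> A a \<Longrightarrow> B \<subseteq> A \<Longrightarrow> a \<le> b \<Longrightarrow> cover_cost Y s \<delta> B b"
  unfolding cover_cost_def by (meson order_trans)

lemma hausdorff_content_le_cover_cost: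
  assumes "cover_cost Y s \<delta> A c" "0 \<le> s"
  shows "hausdorff_content Y s \<delta> A \<le> ennreal c"
proof -
  obtain \<V> where V: "finite \<V>" "A \<subseteq> (\<Union>(V, D)\<in>\<V>. V)" "(\<Sum>(V, D)\<in>\<V>. D powr s) \<le> c"
    "\<forall>(V, D)\<in>\<V>. V \<subseteq> mspace Y \<and> 0 < D \<and> D \<le> \<delta> \<and> (\<forall>x\<in>V. \<forall>y\<in>V. mdist Y x y \<le> D)"
    using assms(1) unfolding cover_cost_def by blast
  have "hausdorff_content Y s \<delta> A \<le> ennreal (\<Sum>i\<in>\<V>. snd i powr s)"
  proof (rule hausdorff_content_le_finite_cover[OF assms(2) V(1), where V = fst])
    show "A \<subseteq> (\<Union>i\<in>\<V>. fst i)" using V(2) by (simp add: case_prod_unfold)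
  qed (use V(4) in \<open>simp_all add: case_prod_unfold\<close>)
  also have "\<dots> \<le> ennreal c" using V(3) by (intro ennreal_leI) (simp add: case_prod_unfold)
  finally show ?thesis .
qed

lemma separated_balls_Un:
  assumes "separated_balls X Q" "separated_balls X Q'"
    and cross: "\<And>q r q' r'. (q, r) \<in> Q \<Longrightarrow> (q', r') \<in> Q' \<Longrightarrow> r + r' < mdist X q q'"
  shows "separated_balls X (Q \<union> Q')" "Q \<inter> Q' = {}"
proof -
  show "separated_balls X (Q \<union> Q')"
    unfolding separated_balls_def
  proof (intro conjI)
    show "finite (Q \<union> Q')" "\<forall>(q, r)\<in>Q \<union> Q'. q \<in> mspace X \<and> 0 < r"
      using assms(1,2) by (auto simp: separated_balls_def)
    have "r + r' < mdist X q q'" if "(q, r) \<in> Q \<union> Q'" "(q', r') \<in> Q \<union> Q'" "(q, r) \<noteq> (q', r')" for q r q' r'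
    proof -
      have "(q', r') \<in> Q \<Longrightarrow> (q, r) \<in> Q' \<Longrightarrow> r + r' < mdist X q q'"
        using cross[of q' r' q r] by (simp add: mdist_commute add.commute)
      with that cross[of q r q' r'] assms(1,2) show ?thesis
        by (auto simp: separated_balls_def)
    qed
    then show "\<forall>(q, r)\<in>Q \<union> Q'. \<forall>(q', r')\<in>Q \<union> Q'. (q, r) \<noteq> (q', r') \<longrightarrow> r + r' < mdist X q q'" by blast
  qed
  show "Q \<inter> Q' = {}"
  proof (rule ccontr)
    assume "Q \<inter> Q' \<noteq> {}"
    then obtain q r where qr: "(q, r) \<in> Q" "(q, r) \<in> Q'" by auto
    with assms(1) have "q \<in> mspace X" "0 < r" by (auto simp: separated_balls_def)
    with cross[OF qr] show False by simp
  qed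
qed

lemma separated_balls_UN:
  assumes "finite I" "\<And>i. i \<in> I \<Longrightarrow> separated_balls X (Q i)"
    and cross: "\<And>i j q r q' r'. i \<in> I \<Longrightarrow> j \<in> I \<Longrightarrow> i \<noteq> j \<Longrightarrow> (q, r) \<in> Q i \<Longrightarrow> (q', r') \<in> Q j \<Longrightarrow>
      r + r' < mdist X q q'"
  shows "separated_balls X (\<Union>i\<in>I. Q i) \<and>
    (\<Sum>(q, r)\<in>(\<Union>i\<in>I. Q i). r powr n) = (\<Sum>i\<in>I. \<Sum>(q, r)\<in>Q i. r powr n)"
  using assms
proof (induction I rule: finite_induct)
  case empty
  then show ?case by (simp add: separated_balls_def)
next
  case (insert i I)
  have IH: "separated_balls X (\<Union>i\<in>I. Q i)"
    "(\<Sum>(q, r)\<in>(\<Union>i\<in>I. Q i). r powr n) = (\<Sum>i\<in>I. \<Sum>(q, r)\<in>Q i. r powr n)"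
    using insert.IH insert.prems by (metis (no_types, lifting) insertCI)+
  have cr: "r + r' < mdist X q q'" if qr: "(q, r) \<in> Q i" "(q', r') \<in> (\<Union>i\<in>I. Q i)" for q r q' r'
  proof -
    obtain j where "j \<in> I" "(q', r') \<in> Q j" using qr by auto
    then show ?thesis using insert.prems(2)[of i j q r q' r'] qr insert.hyps by auto
  qed
  have Qi: "separated_balls X (Q i)" using insert.prems by auto
  have U: "separated_balls X (Q i \<union> (\<Union>i\<in>I. Q i))" "Q i \<inter> (\<Union>i\<in>I. Q i) = {}"
    using separated_balls_Un[OF Qi IH(1) cr] by auto
  have "finite (Q i)" "finite (\<Union>i\<in>I. Q i)" using Qi IH(1) by (simp_all add: separated_balls_def)
  then have "(\<Sum>(q, r)\<in>Q i \<union> (\<Union>i\<in>I. Q i). r powr n) = (\<Sum>(q, r)\<in>Q i. r powr n) + (\<Sum>(q, r)\<in>(\<Union>i\<in>I. Q i). r powr n)"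
    using U(2) by (rule sum.union_disjoint)
  then show ?case using U(1) IH(2) insert.hyps by simp
qed

section \<open>Scales of bounded multiplicity\<close>

text \<open>At the location \<open>p\<close> and scale \<open>s\<close>, and up to the error \<open>\<epsilon>\<close>, the set \<open>Z\<close> fills the space and the
  map \<open>g\<close> is at most \<open>M\<close>-to-one: among \<open>r\<close>-separated points, at most \<open>M\<close> have their images within
  \<open>r\<close> of each other. Both properties pass to the limit when \<open>s\<close> becomes the unit of length and
  \<open>\<epsilon>\<close> tends to \<open>0\<close>.\<close>

definition good_scale ::
    "'a metric \<Rightarrow> 'b metric \<Rightarrow> ('a \<Rightarrow> 'b) \<Rightarrow> 'a set \<Rightarrow> nat \<Rightarrow> real \<Rightarrow> 'a \<Rightarrow> real \<Rightarrow> bool" where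
  "good_scale X Y g Z M \<epsilon> p s \<longleftrightarrow>
     (\<forall>x\<in>mspace X. mdist X p x \<le> s / \<epsilon> \<longrightarrow> (\<exists>z\<in>Z. mdist X x z < \<epsilon> * s)) \<and>
     (\<forall>r S. \<epsilon> * s \<le> r \<and> r \<le> s / \<epsilon> \<and> S \<subseteq> Z \<and> (\<forall>z\<in>S. mdist X p z \<le> s / \<epsilon>) \<and>
        (\<forall>z\<in>S. \<forall>w\<in>S. (z \<noteq> w \<longrightarrow> r \<le> mdist X z w) \<and> mdist Y (g z) (g w) \<le> r) \<longrightarrow> card S \<le> M)"

text \<open>Suppose that for some \<open>\<epsilon>\<close> no point and scale are good. Then every ball about a point of \<open>Z\<close>
  contains, at a definite proportion of its radius, a saving: a hole, that is, a ball missing \<open>Z\<close>,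
  or a cluster of more than \<open>M\<close> disjoint balls whose images lie in one set of comparable size. The
  image of a saving costs at most \<open>\<eta>\<close> times the sum of the powers \<open>r powr n\<close> of its radii, where
  \<open>\<eta>\<close> is small when \<open>M\<close> is large.

  Regularity bounds that sum by a constant \<open>K\<close> for all disjoint families near \<open>Z\<close>. Choose a finite
  disjoint family of savings for which it is almost maximal. The part of \<open>Z\<close> outside the doubled
  balls of the family can be covered by balls of one single, very small radius, and savings placed
  in these balls are disjoint from the family. By near maximality they add almost nothing, so the
  uncovered part has almost no cost. Hence the content of the image is at most about \<open>\<eta> * K\<close>, less
  than the positive content it is assumed to have. One scale suffices for the uncovered part because
  the family is finite: a point outside the doubled balls keeps a distance from the balls that is
  at least the smallest radius of the family.\<close>

lemma good_scales_exist:
  fixes X :: "'a metric" and Y :: "'b metric"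
  assumes n: "0 \<le> n" and reg: "ahlfors_regular n X"
    and Z: "Z \<subseteq> mspace X" "compactin (mtopology_of X) Z"
    and gY: "g \<in> Z \<rightarrow> mspace Y" and L: "1 \<le> L"
    and lip: "\<And>x y. x \<in> Z \<Longrightarrow> y \<in> Z \<Longrightarrow> mdist Y (g x) (g y) \<le> L * mdist X x y"
    and \<delta>: "0 < \<delta>" and pos: "hausdorff_content Y n \<delta> (g ` Z) > 0"
  obtains M :: nat where "\<And>\<epsilon>. 0 < \<epsilon> \<Longrightarrow> \<epsilon> \<le> 1 \<Longrightarrow> \<exists>p\<in>Z. \<exists>s>0. good_scale X Y g Z M \<epsilon> p s"
proof -
  have "Z \<noteq> {}"
    using pos hausdorff_content_le_cover_cost[OF cover_cost_empty[of 0] n, of Y \<delta>] by auto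
  then obtain z0 where z0: "z0 \<in> Z" by blast
  show thesis
  proof (cases "ediam X (mspace X) = 0")
    case True
    \<comment> \<open>In a one-point space regularity says nothing, as no positive radius is at most the diameter; but
      there every location and scale is good.\<close>
    have one: "x = z0" if "x \<in> mspace X" for x
      using ediam_mspace_zero[OF True] that z0 Z by blast
    have "card S \<le> 1" if "S \<subseteq> Z" for S
    proof -
      have "S \<subseteq> {z0}" using that one Z by blast
      then show ?thesis using card_mono[of "{z0}" S] by simp
    qed
    moreover have "\<exists>z\<in>Z. mdist X x z < \<epsilon> * 1" if "x \<in> mspace X" "0 < \<epsilon>" for x \<epsilon>
      using that z0 one by (intro bexI[of _ z0]) auto
    ultimately show thesis
      by (intro that[of 1] bexI[OF _ z0] exI[of _ 1]) (auto simp: good_scale_def)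
  next
    case False
    obtain C where C: "C > 0" and sum: "\<And>Q x R. separated_balls X Q \<Longrightarrow> x \<in> mspace X \<Longrightarrow> 0 < R \<Longrightarrow>
         (\<And>q r. (q, r) \<in> Q \<Longrightarrow> mdist X x q + r \<le> R \<and> ennreal r \<le> ediam X (mspace X)) \<Longrightarrow>
         (\<Sum>(q, r)\<in>Q. r powr n) \<le> C * R powr n"
      using ahlfors_separated_balls_sum[OF reg n] by blast
    interpret Metric_space "mspace X" "mdist X" by simp
    have z0X: "z0 \<in> mspace X" using z0 Z by blast
    have "mbounded Z"
      using Z(2) compactin_imp_mbounded by (simp add: mtopology_of_def)
    then obtain B where B0: "\<And>z. z \<in> Z \<Longrightarrow> mdist X z0 z \<le> B"
      using z0 unfolding mbounded_alt by blast
    have B: "0 \<le> B" using B0[OF z0] z0X by simp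
    obtain \<rho>0 where \<rho>0: "0 < \<rho>0" "\<rho>0 \<le> 1" "ennreal \<rho>0 \<le> ediam X (mspace X)"
    proof (cases "ediam X (mspace X)")
      case (real D)
      then show thesis using False by (intro that[of "min 1 D"]) (auto simp: ennreal_leI less_le)
    next
      case top
      then show thesis by (intro that[of 1]) auto
    qed
    define K where "K = C * (B + 2) powr n"
    have K: "0 < K" using C B by (simp add: K_def)
    obtain \<kappa> where \<kappa>: "0 < \<kappa>" "ennreal \<kappa> < hausdorff_content Y n \<delta> (g ` Z)"
    proof -
      obtain x where x: "0 < x" "x < hausdorff_content Y n \<delta> (g ` Z)" using dense[OF pos] by blast
      have "x < top" using x(2) top_greatest by (rule less_le_trans)
      then obtain \<kappa> where "x = ennreal \<kappa>" "0 \<le> \<kappa>" by (cases x) auto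
      with x that[of \<kappa>] show thesis by (auto simp: ennreal_less_zero_iff)
    qed
    \<comment> \<open>Half of \<open>\<kappa>\<close> is granted to the image of the savings, the other half to the image of the rest.\<close>
    define \<eta> where "\<eta> = \<kappa> / (2 * K)"
    have \<eta>: "0 < \<eta>" "\<eta> * K = \<kappa> / 2" using \<kappa> K by (auto simp: \<eta>_def)
    define M where "M = nat \<lceil>(4 * (1 + L)) powr n / \<eta>\<rceil>"
    have M: "(4 * (1 + L)) powr n \<le> \<eta> * k" if "M < k" for k
    proof -
      have "(4 * (1 + L)) powr n / \<eta> \<le> k" using that unfolding M_def by linarith
      then show ?thesis using \<eta> by (simp add: field_simps)
    qed
    have "\<exists>p\<in>Z. \<exists>s>0. good_scale X Y g Z M \<epsilon> p s" if \<epsilon>: "0 < \<epsilon>" "\<epsilon> \<le> 1" for \<epsilon>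
    proof (rule ccontr)
      assume "\<not> ?thesis"
      then have bad: "\<And>p s. p \<in> Z \<Longrightarrow> 0 < s \<Longrightarrow> \<not> good_scale X Y g Z M \<epsilon> p s" by blast
      define R where "R = 1 / \<epsilon>"
      have R: "1 \<le> R" using \<epsilon> by (simp add: R_def)
      have sR: "s / \<epsilon> = R * s" for s by (simp add: R_def)
      define near where "near Q = {z \<in> Z. \<exists>(q, r)\<in>Q. mdist X q z < 2 * r}" for Q
      define tot where "tot Q = (\<Sum>(q, r)\<in>Q. r powr n)" for Q :: "('a \<times> real) set"
      define cheap where "cheap Q \<longleftrightarrow> cover_cost Y n \<delta> (g ` near Q) (\<eta> * tot Q)" for Q
      define adm where "adm Q \<longleftrightarrow> separated_balls X Q \<and> cheap Q \<and>
          (\<forall>(q, r)\<in>Q. mdist X z0 q \<le> B + 1 \<and> r \<le> \<rho>0)" for Q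
      have near_Un: "near (Q \<union> Q') = near Q \<union> near Q'" for Q Q' by (auto simp: near_def)
      have totK: "tot Q \<le> K" if "adm Q" for Q
        unfolding tot_def K_def
      proof (rule sum[OF _ z0X])
        show "separated_balls X Q" using that by (simp add: adm_def)
        fix q r assume "(q, r) \<in> Q"
        then have "mdist X z0 q \<le> B + 1" "r \<le> \<rho>0" using that by (auto simp: adm_def)
        then show "mdist X z0 q + r \<le> B + 2 \<and> ennreal r \<le> ediam X (mspace X)"
          using \<rho>0(2) order_trans[OF ennreal_leI \<rho>0(3)] by auto
      qed (use B in auto)
      have adm0: "adm {}"
        by (simp add: adm_def separated_balls_def cheap_def near_def tot_def cover_cost_empty)
      \<comment> \<open>The size \<open>10 * L * R * s\<close> of the image of a net ball, in units of the smallest radius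
      \<open>\<epsilon> * s / 4\<close> that a saving can have.\<close>
      define w where "w = 40 * L * R / \<epsilon>"
      have w: "0 < w" using L R \<epsilon> by (simp add: w_def)
      define \<epsilon>' where "\<epsilon>' = \<kappa> / (2 * w powr n)"
      have \<epsilon>': "0 < \<epsilon>'" "\<epsilon>' * w powr n = \<kappa> / 2" using \<kappa> w by (auto simp: \<epsilon>'_def)
      obtain Q where Q: "adm Q" and Qmax: "\<And>Q'. adm Q' \<Longrightarrow> tot Q' \<le> tot Q + \<epsilon>'"
      proof -
        have bdd: "bdd_above (tot ` {Q. adm Q})" using totK by (auto simp: bdd_above_def)
        have "Sup (tot ` {Q. adm Q}) - \<epsilon>' < Sup (tot ` {Q. adm Q})" using \<epsilon>' by simp
        then obtain Q where "adm Q" "Sup (tot ` {Q. adm Q}) - \<epsilon>' < tot Q"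
          using less_cSupD[of "tot ` {Q. adm Q}" "Sup (tot ` {Q. adm Q}) - \<epsilon>'"] adm0 by auto
        moreover have "tot Q' \<le> Sup (tot ` {Q. adm Q})" if "adm Q'" for Q'
          using bdd that by (intro cSup_upper) auto
        ultimately show thesis using that by (smt (verit, best))
      qed
      have Qsep: "separated_balls X Q" using Q by (simp add: adm_def)
      then have Qfin: "finite Q" and Qp: "\<And>q r. (q, r) \<in> Q \<Longrightarrow> q \<in> mspace X \<and> 0 < r"
        by (auto simp: separated_balls_def)
      \<comment> \<open>Small enough for the new savings to be admissible and disjoint from the finitely many balls of \<open>Q\<close>.\<close>
      define s where "s = Min ({\<delta> / (10 * L * R), \<rho>0 / R, 1 / (2 * R)} \<union> (\<lambda>(q, r). r / (4 * R)) ` Q)"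
      have s0: "0 < s"
        unfolding s_def using Qfin Qp \<delta> L R \<rho>0 by (subst Min_gr_iff) (auto split: prod.splits)
      have s_le: "s \<le> x" if "x \<in> {\<delta> / (10 * L * R), \<rho>0 / R, 1 / (2 * R)} \<union> (\<lambda>(q, r). r / (4 * R)) ` Q" for x
        unfolding s_def using Qfin that by (intro Min_le) auto
      have "s \<le> \<delta> / (10 * L * R)" by (rule s_le) auto
      then have s\<delta>: "10 * L * R * s \<le> \<delta>" using L R by (simp add: field_simps)
      have "s \<le> \<rho>0 / R" by (rule s_le) auto
      then have s\<rho>0: "R * s \<le> \<rho>0" using R by (simp add: field_simps)
      have "s \<le> 1 / (2 * R)" by (rule s_le) auto
      then have s1: "2 * (R * s) \<le> 1" using R by (simp add: field_simps)
      have sQ: "2 * (R * s) < r" if "(q, r) \<in> Q" for q r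
      proof -
        have "s \<le> r / (4 * R)" by (rule s_le) (use that in force)
        then have "4 * (R * s) \<le> r" using R by (simp add: field_simps)
        moreover have "0 < R * s" using R s0 by simp
        ultimately show ?thesis by linarith
      qed
      have \<epsilon>R: "\<epsilon> * s \<le> R * s" using \<epsilon> R s0 by (intro mult_right_mono) auto
      have Rs0: "0 < R * s" using R s0 by simp
      have LRs: "(1 + L) * r \<le> \<delta>" if "0 < r" "r \<le> R * s" for r
      proof -
        have "(1 + L) * r \<le> (10 * L) * (R * s)" using that L by (intro mult_mono) auto
        then show ?thesis using s\<delta> by (simp add: mult.assoc)
      qed
      have piece: "\<exists>P. separated_balls X P \<and> cheap P \<and> (\<epsilon> * s / 4) powr n \<le> tot P \<and>
          (\<forall>(q, r)\<in>P. mdist X p q + r \<le> 2 * (R * s) \<and> r \<le> R * s)" if p: "p \<in> Z" for p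
      proof -
        have pX: "p \<in> mspace X" using p Z by blast
        consider (hole) x where "x \<in> mspace X" "mdist X p x \<le> R * s" "\<And>z. z \<in> Z \<Longrightarrow> \<epsilon> * s \<le> mdist X x z"
          | (cluster) r S where "\<epsilon> * s \<le> r" "r \<le> R * s" "S \<subseteq> Z" "\<And>z. z \<in> S \<Longrightarrow> mdist X p z \<le> R * s"
            "\<And>z w. z \<in> S \<Longrightarrow> w \<in> S \<Longrightarrow> z \<noteq> w \<Longrightarrow> r \<le> mdist X z w"
            "\<And>z w. z \<in> S \<Longrightarrow> w \<in> S \<Longrightarrow> mdist Y (g z) (g w) \<le> r" "M < card S"
        proof (cases "\<forall>x\<in>mspace X. mdist X p x \<le> R * s \<longrightarrow> (\<exists>z\<in>Z. mdist X x z < \<epsilon> * s)")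
          case False
          then obtain x where "x \<in> mspace X" "mdist X p x \<le> R * s" "\<forall>z\<in>Z. \<not> mdist X x z < \<epsilon> * s" by blast
          then show thesis by (intro hole[of x]) (auto simp: not_less)
        next
          case True
          then obtain r S where "\<not> (\<epsilon> * s \<le> r \<and> r \<le> R * s \<and> S \<subseteq> Z \<and> (\<forall>z\<in>S. mdist X p z \<le> R * s) \<and>
            (\<forall>z\<in>S. \<forall>w\<in>S. (z \<noteq> w \<longrightarrow> r \<le> mdist X z w) \<and> mdist Y (g z) (g w) \<le> r) \<longrightarrow> card S \<le> M)"
            using bad[OF p s0] unfolding good_scale_def sR by metis
          then show thesis unfolding not_imp not_le by (elim conjE, intro cluster[of r S]) simp_all
        qed
        then show ?thesis
        proof cases
          case hole
          have "near {(x, \<epsilon> * s / 2)} = {}" using hole(3) by (force simp: near_def)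
          moreover have "(\<epsilon> * s / 4) powr n \<le> (\<epsilon> * s / 2) powr n"
            using \<epsilon> s0 n by (intro powr_mono2) auto
          moreover have "mdist X p x + \<epsilon> * s / 2 \<le> 2 * (R * s)" "\<epsilon> * s / 2 \<le> R * s"
            using hole(2) \<epsilon>R Rs0 by linarith+
          ultimately show ?thesis
            using hole(1) \<epsilon> s0 \<eta>
            by (intro exI[of _ "{(x, \<epsilon> * s / 2)}"])
              (auto simp: separated_balls_def cheap_def tot_def cover_cost_empty)
        next
          case cluster
          define P where "P = (\<lambda>z. (z, r / 4)) ` S"
          have finS: "finite S" using cluster(7) card.infinite by fastforce
          have r: "0 < r" using cluster(1) \<epsilon> s0 by (meson less_le_trans mult_pos_pos)
          have totP: "tot P = card S * (r / 4) powr n"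
            unfolding tot_def P_def by (subst sum.reindex) (auto simp: inj_on_def)
          have sepP: "separated_balls X P"
          proof -
            have "r / 4 + r / 4 < mdist X z w" if "z \<in> S" "w \<in> S" "z \<noteq> w" for z w
              using cluster(5)[OF that] r by linarith
            then show ?thesis
              unfolding separated_balls_def P_def using finS r cluster(3) Z(1) by auto
          qed
          have "(\<epsilon> * s / 4) powr n \<le> (r / 4) powr n"
            using \<epsilon> s0 n cluster(1) by (intro powr_mono2) auto
          also have "\<dots> \<le> card S * (r / 4) powr n"
            using cluster(7) by (simp add: mult_le_cancel_right1)
          finally have totP': "(\<epsilon> * s / 4) powr n \<le> tot P" by (simp add: totP)
          have "cheap P"
            unfolding cheap_def
          proof (rule cover_cost_single)
            show "g ` near P \<subseteq> mspace Y" using gY by (auto simp: near_def)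
            show "0 < (1 + L) * r" using L r by simp
            show "(1 + L) * r \<le> \<delta>" using LRs[OF r cluster(2)] .
            have "(1 + L) * r = 4 * (1 + L) * (r / 4)" by simp
            then have "((1 + L) * r) powr n = (4 * (1 + L)) powr n * (r / 4) powr n"
              by (metis powr_mult)
            also have "\<dots> \<le> \<eta> * card S * (r / 4) powr n"
              using M[OF cluster(7)] by (intro mult_right_mono) auto
            finally show "((1 + L) * r) powr n \<le> \<eta> * tot P" by (simp add: totP)
            fix a b assume "a \<in> g ` near P" "b \<in> g ` near P"
            then obtain x y v w where x: "a = g x" "x \<in> Z" "v \<in> S" "mdist X v x < r / 2"
              and y: "b = g y" "y \<in> Z" "w \<in> S" "mdist X w y < r / 2"
              unfolding near_def P_def by auto
            have vw: "v \<in> Z" "w \<in> Z" using x y cluster(3) by auto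
            have gm: "g x \<in> mspace Y" "g y \<in> mspace Y" "g v \<in> mspace Y" "g w \<in> mspace Y"
              using gY x y vw by auto
            have "mdist Y (g x) (g v) \<le> L * (r / 2)"
              using lip[OF x(2) vw(1)] mult_left_mono[of "mdist X v x" "r / 2" L] x(4) L
              unfolding mdist_commute[of X x v] by linarith
            moreover have "mdist Y (g w) (g y) \<le> L * (r / 2)"
              using lip[OF vw(2) y(2)] mult_left_mono[of "mdist X w y" "r / 2" L] y(4) L by linarith
            moreover have "mdist Y (g v) (g w) \<le> r" using cluster(6) x(3) y(3) by blast
            moreover have "mdist Y (g x) (g y) \<le> mdist Y (g x) (g v) + mdist Y (g v) (g w) + mdist Y (g w) (g y)"
              using gm mdist_triangle[of "g x" Y "g v" "g y"] mdist_triangle[of "g v" Y "g w" "g y"] by linarith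
            ultimately show "mdist Y a b \<le> (1 + L) * r"
              using x(1) y(1) by (simp add: algebra_simps)
          qed
          moreover have "mdist X p q + t \<le> 2 * (R * s) \<and> t \<le> R * s" if "(q, t) \<in> P" for q t
            using that cluster(2) cluster(4)[of q] r by (auto simp: P_def)
          ultimately show ?thesis using sepP totP' by (intro exI[of _ P]) auto
        qed
      qed
      then have "\<forall>p\<in>Z. \<exists>P. separated_balls X P \<and> cheap P \<and> (\<epsilon> * s / 4) powr n \<le> tot P \<and>
          (\<forall>(q, r)\<in>P. mdist X p q + r \<le> 2 * (R * s) \<and> r \<le> R * s)" by blast
      from bchoice[OF this] obtain P where PP: "\<forall>p\<in>Z. separated_balls X (P p) \<and> cheap (P p) \<and>
          (\<epsilon> * s / 4) powr n \<le> tot (P p) \<and> (\<forall>(q, r)\<in>P p. mdist X p q + r \<le> 2 * (R * s) \<and> r \<le> R * s)"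
        by blast
      then have P: "\<And>p. p \<in> Z \<Longrightarrow> separated_balls X (P p)" "\<And>p. p \<in> Z \<Longrightarrow> cheap (P p)"
          "\<And>p. p \<in> Z \<Longrightarrow> (\<epsilon> * s / 4) powr n \<le> tot (P p)"
          "\<And>p q r. p \<in> Z \<Longrightarrow> (q, r) \<in> P p \<Longrightarrow> mdist X p q + r \<le> 2 * (R * s)"
          "\<And>p q r. p \<in> Z \<Longrightarrow> (q, r) \<in> P p \<Longrightarrow> r \<le> R * s"
        by blast+
      define A where "A = Z - near Q"
      have AZ: "A \<subseteq> Z" by (auto simp: A_def)
      obtain N where N: "N \<subseteq> A" "\<And>v w. v \<in> N \<Longrightarrow> w \<in> N \<Longrightarrow> v \<noteq> w \<Longrightarrow> 5 * (R * s) \<le> mdist X v w"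
        "\<And>x. x \<in> A \<Longrightarrow> \<exists>v\<in>N. mdist X x v < 5 * (R * s)"
      proof (rule maximal_separated_subset[of A X "5 * (R * s)"])
        show "A \<subseteq> mspace X" "0 < 5 * (R * s)" using AZ Z(1) Rs0 by auto
      qed blast
      have NZ: "p \<in> Z" "p \<in> mspace X" if "p \<in> N" for p using that N(1) AZ Z(1) by auto
      have finN: "finite N"
        by (rule separated_subset_of_compact_finite[where r = "5 * (R * s)", OF Z(2) _ _ N(2)])
          (use N(1) AZ Rs0 in auto)
      have Pm: "q \<in> mspace X" "0 < r" if "p \<in> N" "(q, r) \<in> P p" for p q r
        using P(1)[OF NZ(1)[OF that(1)]] that(2) by (auto simp: separated_balls_def)
      have crossP: "r + r' < mdist X q q'"
        if "p \<in> N" "p' \<in> N" "p \<noteq> p'" "(q, r) \<in> P p" "(q', r') \<in> P p'" for p p' q r q' r'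
      proof -
        have "mdist X p p' \<le> mdist X p q + mdist X q q' + mdist X p' q'"
          using mdist_triangle[of p X q p'] mdist_triangle[of q X q' p'] mdist_commute[of X p' q']
            NZ Pm that by auto
        then show ?thesis
          using P(4)[OF NZ(1)[OF that(1)] that(4)] P(4)[OF NZ(1)[OF that(2)] that(5)] N(2)[OF that(1-3)] Rs0
          by linarith
      qed
      have crossQ: "r + r' < mdist X q q'" if qr: "(q, r) \<in> Q" "(q', r') \<in> (\<Union>p\<in>N. P p)" for q r q' r'
      proof -
        obtain p where p: "p \<in> N" "(q', r') \<in> P p" using qr(2) by auto
        have "\<not> mdist X q p < 2 * r" using N(1) p(1) qr(1) by (auto simp: A_def near_def)
        moreover have "mdist X q p \<le> mdist X q q' + mdist X p q'"
          using mdist_triangle[of q X q' p] mdist_commute[of X p q'] Qp[OF qr(1)] Pm[OF p] NZ p by auto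
        ultimately show ?thesis
          using P(4)[OF NZ(1)[OF p(1)] p(2)] sQ[OF qr(1)] Rs0 by linarith
      qed
      have UP: "separated_balls X (\<Union>p\<in>N. P p)" "tot (\<Union>p\<in>N. P p) = (\<Sum>p\<in>N. tot (P p))"
        using separated_balls_UN[OF finN, of X P n] P(1) NZ crossP unfolding tot_def by blast+
      define Q' where "Q' = Q \<union> (\<Union>p\<in>N. P p)"
      have Q'sep: "separated_balls X Q'" and disj: "Q \<inter> (\<Union>p\<in>N. P p) = {}"
        unfolding Q'_def using separated_balls_Un[OF Qsep UP(1) crossQ] by auto
      have "finite (\<Union>p\<in>N. P p)" using UP(1) by (simp add: separated_balls_def)
      then have totQ': "tot Q' = tot Q + (\<Sum>p\<in>N. tot (P p))"
        unfolding Q'_def UP(2)[symmetric] using disj Qfin unfolding tot_def by (intro sum.union_disjoint)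
      have "near (\<Union>p\<in>N. P p) = (\<Union>p\<in>N. near (P p))" by (auto simp: near_def)
      then have "g ` near Q' = g ` near Q \<union> (\<Union>p\<in>N. g ` near (P p))"
        unfolding Q'_def near_Un by auto
      moreover have "cover_cost Y n \<delta> (g ` near Q \<union> (\<Union>p\<in>N. g ` near (P p)))
          (\<eta> * tot Q + (\<Sum>p\<in>N. \<eta> * tot (P p)))"
        using Q P(2) NZ finN unfolding adm_def cheap_def by (intro cover_cost_Un cover_cost_UN) auto
      ultimately have "cheap Q'"
        unfolding cheap_def totQ' by (simp add: distrib_left sum_distrib_left)
      moreover have "mdist X z0 q \<le> B + 1 \<and> r \<le> \<rho>0" if qQ': "(q, r) \<in> Q'" for q r
      proof (cases "(q, r) \<in> Q")
        case True
        then show ?thesis using Q by (auto simp: adm_def)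
      next
        case False
        then obtain p where p: "p \<in> N" "(q, r) \<in> P p" using qQ' by (auto simp: Q'_def)
        have "mdist X z0 q \<le> mdist X z0 p + mdist X p q"
          using mdist_triangle z0X NZ(2) Pm(1) p by metis
        then show ?thesis
          using B0[OF NZ(1)[OF p(1)]] P(4)[OF NZ(1)[OF p(1)] p(2)] P(5)[OF NZ(1)[OF p(1)] p(2)] Pm(2)[OF p]
            s1 s\<rho>0 by linarith
      qed
      ultimately have "adm Q'" using Q'sep by (auto simp: adm_def)
      then have "(\<Sum>p\<in>N. tot (P p)) \<le> \<epsilon>'" using Qmax[of Q'] totQ' by simp
      moreover have "card N * (\<epsilon> * s / 4) powr n \<le> (\<Sum>p\<in>N. tot (P p))"
        using P(3) NZ by (intro sum_bounded_below) auto
      ultimately have cardN: "card N * (\<epsilon> * s / 4) powr n \<le> \<epsilon>'" by linarith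
      have weq: "10 * L * R * s = w * (\<epsilon> * s / 4)" using \<epsilon> by (simp add: w_def)
      have "(\<Sum>p\<in>N. (10 * L * R * s) powr n) = card N * (\<epsilon> * s / 4) powr n * w powr n"
        unfolding weq powr_mult by simp
      also have "\<dots> \<le> \<epsilon>' * w powr n" using cardN by (intro mult_right_mono) auto
      finally have rest: "(\<Sum>p\<in>N. (10 * L * R * s) powr n) \<le> \<kappa> / 2" using \<epsilon>' by simp
      define G where "G p = g ` {z \<in> Z. mdist X z p < 5 * (R * s)}" for p
      have "cover_cost Y n \<delta> (G p) ((10 * L * R * s) powr n)" if p: "p \<in> N" for p
      proof (rule cover_cost_single)
        show "G p \<subseteq> mspace Y" using gY by (auto simp: G_def)
        show "0 < 10 * L * R * s" using L R s0 by simp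
        fix a b assume "a \<in> G p" "b \<in> G p"
        then obtain x y where xy: "x \<in> Z" "y \<in> Z" "a = g x" "b = g y" "mdist X x p < 5 * (R * s)" "mdist X y p < 5 * (R * s)"
          by (auto simp: G_def)
        have "mdist X x y \<le> 10 * (R * s)"
          using mdist_triangle[of x X p y] mdist_commute[of X p y] xy(5,6) NZ(2)[OF p]
            subsetD[OF Z(1) xy(1)] subsetD[OF Z(1) xy(2)] by linarith
        then have "L * mdist X x y \<le> L * (10 * (R * s))" using L by (intro mult_left_mono) auto
        then show "mdist Y a b \<le> 10 * L * R * s" using lip[OF xy(1,2)] xy(3,4) by (simp add: mult_ac)
      qed (use s\<delta> in auto)
      then have "cover_cost Y n \<delta> (g ` near Q \<union> (\<Union>p\<in>N. G p)) (\<eta> * tot Q + (\<Sum>p\<in>N. (10 * L * R * s) powr n))"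
        using Q finN unfolding adm_def cheap_def by (intro cover_cost_Un cover_cost_UN) auto
      then have "cover_cost Y n \<delta> (g ` Z) \<kappa>"
      proof (rule cover_cost_mono)
        show "g ` Z \<subseteq> g ` near Q \<union> (\<Union>p\<in>N. G p)"
        proof
          fix y assume "y \<in> g ` Z"
          then obtain z where z: "z \<in> Z" "y = g z" by blast
          then show "y \<in> g ` near Q \<union> (\<Union>p\<in>N. G p)" using N(3)[of z] by (auto simp: A_def G_def)
        qed
        have "\<eta> * tot Q \<le> \<eta> * K" using totK[OF Q] \<eta> by (intro mult_left_mono) auto
        then show "\<eta> * tot Q + (\<Sum>p\<in>N. (10 * L * R * s) powr n) \<le> \<kappa>" using rest \<eta> by linarith
      qed
      then have "hausdorff_content Y n \<delta> (g ` Z) \<le> ennreal \<kappa>"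
        using n by (rule hausdorff_content_le_cover_cost)
      then show False using \<kappa> by simp
    qed
    then show thesis by (rule that)
  qed
qed

section \<open>The Assouad embedding\<close>

text \<open>A colouring of a net such that points of one colour are far apart, obtained greedily: each class
  is a maximal \<open>4 * s\<close>-separated set of points not yet within \<open>s / 4\<close> of an earlier class. A point
  left over after \<open>M + 1\<close> steps would, by maximality, have a point of every class within distance
  \<open>4 * s\<close>, and these \<open>M + 1\<close> points are \<open>s / 4\<close>-separated.\<close>

lemma separated_classes:
  assumes M: "packing_bound X M" and s: "0 < s"
  obtains C :: "nat \<Rightarrow> 'a set" where "\<And>i. C i \<subseteq> mspace X"
    "\<And>i v w. v \<in> C i \<Longrightarrow> w \<in> C i \<Longrightarrow> v \<noteq> w \<Longrightarrow> 4 * s \<le> mdist X v w"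
    "\<And>x. x \<in> mspace X \<Longrightarrow> \<exists>i\<le>M. \<exists>v\<in>C i. mdist X x v < s / 4"
proof -
  have "\<forall>A. \<exists>S. A \<subseteq> mspace X \<longrightarrow> S \<subseteq> A \<and> (\<forall>v\<in>S. \<forall>w\<in>S. v \<noteq> w \<longrightarrow> 4 * s \<le> mdist X v w) \<and>
      (\<forall>x\<in>A. \<exists>v\<in>S. mdist X x v < 4 * s)" (is "\<forall>A. \<exists>S. ?P A S")
  proof
    fix A show "\<exists>S. ?P A S"
    proof (cases "A \<subseteq> mspace X")
      case True
      then show ?thesis
        using maximal_separated_subset[of A X "4 * s"] s by (metis mult_pos_pos zero_less_numeral)
    qed blast
  qed
  then obtain S where S: "\<And>A. A \<subseteq> mspace X \<Longrightarrow> S A \<subseteq> A"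
    "\<And>A v w. A \<subseteq> mspace X \<Longrightarrow> v \<in> S A \<Longrightarrow> w \<in> S A \<Longrightarrow> v \<noteq> w \<Longrightarrow> 4 * s \<le> mdist X v w"
    "\<And>A x. A \<subseteq> mspace X \<Longrightarrow> x \<in> A \<Longrightarrow> \<exists>v\<in>S A. mdist X x v < 4 * s"
    by metis
  define rest where "rest U = {x \<in> mspace X. \<forall>v\<in>U. s / 4 \<le> mdist X x v}" for U
  define U where "U = rec_nat {} (\<lambda>_ U. U \<union> S (rest U))"
  define C where "C i = S (rest (U i))" for i
  have U: "U 0 = {}" "U (Suc i) = U i \<union> C i" for i by (simp_all add: U_def C_def)
  have restX: "rest V \<subseteq> mspace X" for V by (auto simp: rest_def)
  have CU: "C j \<subseteq> U i" if "j < i" for i j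
    using that by (induction i) (auto simp: U less_Suc_eq)
  have UC: "\<exists>j<i. v \<in> C j" if "v \<in> U i" for i v
    using that by (induction i) (auto simp: U less_Suc_eq)
  have cover: "\<exists>i\<le>M. \<exists>v\<in>C i. mdist X x v < s / 4" if x: "x \<in> mspace X" for x
  proof (rule ccontr)
    assume "\<not> ?thesis"
    then have far: "\<And>i v. i \<le> M \<Longrightarrow> v \<in> C i \<Longrightarrow> s / 4 \<le> mdist X x v" by force
    have "x \<in> rest (U i)" if "i \<le> M" for i
    proof -
      have "s / 4 \<le> mdist X x v" if v: "v \<in> U i" for v
      proof -
        obtain j where "j < i" "v \<in> C j" using UC[OF v] by blast
        with \<open>i \<le> M\<close> show ?thesis by (intro far[of j]) auto
      qed
      then show ?thesis using x by (simp add: rest_def)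
    qed
    then have "\<forall>i. \<exists>v. i \<le> M \<longrightarrow> v \<in> C i \<and> mdist X x v < 4 * s"
      using S(3)[OF restX] by (fastforce simp: C_def)
    then obtain v where v: "\<And>i. i \<le> M \<Longrightarrow> v i \<in> C i \<and> mdist X x (v i) < 4 * s" by metis
    have vrest: "v i \<in> rest (U i)" if "i \<le> M" for i
      using v[OF that] S(1)[OF restX] by (auto simp: C_def)
    have sep': "s / 4 \<le> mdist X (v i) (v j)" if "i \<le> M" "j < i" for i j
      using vrest[OF that(1)] v[of j] CU[OF that(2)] that by (auto simp: rest_def)
    have sep: "s / 4 \<le> mdist X (v i) (v j)" if "i \<le> M" "j \<le> M" "i \<noteq> j" for i j
    proof (cases "j < i")
      case False
      then show ?thesis using sep'[of j i] that by (simp add: mdist_commute)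
    qed (use sep' that in auto)
    have vX: "v i \<in> mspace X" if "i \<le> M" for i using vrest[OF that] restX by blast
    have inj: "inj_on v {..M}"
    proof (rule inj_onI)
      fix i j assume ij: "i \<in> {..M}" "j \<in> {..M}" "v i = v j"
      show "i = j"
      proof (rule ccontr)
        assume "i \<noteq> j"
        with ij have "s / 4 \<le> mdist X (v i) (v i)" using sep[of i j] by auto
        then show False using vX[of i] ij s by simp
      qed
    qed
    have "v ` {..M} \<subseteq> mball_of X x (16 * (s / 4))" using v vX x by auto
    moreover have "\<forall>a\<in>v ` {..M}. \<forall>b\<in>v ` {..M}. a \<noteq> b \<longrightarrow> s / 4 \<le> mdist X a b"
      using sep by auto
    ultimately have "card (v ` {..M}) \<le> M"
      using M x s unfolding packing_bound_def by (metis divide_pos_pos finite_atMost finite_imageI zero_less_numeral)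
    then show False by (simp add: card_image[OF inj])
  qed
  show thesis
  proof (rule that[of C])
    show "C i \<subseteq> mspace X" for i using S(1)[OF restX] restX unfolding C_def by blast
  qed (use S(2)[OF restX] cover in \<open>auto simp: C_def\<close>)
qed

text \<open>With \<open>s\<close> in the set the infimum is over a non-empty set, and an empty \<open>C\<close> gives \<open>s\<close>.\<close>

definition truncated_dist :: "'a metric \<Rightarrow> real \<Rightarrow> 'a set \<Rightarrow> 'a \<Rightarrow> real" where
  "truncated_dist X s C x = Inf (insert s (mdist X x ` C))"

lemma truncated_dist_bdd: "bdd_below (insert s (mdist X x ` C))"
  by (simp, rule bdd_belowI[of _ 0]) auto

lemma truncated_dist_le: "truncated_dist X s C x \<le> s" "v \<in> C \<Longrightarrow> truncated_dist X s C x \<le> mdist X x v"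
  unfolding truncated_dist_def by (rule cInf_lower[OF _ truncated_dist_bdd]; simp)+

lemma truncated_dist_ge:
  "t \<le> s \<Longrightarrow> (\<And>v. v \<in> C \<Longrightarrow> t \<le> mdist X x v) \<Longrightarrow> t \<le> truncated_dist X s C x"
  unfolding truncated_dist_def by (rule cInf_greatest) auto

lemma truncated_dist_diff:
  assumes "x \<in> mspace X" "y \<in> mspace X" "C \<subseteq> mspace X" "0 \<le> s"
  shows "\<bar>truncated_dist X s C x - truncated_dist X s C y\<bar> \<le> mdist X x y"
    "\<bar>truncated_dist X s C x - truncated_dist X s C y\<bar> \<le> s"
proof -
  have "truncated_dist X s C x - mdist X x y \<le> truncated_dist X s C y"
    if xy: "x \<in> mspace X" "y \<in> mspace X" for x y
  proof (rule truncated_dist_ge)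
    show "truncated_dist X s C x - mdist X x y \<le> s"
      using truncated_dist_le(1)[of X s C x] mdist_nonneg[of X x y] by linarith
    fix v assume v: "v \<in> C"
    then have "mdist X x v \<le> mdist X x y + mdist X y v" using xy assms(3) by (auto intro: mdist_triangle)
    with truncated_dist_le(2)[OF v, of X s x] show "truncated_dist X s C x - mdist X x y \<le> mdist X y v"
      by linarith
  qed
  from this[OF assms(1,2)] this[OF assms(2,1)]
  show "\<bar>truncated_dist X s C x - truncated_dist X s C y\<bar> \<le> mdist X x y" by (simp add: mdist_commute abs_le_iff)
  have "0 \<le> truncated_dist X s C z" for z using assms(4) by (intro truncated_dist_ge) auto
  then show "\<bar>truncated_dist X s C x - truncated_dist X s C y\<bar> \<le> s"
    using truncated_dist_le(1)[of X s C] by (smt (verit, best))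
qed

text \<open>The point \<open>x\<close> is close to \<open>v\<close>, so the value at \<open>x\<close> is small. The value at \<open>y\<close> is large, because
  \<open>y\<close> is far from \<open>v\<close> and every other point of \<open>C\<close> is too far from \<open>v\<close> to be near \<open>y\<close>.\<close>

lemma truncated_dist_separates:
  assumes "x \<in> mspace X" "y \<in> mspace X" "C \<subseteq> mspace X"
    and sep: "\<And>v w. v \<in> C \<Longrightarrow> w \<in> C \<Longrightarrow> v \<noteq> w \<Longrightarrow> 4 * s \<le> mdist X v w"
    and v: "v \<in> C" "mdist X x v < s / 4" and xy: "s \<le> mdist X x y" "mdist X x y < 2 * s"
  shows "s / 2 \<le> truncated_dist X s C y - truncated_dist X s C x"
proof -
  have "3 * s / 4 \<le> truncated_dist X s C y"
  proof (rule truncated_dist_ge)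
    show "3 * s / 4 \<le> s" using xy by linarith
    fix w assume w: "w \<in> C"
    have t: "mdist X x w \<le> mdist X x y + mdist X y w" "mdist X x y \<le> mdist X x w + mdist X y w"
      "mdist X v w \<le> mdist X x v + mdist X x w"
      using mdist_triangle[of x X y w] mdist_triangle[of x X w y] mdist_triangle[of v X x w]
        assms(1-3) v w by (auto simp: mdist_commute)
    show "3 * s / 4 \<le> mdist X y w"
    proof (cases "v = w")
      case True
      then show ?thesis using t(2) v(2) xy by simp
    next
      case False
      then show ?thesis using sep[OF v(1) w] t v xy by linarith
    qed
  qed
  moreover have "truncated_dist X s C x \<le> s / 4"
    using truncated_dist_le(2)[OF v(1), of X s x] v(2) by linarith
  ultimately show ?thesis by linarith
qed

lemma two_sided_geometric_sum_le:
  fixes F :: "int set"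
  assumes "finite F"
  shows "(\<Sum>l\<in>F - {l0}. (1 / 32 :: real) ^ nat \<bar>l - l0\<bar>) \<le> 2 / 31"
proof -
  have half: "(\<Sum>l\<in>G. (1 / 32 :: real) ^ nat \<bar>l - l0\<bar>) \<le> 1 / 31"
    if G: "finite G" "inj_on (\<lambda>l. nat \<bar>l - l0\<bar>) G" "l0 \<notin> G" for G
  proof -
    define H where "H = (\<lambda>l. nat \<bar>l - l0\<bar>) ` G"
    have H: "finite H" "0 \<notin> H" using G by (auto simp: H_def)
    have "(\<Sum>l\<in>G. (1 / 32 :: real) ^ nat \<bar>l - l0\<bar>) = (\<Sum>k\<in>H. (1 / 32) ^ k)"
      unfolding H_def using G(2) by (simp add: sum.reindex)
    also have "\<dots> \<le> (\<Sum>k\<in>{1..Max (insert 0 H)}. (1 / 32) ^ k)"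
    proof (rule sum_mono2)
      show "H \<subseteq> {1..Max (insert 0 H)}"
        using H by (auto simp: Suc_le_eq intro: Max_ge) (metis gr0I)
    qed auto
    also have "\<dots> \<le> 1 / 31"
    proof -
      have "31 * (\<Sum>k\<in>{1..m}. (1 / 32 :: real) ^ k) = 1 - (1 / 32) ^ m" for m
        by (induction m) (simp_all add: distrib_left)
      from this[of "Max (insert 0 H)"] show ?thesis
        using zero_le_power[of "1 / 32 :: real" "Max (insert 0 H)"] by linarith
    qed
    finally show ?thesis .
  qed
  have "F - {l0} = {l \<in> F. l < l0} \<union> {l \<in> F. l > l0}" by auto
  then have "(\<Sum>l\<in>F - {l0}. (1 / 32 :: real) ^ nat \<bar>l - l0\<bar>) =
      (\<Sum>l\<in>{l \<in> F. l < l0}. (1 / 32) ^ nat \<bar>l - l0\<bar>) + (\<Sum>l\<in>{l \<in> F. l > l0}. (1 / 32) ^ nat \<bar>l - l0\<bar>)"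
    using assms by (simp add: sum.union_disjoint disjoint_iff)
  also have "\<dots> \<le> 1 / 31 + 1 / 31"
    using assms by (intro add_mono half) (auto simp: inj_on_def)
  finally show ?thesis by simp
qed

lemma infsum_abs_le:
  fixes f :: "'i \<Rightarrow> real"
  assumes "\<And>F. finite F \<Longrightarrow> F \<subseteq> A \<Longrightarrow> (\<Sum>i\<in>F. \<bar>f i\<bar>) \<le> K"
  shows "f summable_on A" "\<bar>infsum f A\<bar> \<le> K"
proof -
  have abs: "(\<lambda>i. norm (f i)) summable_on A"
    unfolding abs_summable_iff_bdd_above using assms by (auto simp: bdd_above_def)
  then show "f summable_on A" by (rule abs_summable_summable)
  have "\<bar>infsum f A\<bar> \<le> (\<Sum>\<^sub>\<infinity>i\<in>A. norm (f i))" using norm_infsum_bound[OF abs] by simp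
  also have "\<dots> \<le> K" using abs assms by (intro infsum_le_finite_sums) auto
  finally show "\<bar>infsum f A\<bar> \<le> K" .
qed

text \<open>The terms of the series decay geometrically away from the scale comparable to \<open>d\<close>: the first
  bound handles the smaller scales and the second the larger ones. The factor \<open>32\<close> of the
  decay is large enough for all other terms together to stay below a quarter of the size
  \<open>t * 32 powi l0\<close> of the scale.\<close>

lemma scale_series:
  fixes c :: "int \<Rightarrow> real"
  assumes t: "0 < t" and d: "0 \<le> d"
    and c1: "\<And>l. \<bar>c l\<bar> \<le> t * 32 powi l" and c2: "\<And>l. \<bar>c l\<bar> \<le> d / (t * 32 powi l)"
  shows "c summable_on UNIV" "\<bar>infsum c UNIV\<bar> \<le> 40 * sqrt d"
    and "(t * 32 powi l0)\<^sup>2 \<le> d \<Longrightarrow> d < 2 * (t * 32 powi l0)\<^sup>2 \<Longrightarrow>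
      \<bar>c l0\<bar> - t * 32 powi l0 / 4 \<le> \<bar>infsum c UNIV\<bar>"
proof -
  have est: "\<bar>c l\<bar> \<le> E * (1 / 32) ^ nat \<bar>l - k\<bar>"
    if "t * 32 powi k \<le> E" "d / (t * 32 powi k) \<le> E" for E k l
  proof (cases "l \<le> k")
    case True
    have "l = k + - int (nat (k - l))" using True by simp
    then have "(32 :: real) powi l = 32 powi (k + - int (nat (k - l)))" by metis
    also have "\<dots> = 32 powi k * 32 powi (- int (nat (k - l)))" by (rule power_int_add) simp
    also have "32 powi (- int (nat (k - l))) = (1 / 32 :: real) ^ nat (k - l)"
      unfolding power_int_minus power_int_of_nat by (simp add: power_one_over inverse_eq_divide)
    finally have "t * 32 powi l = (t * 32 powi k) * (1 / 32) ^ nat (k - l)" by simp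
    also have "\<dots> \<le> E * (1 / 32) ^ nat (k - l)" using that by (intro mult_right_mono) auto
    also have "nat (k - l) = nat \<bar>l - k\<bar>" using True by simp
    finally show ?thesis using c1[of l] by linarith
  next
    case False
    have "l = k + int (nat (l - k))" using False by simp
    then have "(32 :: real) powi l = 32 powi (k + int (nat (l - k)))" by metis
    also have "\<dots> = 32 powi k * 32 powi int (nat (l - k))" by (rule power_int_add) simp
    also have "32 powi int (nat (l - k)) = (32 :: real) ^ nat (l - k)" by (rule power_int_of_nat)
    finally have "d / (t * 32 powi l) = (d / (t * 32 powi k)) * (1 / 32) ^ nat (l - k)"
      by (simp add: field_simps)
    also have "\<dots> \<le> E * (1 / 32) ^ nat (l - k)" using that by (intro mult_right_mono) auto
    also have "nat (l - k) = nat \<bar>l - k\<bar>" using False by simp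
    finally show ?thesis using c2[of l] by linarith
  qed
  have sums: "(\<Sum>l\<in>F - {k}. \<bar>c l\<bar>) \<le> E * (2 / 31)"
    if "t * 32 powi k \<le> E" "d / (t * 32 powi k) \<le> E" "finite F" for E k F
  proof -
    have "0 < t * 32 powi k" using t by simp
    then have E: "0 \<le> E" using that(1) by linarith
    have "(\<Sum>l\<in>F - {k}. \<bar>c l\<bar>) \<le> (\<Sum>l\<in>F - {k}. E * (1 / 32) ^ nat \<bar>l - k\<bar>)"
      by (intro sum_mono est that)
    also have "\<dots> = E * (\<Sum>l\<in>F - {k}. (1 / 32) ^ nat \<bar>l - k\<bar>)" by (simp add: sum_distrib_left)
    also have "\<dots> \<le> E * (2 / 31)" using two_sided_geometric_sum_le[OF that(3)] E by (rule mult_left_mono)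
    finally show ?thesis .
  qed
  have total: "(\<Sum>l\<in>F. \<bar>c l\<bar>) \<le> 40 * sqrt d" if F: "finite F" for F
  proof (cases "d = 0")
    case True
    then have "c l = 0" for l using c2[of l] by simp
    then show ?thesis using d by simp
  next
    case False
    then have d0: "0 < sqrt d" using d by simp
    \<comment> \<open>The scale comparable to \<open>d\<close>, at which both bounds are of order \<open>sqrt d\<close>.\<close>
    define k where "k = \<lfloor>log 32 (sqrt d / t)\<rfloor>"
    have pow: "32 powi j = 32 powr (real_of_int j)" for j :: int
      by (simp add: powr_real_of_int')
    have "32 powr (real_of_int k) \<le> sqrt d / t"
      using d0 t by (subst le_log_iff[symmetric]) (auto simp: k_def)
    then have k1: "t * 32 powi k \<le> sqrt d" using t by (simp add: pow field_simps)
    have "sqrt d / t \<le> 32 powr (real_of_int k + 1)"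
      using d0 t by (subst log_le_iff[symmetric]) (auto simp: k_def)
    then have k2: "sqrt d \<le> 32 * (t * 32 powi k)" using t by (simp add: pow powr_add field_simps)
    have tk: "0 < t * 32 powi k" using t by simp
    have "d = sqrt d * sqrt d" using d by simp
    also have "\<dots> \<le> sqrt d * (32 * (t * 32 powi k))" using k2 d0 by (intro mult_left_mono) auto
    finally have k3: "d / (t * 32 powi k) \<le> 32 * sqrt d" using tk by (simp add: field_simps)
    have E: "t * 32 powi k \<le> 32 * sqrt d" using k1 d0 by linarith
    have "(\<Sum>l\<in>F. \<bar>c l\<bar>) \<le> (\<Sum>l\<in>insert k F. \<bar>c l\<bar>)" using F by (intro sum_mono2) auto
    also have "\<dots> = \<bar>c k\<bar> + (\<Sum>l\<in>F - {k}. \<bar>c l\<bar>)" using F by (simp add: sum.insert_remove)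
    also have "\<dots> \<le> 32 * sqrt d + 32 * sqrt d * (2 / 31)"
      using sums[OF E k3 F] est[OF E k3, of k] by simp
    also have "\<dots> \<le> 40 * sqrt d" using d0 by simp
    finally show ?thesis .
  qed
  then show "c summable_on UNIV" "\<bar>infsum c UNIV\<bar> \<le> 40 * sqrt d"
    by (auto intro!: infsum_abs_le)
  define b where "b = t * 32 powi l0"
  have b: "0 < b" using t by (simp add: b_def)
  assume "(t * 32 powi l0)\<^sup>2 \<le> d" "d < 2 * (t * 32 powi l0)\<^sup>2"
  then have db: "b\<^sup>2 \<le> d" "d < 2 * b\<^sup>2" by (simp_all add: b_def)
  have E: "t * 32 powi l0 \<le> 2 * b" using b by (simp add: b_def)
  have E': "d / (t * 32 powi l0) \<le> 2 * b"
    unfolding b_def[symmetric] using b db by (simp add: field_simps power2_eq_square)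
  have *: "(\<Sum>l\<in>F. \<bar>c l\<bar>) \<le> 2 * b * (2 / 31)" if "finite F" "F \<subseteq> - {l0}" for F
  proof -
    have "F - {l0} = F" using that by auto
    then show ?thesis using sums[OF E E' that(1)] by simp
  qed
  have "infsum c ({l0} \<union> - {l0}) = infsum c {l0} + infsum c (- {l0})"
    using infsum_abs_le(1)[of "- {l0}" c, OF *] by (intro infsum_Un_disjoint) auto
  then have "infsum c UNIV = c l0 + infsum c (- {l0})" by (simp add: Compl_partition)
  moreover have "\<bar>infsum c (- {l0})\<bar> \<le> 2 * b * (2 / 31)" by (rule infsum_abs_le(2)[OF *])
  ultimately show "\<bar>c l0\<bar> - t * 32 powi l0 / 4 \<le> \<bar>infsum c UNIV\<bar>"
    unfolding b_def[symmetric] using b by linarith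
qed

text \<open>Consecutive scales in one series differ by the factor \<open>1024 = 2 ^ 10\<close>; the ten residues \<open>a\<close>
  distribute all dyadic scales over ten series.\<close>

lemma dyadic_scale:
  fixes d :: real
  assumes "0 < d"
  obtains a :: nat and l :: int where "a < 10" "(sqrt (2 ^ a) * 32 powi l)\<^sup>2 \<le> d" "d < 2 * (sqrt (2 ^ a) * 32 powi l)\<^sup>2"
proof -
  define k where "k = \<lfloor>log 2 d\<rfloor>"
  define a where "a = nat (k mod 10)"
  define l where "l = k div 10"
  have "k = int a + 10 * l" unfolding a_def l_def by simp
  then have "(2 :: real) powi k = 2 powi int a * 2 powi (10 * l)"
    by (metis power_int_add zero_neq_numeral)
  also have "(2 :: real) powi int a = 2 ^ a" by (rule power_int_of_nat)
  also have "(2 :: real) powi (10 * l) = 1024 powi l"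
    by (simp add: power_int_mult)
  also have "(1024 :: real) powi l = (32 powi l)\<^sup>2"
    by (simp add: power2_eq_square flip: power_int_mult_distrib)
  finally have eq: "2 powi k = (sqrt (2 ^ a) * 32 powi l)\<^sup>2" by (simp add: power_mult_distrib)
  have pow: "2 powi k = 2 powr (real_of_int k)"
    by (simp add: powr_real_of_int')
  have "2 powr (real_of_int k) \<le> d"
    using assms by (subst le_log_iff[symmetric]) (auto simp: k_def)
  moreover have "d < 2 powr (real_of_int k + 1)"
    using assms by (subst log_less_iff[symmetric]) (auto simp: k_def)
  moreover have "a < 10" by (simp add: a_def)
  ultimately show thesis
    by (intro that[of a l]) (simp_all add: eq[symmetric] pow powr_add)
qed

text \<open>Assouad's theorem for the exponent \<open>1 / 2\<close>. For every residue \<open>a\<close> and colour \<open>i\<close> one coordinate is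
  the sum over the scales \<open>s = 2 ^ a * 1024 powi l\<close> of the truncated distance to the colour class
  at scale \<open>s\<close>, divided by \<open>sqrt s\<close> and normalised to vanish at a base point so that the series
  converges. Two points at distance \<open>d\<close> are separated by the coordinate that belongs to the dyadic
  scale of \<open>d\<close> and to the colour of a net point near one of them.\<close>

lemma assouad_embedding:
  assumes "packing_bound X M"
  obtains N :: nat and L :: real and e :: "'a \<Rightarrow> nat \<Rightarrow> real" where "1 \<le> L"
    "\<And>x i. N \<le> i \<Longrightarrow> e x i = 0"
    "\<And>x y. x \<in> mspace X \<Longrightarrow> y \<in> mspace X \<Longrightarrow>
      sqrt (mdist X x y) / L \<le> mdist (Euclidean_metric N) (e x) (e y) \<and>
      mdist (Euclidean_metric N) (e x) (e y) \<le> L * sqrt (mdist X x y)"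
proof -
  have "\<forall>s. \<exists>C::nat \<Rightarrow> 'a set. 0 < s \<longrightarrow> (\<forall>i. C i \<subseteq> mspace X) \<and>
    (\<forall>i. \<forall>v\<in>C i. \<forall>w\<in>C i. v \<noteq> w \<longrightarrow> 4 * s \<le> mdist X v w) \<and>
    (\<forall>x\<in>mspace X. \<exists>i\<le>M. \<exists>v\<in>C i. mdist X x v < s / 4)" (is "\<forall>s. \<exists>C. ?P s C")
  proof
    fix s show "\<exists>C. ?P s C"
    proof (cases "0 < s")
      case True
      then show ?thesis using separated_classes[OF assms True] by metis
    qed auto
  qed
  then obtain C :: "real \<Rightarrow> nat \<Rightarrow> 'a set" where C: "\<And>s i. 0 < s \<Longrightarrow> C s i \<subseteq> mspace X"
    "\<And>s i v w. 0 < s \<Longrightarrow> v \<in> C s i \<Longrightarrow> w \<in> C s i \<Longrightarrow> v \<noteq> w \<Longrightarrow> 4 * s \<le> mdist X v w"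
    "\<And>s x. 0 < s \<Longrightarrow> x \<in> mspace X \<Longrightarrow> \<exists>i\<le>M. \<exists>v\<in>C s i. mdist X x v < s / 4"
    by metis
  define x0 where "x0 = (SOME x. x \<in> mspace X)"
  define N where "N = 10 * (M + 1)"
  define b where "b a l = sqrt (2 ^ a) * 32 powi l" for a :: nat and l :: int
  have b: "0 < b a l" for a l by (simp add: b_def)
  define \<psi> where "\<psi> a i l = truncated_dist X ((b a l)\<^sup>2) (C ((b a l)\<^sup>2) i)" for a i l
  define u where "u a i x y l = (\<psi> a i l x - \<psi> a i l y) / b a l" for a i x y l
  define e where "e x c = (if c < N then infsum (u (c mod 10) (c div 10) x x0) UNIV else 0)" for x c
  have u1: "\<bar>u a i x y l\<bar> \<le> sqrt (2 ^ a) * 32 powi l"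
    and u2: "\<bar>u a i x y l\<bar> \<le> mdist X x y / (sqrt (2 ^ a) * 32 powi l)"
    if "x \<in> mspace X" "y \<in> mspace X" for a i x y l
  proof -
    have bb: "0 < (b a l)\<^sup>2" using b[of a l] by simp
    have "\<bar>\<psi> a i l x - \<psi> a i l y\<bar> \<le> mdist X x y" "\<bar>\<psi> a i l x - \<psi> a i l y\<bar> \<le> b a l * b a l"
      using truncated_dist_diff[OF that C(1)[OF bb], of "(b a l)\<^sup>2" i]
      by (simp_all add: \<psi>_def power2_eq_square)
    then show "\<bar>u a i x y l\<bar> \<le> sqrt (2 ^ a) * 32 powi l"
      "\<bar>u a i x y l\<bar> \<le> mdist X x y / (sqrt (2 ^ a) * 32 powi l)"
      using b[of a l] unfolding u_def b_def[symmetric] by (simp_all add: field_simps)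
  qed
  note series = scale_series[OF _ mdist_nonneg u1 u2]
  have ediff: "e x c - e y c = infsum (u (c mod 10) (c div 10) x y) UNIV"
    if xy: "x \<in> mspace X" "y \<in> mspace X" and c: "c < N" for x y c
  proof -
    have x0: "x0 \<in> mspace X" unfolding x0_def using xy by (metis someI)
    have "e x c - e y c = infsum (\<lambda>l. u (c mod 10) (c div 10) x x0 l - u (c mod 10) (c div 10) y x0 l) UNIV"
      unfolding e_def using c series(1)[OF _ xy(1) x0 xy(1) x0] series(1)[OF _ xy(2) x0 xy(2) x0]
        infsum_add[of "u (c mod 10) (c div 10) x x0" UNIV "\<lambda>l. - u (c mod 10) (c div 10) y x0 l"]
      by (simp add: summable_on_uminus infsum_uminus)
    also have "(\<lambda>l. u (c mod 10) (c div 10) x x0 l - u (c mod 10) (c div 10) y x0 l) = u (c mod 10) (c div 10) x y"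
      by (auto simp: u_def diff_divide_distrib)
    finally show ?thesis .
  qed
  define L where "L = 40 * real N"
  have N1: "1 \<le> real N" by (simp add: N_def)
  have L4: "4 \<le> L" using N1 by (simp add: L_def)
  show thesis
  proof (rule that[of L N e])
    show "1 \<le> L" using L4 by simp
    show "e x i = 0" if "N \<le> i" for x i using that by (simp add: e_def)
    fix x y assume xy: "x \<in> mspace X" "y \<in> mspace X"
    have "L2_set (\<lambda>c. e x c - e y c) {..<N} \<le> (\<Sum>c<N. \<bar>e x c - e y c\<bar>)" by (rule L2_set_le_sum_abs)
    also have "\<dots> \<le> (\<Sum>c<N. 40 * sqrt (mdist X x y))"
      using series(2)[OF _ xy xy] ediff[OF xy] by (intro sum_mono) auto
    finally have upper: "L2_set (\<lambda>c. e x c - e y c) {..<N} \<le> L * sqrt (mdist X x y)" by (simp add: L_def)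
    have lower: "sqrt (mdist X x y) / L \<le> L2_set (\<lambda>c. e x c - e y c) {..<N}"
    proof (cases "mdist X x y = 0")
      case False
      then have "0 < mdist X x y" using mdist_nonneg[of X x y] by linarith
      then obtain a l where al: "a < 10" "(b a l)\<^sup>2 \<le> mdist X x y" "mdist X x y < 2 * (b a l)\<^sup>2"
        unfolding b_def by (rule dyadic_scale)
      have bb: "0 < (b a l)\<^sup>2" using b[of a l] by simp
      obtain i v where iv: "i \<le> M" "v \<in> C ((b a l)\<^sup>2) i" "mdist X x v < (b a l)\<^sup>2 / 4"
        using C(3)[OF bb xy(1)] by blast
      define c where "c = 10 * i + a"
      have c: "c < N" "c mod 10 = a" "c div 10 = i" using al(1) iv(1) by (auto simp: c_def N_def)
      have "(b a l)\<^sup>2 / 2 \<le> \<psi> a i l y - \<psi> a i l x"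
        unfolding \<psi>_def by (rule truncated_dist_separates[OF xy C(1)[OF bb] C(2)[OF bb] iv(2,3) al(2,3)])
      then have "(b a l)\<^sup>2 / 2 \<le> \<bar>\<psi> a i l x - \<psi> a i l y\<bar>" by linarith
      then have "b a l / 2 \<le> \<bar>u a i x y l\<bar>"
        using b[of a l] by (simp add: u_def field_simps power2_eq_square)
      moreover have "\<bar>u a i x y l\<bar> - b a l / 4 \<le> \<bar>infsum (u a i x y) UNIV\<bar>"
        unfolding b_def by (rule series(3)[OF _ xy xy]) (use al in \<open>auto simp: b_def\<close>)
      moreover have "\<bar>e x c - e y c\<bar> \<le> L2_set (\<lambda>c. e x c - e y c) {..<N}"
        using member_le_L2_set[of "{..<N}" c "\<lambda>c. \<bar>e x c - e y c\<bar>"] c(1) by (simp add: L2_set_def)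
      ultimately have low: "b a l / 4 \<le> L2_set (\<lambda>c. e x c - e y c) {..<N}"
        using ediff[OF xy c(1)] c by simp
      have "mdist X x y \<le> (2 * b a l)\<^sup>2" using al bb by (simp add: power_mult_distrib)
      then have "sqrt (mdist X x y) \<le> 2 * b a l" using b[of a l] by (intro real_le_lsqrt) auto
      moreover have "sqrt (mdist X x y) / L \<le> sqrt (mdist X x y) / 8"
        using N1 by (intro divide_left_mono) (auto simp: L_def)
      ultimately show ?thesis using low by linarith
    qed simp
    show "sqrt (mdist X x y) / L \<le> mdist (Euclidean_metric N) (e x) (e y) \<and>
      mdist (Euclidean_metric N) (e x) (e y) \<le> L * sqrt (mdist X x y)"
      using lower upper by simp
  qed
qed

section \<open>Ultralimits of rescaled spaces\<close>

text \<open>Along an ultrafilter every bounded real sequence converges. Taking all limits along one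
  ultrafilter makes the limits of both spaces and of all maps exist at once, without passing to
  subsequences; the sequence of indices required for a weak tangent is chosen at the very end.\<close>

definition free_ultrafilter :: "nat filter \<Rightarrow> bool" where
  "free_ultrafilter U \<longleftrightarrow> U \<noteq> bot \<and> U \<le> sequentially \<and> (\<forall>P. eventually P U \<or> eventually (\<lambda>j. \<not> P j) U)"

text \<open>A maximal family of sets all of whose finite intersections are infinite generates such a filter.\<close>

lemma free_ultrafilter_exists: "\<exists>U. free_ultrafilter U"
proof -
  define \<A> where "\<A> = {G :: nat set set. \<forall>F\<subseteq>G. finite F \<longrightarrow> infinite (\<Inter>F)}"
  have "\<exists>G\<in>\<A>. \<forall>H\<in>\<A>. G \<subseteq> H \<longrightarrow> H = G"
  proof (rule subset_Zorn_nonempty)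
    have "{} \<in> \<A>" by (simp add: \<A>_def)
    then show "\<A> \<noteq> {}" by blast
    fix \<C> assume C: "\<C> \<noteq> {}" "subset.chain \<A> \<C>"
    show "\<Union>\<C> \<in> \<A>"
      unfolding \<A>_def
    proof (intro CollectI allI impI)
      fix F assume F: "F \<subseteq> \<Union>\<C>" "finite F"
      obtain G where "G \<in> \<C>" "F \<subseteq> G"
        using finite_subset_Union_chain[OF F(2,1) C] by blast
      moreover have "\<C> \<subseteq> \<A>" using C(2) by (simp add: subset_chain_def)
      ultimately show "infinite (\<Inter>F)" using F(2) unfolding \<A>_def by blast
    qed
  qed
  then obtain G where G: "G \<in> \<A>" and max: "\<And>H. H \<in> \<A> \<Longrightarrow> G \<subseteq> H \<Longrightarrow> H = G" by blast
  have fip: "infinite (\<Inter>F)" if "F \<subseteq> G" "finite F" for F using G that by (auto simp: \<A>_def)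
  have small: "\<exists>F\<subseteq>G. finite F \<and> finite (A \<inter> \<Inter>F)" if "A \<notin> G" for A
  proof -
    have "insert A G \<notin> \<A>" using max[of "insert A G"] that by auto
    then obtain F where F: "F \<subseteq> insert A G" "finite F" "finite (\<Inter>F)" by (auto simp: \<A>_def)
    have "A \<inter> \<Inter>(F - {A}) \<subseteq> \<Inter>F" by blast
    then have "finite (A \<inter> \<Inter>(F - {A}))" using F(3) finite_subset by blast
    then show ?thesis using F by (intro exI[of _ "F - {A}"]) auto
  qed
  have dich: "A \<in> G \<or> - A \<in> G" for A
  proof (rule ccontr)
    assume "\<not> ?thesis"
    then obtain F F' where F: "F \<subseteq> G" "finite F" "finite (A \<inter> \<Inter>F)" "F' \<subseteq> G" "finite F'" "finite (- A \<inter> \<Inter>F')"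
      using small[of A] small[of "- A"] by blast
    have "\<Inter>(F \<union> F') \<subseteq> (A \<inter> \<Inter>F) \<union> (- A \<inter> \<Inter>F')" by blast
    then have "finite (\<Inter>(F \<union> F'))" using F(3,6) finite_subset by blast
    then show False using fip[of "F \<union> F'"] F by blast
  qed
  define U where "U = (INF A\<in>G. principal A)"
  have ev: "eventually P U \<longleftrightarrow> (\<exists>F\<subseteq>G. finite F \<and> (\<forall>j\<in>\<Inter>F. P j))" for P
    unfolding U_def by (subst eventually_INF) (auto simp: INF_principal_finite eventually_principal cong: conj_cong)
  have inG: "eventually (\<lambda>j. j \<in> A) U" if "A \<in> G" for A
    unfolding ev using that by (intro exI[of _ "{A}"]) auto
  have "U \<noteq> bot"
  proof
    assume "U = bot"
    then have "eventually (\<lambda>_. False) U" by simp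
    then obtain F where "F \<subseteq> G" "finite F" "\<Inter>F = {}" unfolding ev by blast
    then show False using fip[of F] by simp
  qed
  moreover have "U \<le> sequentially"
  proof (rule filter_leI)
    fix P assume "eventually P sequentially"
    then obtain n where n: "\<And>j. n \<le> j \<Longrightarrow> P j" by (auto simp: eventually_sequentially)
    have "- {n..} \<notin> G" using fip[of "{- {n..}}"] by (auto simp: Compl_atLeast)
    then have "eventually (\<lambda>j. j \<in> {n..}) U" using dich[of "{n..}"] inG by blast
    then show "eventually P U" by (rule eventually_mono) (use n in auto)
  qed
  moreover have "eventually P U \<or> eventually (\<lambda>j. \<not> P j) U" for P
    using dich[of "{j. P j}"] inG[of "{j. P j}"] inG[of "- {j. P j}"] by auto
  ultimately show ?thesis unfolding free_ultrafilter_def by blast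
qed

text \<open>By compactness the values cluster at some point, and an ultrafilter converges to each of its
  cluster points.\<close>

lemma ultrafilter_bounded_convergent:
  fixes a :: "nat \<Rightarrow> real"
  assumes U: "free_ultrafilter U" and "eventually (\<lambda>j. \<bar>a j\<bar> \<le> B) U"
  obtains l where "(a \<longlongrightarrow> l) U"
proof -
  have "filtermap a U \<noteq> bot" using U by (simp add: free_ultrafilter_def filtermap_bot_iff)
  moreover have "eventually (\<lambda>x. x \<in> {- B..B}) (filtermap a U)"
    unfolding eventually_filtermap using assms(2) by (rule eventually_mono) auto
  ultimately obtain l where l: "inf (nhds l) (filtermap a U) \<noteq> bot"
    using compact_Icc[of "- B" B] unfolding compact_filter by blast
  have "(a \<longlongrightarrow> l) U"
    unfolding tendsto_def
  proof (intro allI impI)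
    fix S assume S: "open S" "l \<in> S"
    show "eventually (\<lambda>j. a j \<in> S) U"
    proof (rule ccontr)
      assume "\<not> ?thesis"
      then have "eventually (\<lambda>j. a j \<notin> S) U" using U unfolding free_ultrafilter_def by blast
      then have "eventually (\<lambda>x. x \<notin> S) (filtermap a U)" by (simp add: eventually_filtermap)
      moreover have "eventually (\<lambda>x. x \<in> S) (nhds l)" using S by (simp add: eventually_nhds_in_open)
      ultimately have "eventually (\<lambda>_. False) (inf (nhds l) (filtermap a U))"
        unfolding eventually_inf by blast
      then show False using l by (simp add: trivial_limit_def)
    qed
  qed
  then show thesis by (rule that)
qed

text \<open>\<open>T\<close> is the limit along \<open>U\<close> of the pointed spaces \<open>(X, lam j * d, p j)\<close>, and \<open>conv x u\<close> says that
  the points \<open>x j\<close> converge to \<open>u\<close>. The clauses are what the study of maps between limits needs: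
  distances converge, sequences at bounded distance from the base points converge, and the limit
  is not changed by an error tending to \<open>0\<close>.\<close>

definition ultralimit ::
    "nat filter \<Rightarrow> 'a metric \<Rightarrow> (nat \<Rightarrow> real) \<Rightarrow> (nat \<Rightarrow> 'a) \<Rightarrow> 'b metric \<Rightarrow> ((nat \<Rightarrow> 'a) \<Rightarrow> 'b \<Rightarrow> bool) \<Rightarrow> bool" where
  "ultralimit U X lam p T conv \<longleftrightarrow>
     (\<forall>x u. conv x u \<longrightarrow> range x \<subseteq> mspace X \<and> u \<in> mspace T) \<and>
     (\<forall>u\<in>mspace T. \<exists>x. conv x u) \<and>
     (\<forall>x u y v. conv x u \<and> conv y v \<longrightarrow> ((\<lambda>j. lam j * mdist X (x j) (y j)) \<longlongrightarrow> mdist T u v) U) \<and>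
     (\<forall>x B. range x \<subseteq> mspace X \<and> eventually (\<lambda>j. lam j * mdist X (x j) (p j) \<le> B) U \<longrightarrow> (\<exists>u. conv x u)) \<and>
     (\<forall>x y u. conv x u \<and> range y \<subseteq> mspace X \<and> ((\<lambda>j. lam j * mdist X (x j) (y j)) \<longlongrightarrow> 0) U \<longrightarrow> conv y u)"

text \<open>Points with the same integer parts after division by a small \<open>\<eta>\<close> are close, and only finitely
  many such integer vectors occur.\<close>

lemma Euclidean_finite_net:
  fixes A :: "(nat \<Rightarrow> real) set"
  assumes A: "\<And>u i. u \<in> A \<Longrightarrow> i < N \<Longrightarrow> \<bar>u i\<bar> \<le> B" and \<delta>: "0 < \<delta>"
  obtains S where "finite S" "S \<subseteq> A" "\<And>u. u \<in> A \<Longrightarrow> \<exists>w\<in>S. L2_set (\<lambda>i. u i - w i) {..<N} < \<delta>"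
proof -
  define \<eta> where "\<eta> = \<delta> / (real N + 1)"
  have \<eta>: "0 < \<eta>" "real N * \<eta> < \<delta>" using \<delta> by (auto simp: \<eta>_def field_simps)
  define key where "key u = (\<lambda>i\<in>{..<N}. \<lfloor>u i / \<eta>\<rfloor>)" for u :: "nat \<Rightarrow> real"
  have "key ` A \<subseteq> {..<N} \<rightarrow>\<^sub>E {\<lfloor>- B / \<eta>\<rfloor>..\<lfloor>B / \<eta>\<rfloor>}"
  proof (intro image_subsetI PiE_I)
    fix u i assume "u \<in> A" "i \<in> {..<N}"
    then have "- B \<le> u i" "u i \<le> B" using A[of u i] by auto
    then have "- B / \<eta> \<le> u i / \<eta>" "u i / \<eta> \<le> B / \<eta>"
      using \<eta>(1) by (intro divide_right_mono; simp)+
    then show "key u i \<in> {\<lfloor>- B / \<eta>\<rfloor>..\<lfloor>B / \<eta>\<rfloor>}"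
      using \<open>i \<in> {..<N}\<close> by (auto simp: key_def intro: floor_mono)
  qed (auto simp: key_def)
  moreover have "finite ({..<N} \<rightarrow>\<^sub>E {\<lfloor>- B / \<eta>\<rfloor>..\<lfloor>B / \<eta>\<rfloor>})" by (intro finite_PiE) auto
  ultimately have fin: "finite (key ` A)" by (rule finite_subset)
  define S where "S = inv_into A key ` key ` A"
  have "\<exists>w\<in>S. L2_set (\<lambda>i. u i - w i) {..<N} < \<delta>" if u: "u \<in> A" for u
  proof -
    define w where "w = inv_into A key (key u)"
    have key: "key w = key u" unfolding w_def using u by (simp add: f_inv_into_f)
    have "\<bar>u i - w i\<bar> \<le> \<eta>" if "i < N" for i
    proof -
      have "\<lfloor>w i / \<eta>\<rfloor> = \<lfloor>u i / \<eta>\<rfloor>" using fun_cong[OF key, of i] that by (simp add: key_def)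
      then have "\<bar>u i / \<eta> - w i / \<eta>\<bar> \<le> 1" by linarith
      then show ?thesis using \<eta>(1) by (simp add: abs_le_iff field_simps)
    qed
    then have "(\<Sum>i<N. \<bar>u i - w i\<bar>) \<le> (\<Sum>i<N. \<eta>)" by (intro sum_mono) auto
    then have "L2_set (\<lambda>i. u i - w i) {..<N} < \<delta>"
      using L2_set_le_sum_abs[of "\<lambda>i. u i - w i" "{..<N}"] \<eta>(2) by simp
    moreover have "w \<in> S" using u by (auto simp: S_def w_def)
    ultimately show ?thesis by blast
  qed
  moreover have "S \<subseteq> A" by (auto simp: S_def intro: inv_into_into)
  moreover have "finite S" using fin by (simp add: S_def)
  ultimately show thesis using that[of S] by blast
qed

text \<open>The rescalings of one embedding \<open>e\<close> of the square root metric embed all spaces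
  \<open>(X, lam j * d, p j)\<close> with the same constants, so the limit can be formed in the same
  Euclidean space.\<close>

locale blowup =
  fixes U :: "nat filter" and X :: "'a metric" and lam :: "nat \<Rightarrow> real" and p :: "nat \<Rightarrow> 'a"
    and e :: "'a \<Rightarrow> nat \<Rightarrow> real" and N :: nat and L :: real
  assumes U: "free_ultrafilter U" and complete: "mcomplete_of X"
    and lam: "\<And>j. 0 < lam j" and p: "\<And>j. p j \<in> mspace X" and L: "1 \<le> L"
    and e0: "\<And>x i. N \<le> i \<Longrightarrow> e x i = 0"
    and e: "\<And>x y. x \<in> mspace X \<Longrightarrow> y \<in> mspace X \<Longrightarrow>
      sqrt (mdist X x y) / L \<le> mdist (Euclidean_metric N) (e x) (e y) \<and>
      mdist (Euclidean_metric N) (e x) (e y) \<le> L * sqrt (mdist X x y)"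
begin

lemma U_bot: "U \<noteq> bot" and U_seq: "U \<le> sequentially"
  and U_dich: "\<not> eventually P U \<Longrightarrow> eventually (\<lambda>j. \<not> P j) U"
  using U by (auto simp: free_ultrafilter_def)

abbreviation nrm :: "(nat \<Rightarrow> real) \<Rightarrow> (nat \<Rightarrow> real) \<Rightarrow> real" where
  "nrm u v \<equiv> L2_set (\<lambda>i. u i - v i) {..<N}"

definition E :: "nat \<Rightarrow> 'a \<Rightarrow> nat \<Rightarrow> real" where
  "E j x i = sqrt (lam j) * (e x i - e (p j) i)"

abbreviation D :: "nat \<Rightarrow> 'a \<Rightarrow> 'a \<Rightarrow> real" where
  "D j x y \<equiv> lam j * mdist X x y"

lemma nrm_commute: "nrm u v = nrm v u"
  by (simp add: L2_set_def power2_commute)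

lemma nrm_triangle: "nrm u w \<le> nrm u v + nrm v w"
  using L2_set_triangle_ineq [of "\<lambda>i. u i - v i" "\<lambda>i. v i - w i" "{..<N}"] by simp

lemma coord_le_nrm: "i < N \<Longrightarrow> \<bar>u i - v i\<bar> \<le> nrm u v"
  using member_le_L2_set[of "{..<N}" i "\<lambda>i. \<bar>u i - v i\<bar>"] by (simp add: L2_set_def)

lemma nrm_tendsto:
  assumes "\<And>i. i < N \<Longrightarrow> ((\<lambda>j. a j i) \<longlongrightarrow> u i) F" "\<And>i. i < N \<Longrightarrow> ((\<lambda>j. b j i) \<longlongrightarrow> v i) F"
  shows "((\<lambda>j. nrm (a j) (b j)) \<longlongrightarrow> nrm u v) F"
  unfolding L2_set_def using assms by (intro tendsto_intros) auto

lemma E_p: "E j (p j) i = 0" and E_ge: "N \<le> i \<Longrightarrow> E j x i = 0"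
  by (simp_all add: E_def e0)

lemma D_nonneg: "0 \<le> D j x y"
  using lam[of j] by simp

lemma D_triangle: "x \<in> mspace X \<Longrightarrow> y \<in> mspace X \<Longrightarrow> z \<in> mspace X \<Longrightarrow> D j x z \<le> D j x y + D j y z"
  using lam[of j] mdist_triangle[of x X y z] by (simp flip: distrib_left)

lemma E_bilipschitz:
  assumes "x \<in> mspace X" "y \<in> mspace X"
  shows "sqrt (D j x y) / L \<le> nrm (E j x) (E j y)" "nrm (E j x) (E j y) \<le> L * sqrt (D j x y)"
proof -
  have s: "0 \<le> sqrt (lam j)" using lam[of j] by simp
  have eq: "nrm (E j x) (E j y) = sqrt (lam j) * nrm (e x) (e y)"
    by (simp add: L2_set_right_distrib[OF s] E_def algebra_simps)
  have "sqrt (mdist X x y) / L \<le> nrm (e x) (e y)" "nrm (e x) (e y) \<le> L * sqrt (mdist X x y)"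
    using e[OF assms] by simp_all
  from mult_left_mono[OF this(1) s] mult_left_mono[OF this(2) s] show "sqrt (D j x y) / L \<le> nrm (E j x) (E j y)" "nrm (E j x) (E j y) \<le> L * sqrt (D j x y)"
    by (simp_all add: eq real_sqrt_mult mult_ac)
qed

lemma D_le:
  assumes "x \<in> mspace X" "y \<in> mspace X"
  shows "D j x y \<le> (L * nrm (E j x) (E j y))\<^sup>2"
proof -
  have "sqrt (D j x y) \<le> L * nrm (E j x) (E j y)"
    using E_bilipschitz(1)[OF assms, of j] L by (simp add: field_simps)
  then show ?thesis by (rule sqrt_le_D)
qed

definition conv :: "(nat \<Rightarrow> 'a) \<Rightarrow> (nat \<Rightarrow> real) \<Rightarrow> bool" where
  "conv x u \<longleftrightarrow> range x \<subseteq> mspace X \<and> (\<forall>i. ((\<lambda>j. E j (x j) i) \<longlongrightarrow> u i) U)"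

lemma conv_mem: "conv x u \<Longrightarrow> x j \<in> mspace X"
  by (auto simp: conv_def)

lemma conv_coord: "conv x u \<Longrightarrow> ((\<lambda>j. E j (x j) i) \<longlongrightarrow> u i) U"
  by (simp add: conv_def)

lemma conv_nrm2: "conv x u \<Longrightarrow> conv y v \<Longrightarrow> ((\<lambda>j. nrm (E j (x j)) (E j (y j))) \<longlongrightarrow> nrm u v) U"
  by (intro nrm_tendsto conv_coord)

lemma conv_nrm: "conv x u \<Longrightarrow> ((\<lambda>j. nrm (E j (x j)) u) \<longlongrightarrow> 0) U"
  using nrm_tendsto[of "\<lambda>j. E j (x j)" u U "\<lambda>_. u" u] by (simp add: conv_coord L2_set_def)

lemma conv_ge: "conv x u \<Longrightarrow> N \<le> i \<Longrightarrow> u i = 0"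
  using conv_coord[of x u i] U_bot by (simp add: E_ge tendsto_const_iff)

lemma conv_p: "conv p (\<lambda>_. 0)"
  using p by (auto simp: conv_def E_p)

lemma nrm_bounded_conv:
  assumes "range x \<subseteq> mspace X" "eventually (\<lambda>j. nrm (E j (x j)) (\<lambda>_. 0) \<le> B) U"
  obtains u where "conv x u"
proof -
  have "\<exists>l. ((\<lambda>j. E j (x j) i) \<longlongrightarrow> l) U" for i
  proof (cases "i < N")
    case True
    have ev: "eventually (\<lambda>j. \<bar>E j (x j) i\<bar> \<le> B) U"
      using assms(2)
    proof (rule eventually_mono)
      fix j assume "nrm (E j (x j)) (\<lambda>_. 0) \<le> B"
      with coord_le_nrm[OF True, of "E j (x j)" "\<lambda>_. 0"] show "\<bar>E j (x j) i\<bar> \<le> B" by simp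
    qed
    show ?thesis using ultrafilter_bounded_convergent[OF U ev] by blast
  next
    case False
    then show ?thesis by (auto simp: E_ge intro!: exI[of _ 0])
  qed
  then obtain u where "\<And>i. ((\<lambda>j. E j (x j) i) \<longlongrightarrow> u i) U" by metis
  then show thesis using that assms(1) by (auto simp: conv_def)
qed

lemma bounded_conv:
  assumes "range x \<subseteq> mspace X" "eventually (\<lambda>j. D j (x j) (p j) \<le> B) U"
  obtains u where "conv x u"
proof (rule nrm_bounded_conv[OF assms(1)])
  show "eventually (\<lambda>j. nrm (E j (x j)) (\<lambda>_. 0) \<le> L * sqrt B) U"
    using assms(2)
  proof (rule eventually_mono)
    fix j assume "D j (x j) (p j) \<le> B"
    then have "L * sqrt (D j (x j) (p j)) \<le> L * sqrt B" using L by (intro mult_left_mono) auto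
    moreover have "nrm (E j (x j)) (E j (p j)) \<le> L * sqrt (D j (x j) (p j))"
      using assms(1) p by (intro E_bilipschitz) auto
    ultimately show "nrm (E j (x j)) (\<lambda>_. 0) \<le> L * sqrt B" by (simp add: E_p)
  qed
qed (use that in blast)

lemma nrm_zero_conv:
  assumes "range y \<subseteq> mspace X" "((\<lambda>j. nrm (E j (y j)) u) \<longlongrightarrow> 0) U" "\<And>i. N \<le> i \<Longrightarrow> u i = 0"
  shows "conv y u"
proof -
  have "((\<lambda>j. E j (y j) i) \<longlongrightarrow> u i) U" for i
  proof (cases "i < N")
    case True
    have "((\<lambda>j. E j (y j) i - u i) \<longlongrightarrow> 0) U"
      by (rule Lim_null_comparison[OF _ assms(2)]) (simp add: coord_le_nrm[OF True])
    then show ?thesis by (simp add: LIM_zero_iff)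
  qed (simp add: E_ge assms(3))
  then show ?thesis using assms(1) by (simp add: conv_def)
qed

lemma close_conv:
  assumes "conv x u" "range y \<subseteq> mspace X" "((\<lambda>j. D j (x j) (y j)) \<longlongrightarrow> 0) U"
  shows "conv y u"
proof (rule nrm_zero_conv[OF assms(2)])
  have "((\<lambda>j. L * sqrt (D j (x j) (y j)) + nrm (E j (x j)) u) \<longlongrightarrow> L * sqrt 0 + 0) U"
    by (intro tendsto_intros assms(3) conv_nrm[OF assms(1)])
  then have lim: "((\<lambda>j. L * sqrt (D j (x j) (y j)) + nrm (E j (x j)) u) \<longlongrightarrow> 0) U" by simp
  have y: "y j \<in> mspace X" for j using assms(2) by auto
  have "nrm (E j (y j)) u \<le> L * sqrt (D j (x j) (y j)) + nrm (E j (x j)) u" for j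
    using nrm_triangle[of "E j (y j)" u "E j (x j)"] E_bilipschitz(2)[of "x j" "y j" j]
      conv_mem[OF assms(1), of j] y[of j] nrm_commute[of "E j (y j)" "E j (x j)"] by linarith
  then show "((\<lambda>j. nrm (E j (y j)) u) \<longlongrightarrow> 0) U"
    by (intro Lim_null_comparison[OF _ lim]) (auto intro: always_eventually)
  show "u i = 0" if "N \<le> i" for i using conv_ge[OF assms(1) that] .
qed

lemma conv_D_zero:
  assumes "conv x u" "conv y u"
  shows "((\<lambda>j. D j (x j) (y j)) \<longlongrightarrow> 0) U"
proof -
  have "((\<lambda>j. (L * nrm (E j (x j)) (E j (y j)))\<^sup>2) \<longlongrightarrow> (L * nrm u u)\<^sup>2) U"
    by (intro tendsto_intros conv_nrm2 assms)
  then have "((\<lambda>j. (L * nrm (E j (x j)) (E j (y j)))\<^sup>2) \<longlongrightarrow> 0) U" by (simp add: L2_set_def)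
  then show ?thesis
    by (rule Lim_null_comparison[rotated])
      (use D_le conv_mem assms D_nonneg in \<open>auto intro!: always_eventually simp del: zero_le_mult_iff\<close>)
qed

definition dh :: "(nat \<Rightarrow> real) \<Rightarrow> (nat \<Rightarrow> real) \<Rightarrow> real" where
  "dh u v = (SOME l. \<exists>x y. conv x u \<and> conv y v \<and> ((\<lambda>j. D j (x j) (y j)) \<longlongrightarrow> l) U)"

text \<open>Any two sequences converging to the same point have mutual distance tending to \<open>0\<close>, so the limit
  of the distances depends on the two limit points alone.\<close>

lemma dh:
  assumes "conv x u" "conv y v"
  shows "((\<lambda>j. D j (x j) (y j)) \<longlongrightarrow> dh u v) U"
proof -
  have ex: "\<exists>l. ((\<lambda>j. D j (x j) (y j)) \<longlongrightarrow> l) U"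
  proof -
    have "((\<lambda>j. (L * nrm (E j (x j)) (E j (y j)))\<^sup>2) \<longlongrightarrow> (L * nrm u v)\<^sup>2) U"
      by (intro tendsto_intros conv_nrm2 assms)
    then have "eventually (\<lambda>j. (L * nrm (E j (x j)) (E j (y j)))\<^sup>2 < (L * nrm u v)\<^sup>2 + 1) U"
      by (rule order_tendstoD) simp
    then have ev: "eventually (\<lambda>j. \<bar>D j (x j) (y j)\<bar> \<le> (L * nrm u v)\<^sup>2 + 1) U"
    proof (rule eventually_mono)
      fix j assume "(L * nrm (E j (x j)) (E j (y j)))\<^sup>2 < (L * nrm u v)\<^sup>2 + 1"
      moreover have "D j (x j) (y j) \<le> (L * nrm (E j (x j)) (E j (y j)))\<^sup>2"
        using assms by (intro D_le conv_mem)
      ultimately show "\<bar>D j (x j) (y j)\<bar> \<le> (L * nrm u v)\<^sup>2 + 1"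
        using D_nonneg[of j "x j" "y j"] by linarith
    qed
    show ?thesis using ultrafilter_bounded_convergent[OF U ev] by blast
  qed
  then have "\<exists>l. \<exists>x y. conv x u \<and> conv y v \<and> ((\<lambda>j. D j (x j) (y j)) \<longlongrightarrow> l) U" using assms by blast
  from someI_ex[OF this] obtain x' y' where xy': "conv x' u" "conv y' v" "((\<lambda>j. D j (x' j) (y' j)) \<longlongrightarrow> dh u v) U"
    unfolding dh_def by blast
  have "((\<lambda>j. D j (x j) (x' j) + D j (y j) (y' j)) \<longlongrightarrow> 0 + 0) U"
    by (intro tendsto_add conv_D_zero[OF assms(1) xy'(1)] conv_D_zero[OF assms(2) xy'(2)])
  then have lim: "((\<lambda>j. D j (x j) (x' j) + D j (y j) (y' j)) \<longlongrightarrow> 0) U" by simp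
  have "\<bar>D j (x j) (y j) - D j (x' j) (y' j)\<bar> \<le> D j (x j) (x' j) + D j (y j) (y' j)" for j
  proof -
    have m: "x j \<in> mspace X" "y j \<in> mspace X" "x' j \<in> mspace X" "y' j \<in> mspace X"
      using assms xy' conv_mem by auto
    show ?thesis
      using D_triangle[of "x j" "x' j" "y j" j] D_triangle[of "x' j" "y' j" "y j" j]
        D_triangle[of "x' j" "x j" "y' j" j] D_triangle[of "x j" "y j" "y' j" j] m
      by (simp add: mdist_commute abs_le_iff)
  qed
  then have "((\<lambda>j. D j (x j) (y j) - D j (x' j) (y' j)) \<longlongrightarrow> 0) U"
    by (intro Lim_null_comparison[OF _ lim] always_eventually) simp
  from tendsto_add[OF this xy'(3)] show ?thesis by simp
qed

definition F :: "(nat \<Rightarrow> real) set" where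
  "F = {u. \<exists>x. conv x u}"

lemma dh_bilipschitz:
  assumes "u \<in> F" "v \<in> F"
  shows "sqrt (dh u v) / L \<le> nrm u v" "nrm u v \<le> L * sqrt (dh u v)" "0 \<le> dh u v"
proof -
  obtain x y where xy: "conv x u" "conv y v" using assms by (auto simp: F_def)
  note m = conv_mem[OF xy(1)] conv_mem[OF xy(2)]
  note lim = dh[OF xy] conv_nrm2[OF xy]
  have L0: "L \<noteq> 0" using L by simp
  show "sqrt (dh u v) / L \<le> nrm u v"
    by (rule tendsto_le[OF U_bot lim(2)], rule tendsto_divide[OF tendsto_real_sqrt[OF lim(1)] tendsto_const L0])
      (use E_bilipschitz(1)[OF m] in \<open>auto intro: always_eventually\<close>)
  show "nrm u v \<le> L * sqrt (dh u v)"
    by (rule tendsto_le[OF U_bot tendsto_mult[OF tendsto_const tendsto_real_sqrt[OF lim(1)]] lim(2)])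
      (use E_bilipschitz(2)[OF m] in \<open>auto intro: always_eventually\<close>)
  show "0 \<le> dh u v"
    by (rule tendsto_lowerbound[OF lim(1) _ U_bot]) (use D_nonneg in \<open>auto intro: always_eventually\<close>)
qed

lemma dh_le: "u \<in> F \<Longrightarrow> v \<in> F \<Longrightarrow> dh u v \<le> (L * nrm u v)\<^sup>2"
  using dh_bilipschitz(1)[of u v] L by (intro sqrt_le_D) (simp add: field_simps)

lemma dh_commute: "u \<in> F \<Longrightarrow> v \<in> F \<Longrightarrow> dh u v = dh v u"
proof -
  assume "u \<in> F" "v \<in> F"
  then obtain x y where xy: "conv x u" "conv y v" by (auto simp: F_def)
  show ?thesis
    using tendsto_unique[OF U_bot dh[OF xy]] dh[OF xy(2,1)] by (simp add: mdist_commute)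
qed

lemma dh_triangle:
  assumes "u \<in> F" "v \<in> F" "w \<in> F"
  shows "dh u w \<le> dh u v + dh v w"
proof -
  obtain x y z where xyz: "conv x u" "conv y v" "conv z w" using assms by (auto simp: F_def)
  show ?thesis
    by (rule tendsto_le[OF U_bot tendsto_add[OF dh[OF xyz(1,2)] dh[OF xyz(2,3)]] dh[OF xyz(1,3)]])
      (use D_triangle xyz conv_mem in \<open>auto intro!: always_eventually\<close>)
qed

lemma F_ge: "u \<in> F \<Longrightarrow> N \<le> i \<Longrightarrow> u i = 0"
  by (auto simp: F_def conv_ge)

text \<open>The function \<open>dh\<close> is meaningful on \<open>F\<close> only; outside it is replaced by \<open>0\<close>, since a metric
  has to be symmetric and non-negative on the whole type.\<close>

lemma Metric_space_F: "Metric_space F (\<lambda>u v. if u \<in> F \<and> v \<in> F then dh u v else 0)"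
proof
  fix u v
  show "0 \<le> (if u \<in> F \<and> v \<in> F then dh u v else 0)" using dh_bilipschitz(3) by auto
  show "(if u \<in> F \<and> v \<in> F then dh u v else 0) = (if v \<in> F \<and> u \<in> F then dh v u else 0)"
    using dh_commute by auto
  assume uv: "u \<in> F" "v \<in> F"
  show "((if u \<in> F \<and> v \<in> F then dh u v else 0) = 0) = (u = v)"
  proof
    assume "(if u \<in> F \<and> v \<in> F then dh u v else 0) = 0"
    then have "nrm u v \<le> 0" using dh_bilipschitz(2)[OF uv] uv by simp
    then have "u i = v i" for i
      using coord_le_nrm[of i u v] F_ge[of u i] F_ge[of v i] uv by (cases "i < N") auto
    then show "u = v" by blast
  next
    assume "u = v"
    then have "dh u v \<le> 0" using dh_le[OF uv] by (simp add: L2_set_def)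
    then show "(if u \<in> F \<and> v \<in> F then dh u v else 0) = 0" using dh_bilipschitz(3)[OF uv] by simp
  qed
qed (use dh_triangle in auto)

definition T :: "(nat \<Rightarrow> real) metric" where
  "T = metric (F, \<lambda>u v. if u \<in> F \<and> v \<in> F then dh u v else 0)"

lemma mspace_T [simp]: "mspace T = F"
  and mdist_T: "u \<in> F \<Longrightarrow> v \<in> F \<Longrightarrow> mdist T u v = dh u v"
  by (simp_all add: T_def Metric_space.mspace_metric[OF Metric_space_F]
      Metric_space.mdist_metric[OF Metric_space_F])

lemma ultralimit_T: "ultralimit U X lam p T conv"
  unfolding ultralimit_def
proof (intro conjI allI impI ballI)
  show "\<exists>x. conv x u" if "u \<in> mspace T" for u using that by (simp add: F_def)
  show "range x \<subseteq> mspace X" "u \<in> mspace T" if "conv x u" for x u using that by (auto simp: conv_def F_def)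
  show "((\<lambda>j. D j (x j) (y j)) \<longlongrightarrow> mdist T u v) U" if "conv x u \<and> conv y v" for x u y v
  proof -
    have "u \<in> F" "v \<in> F" using that by (auto simp: F_def)
    then show ?thesis using dh that by (simp add: mdist_T)
  qed
  show "\<exists>u. conv x u" if "range x \<subseteq> mspace X \<and> eventually (\<lambda>j. D j (x j) (p j) \<le> B) U" for x B
    using that bounded_conv[of x B] by metis
  show "conv y u" if "conv x u \<and> range y \<subseteq> mspace X \<and> ((\<lambda>j. D j (x j) (y j)) \<longlongrightarrow> 0) U" for x y u
    using that close_conv[of x u y] by metis
qed

end

section \<open>Ultralimits are weak tangents\<close>

context blowup begin

text \<open>Otherwise bad points exist for \<open>U\<close>-almost all \<open>j\<close>, and their limit is a point of \<open>F\<close> to which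
  they are close.\<close>

lemma F_approx:
  assumes "0 < \<delta>"
  shows "eventually (\<lambda>j. \<forall>x\<in>mspace X. nrm (E j x) (\<lambda>_. 0) \<le> K \<longrightarrow> (\<exists>u\<in>F. nrm (E j x) u < \<delta>)) U"
proof (rule ccontr)
  let ?bad = "\<lambda>j x. x \<in> mspace X \<and> nrm (E j x) (\<lambda>_. 0) \<le> K \<and> (\<forall>u\<in>F. \<delta> \<le> nrm (E j x) u)"
  assume "\<not> ?thesis"
  from U_dich[OF this] have ev: "eventually (\<lambda>j. \<exists>x. ?bad j x) U"
    by (rule eventually_mono) (auto simp: not_less)
  define x where "x j = (if \<exists>x. ?bad j x then SOME x. ?bad j x else p j)" for j
  have x: "eventually (\<lambda>j. ?bad j (x j)) U"
    using ev
  proof (rule eventually_mono)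
    fix j assume ex: "\<exists>x. ?bad j x"
    then have "x j = (SOME x. ?bad j x)" by (simp add: x_def)
    with someI_ex[OF ex] show "?bad j (x j)" by simp
  qed
  have "x j \<in> mspace X" for j
  proof (cases "\<exists>x. ?bad j x")
    case True
    then have "x j = (SOME x. ?bad j x)" by (simp add: x_def)
    with someI_ex[OF True] show ?thesis by simp
  next
    case False
    then have "x j = p j" unfolding x_def by (rule if_not_P)
    then show ?thesis using p by simp
  qed
  then have rx: "range x \<subseteq> mspace X" by auto
  have "eventually (\<lambda>j. nrm (E j (x j)) (\<lambda>_. 0) \<le> K) U" using x by (rule eventually_mono) simp
  then obtain u where u: "conv x u" by (rule nrm_bounded_conv[OF rx])
  then have "u \<in> F" by (auto simp: F_def)
  have "eventually (\<lambda>j. nrm (E j (x j)) u < \<delta>) U"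
    using conv_nrm[OF u] assms by (rule order_tendstoD)
  with x have "eventually (\<lambda>j. False) U"
    by eventually_elim (use \<open>u \<in> F\<close> in force)
  then show False using U_bot by (simp add: trivial_limit_def)
qed

text \<open>For each single pair of points this is the definition of \<open>F\<close> and \<open>dh\<close>. A finite net of the
  bounded part of \<open>F\<close> and the Hoelder continuity of \<open>dh\<close> make it uniform.\<close>

lemma dh_approx:
  assumes "0 < \<delta>"
  shows "eventually (\<lambda>j. \<forall>u\<in>F. \<forall>v\<in>F. nrm u (\<lambda>_. 0) \<le> K \<and> nrm v (\<lambda>_. 0) \<le> K \<longrightarrow>
    (\<exists>x\<in>mspace X. \<exists>y\<in>mspace X. nrm (E j x) u < \<delta> \<and> nrm (E j y) v < \<delta> \<and> \<bar>D j x y - dh u v\<bar> < \<delta>)) U"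
proof -
  define \<eta> where "\<eta> = min (\<delta> / 2) (min 1 (\<delta> / (4 * L\<^sup>2)))"
  have L2: "0 < L\<^sup>2" using L by simp
  have \<eta>: "0 < \<eta>" "2 * \<eta> \<le> \<delta>" "\<eta> \<le> 1" "\<eta> \<le> \<delta> / (4 * L\<^sup>2)" using assms L2 by (auto simp: \<eta>_def)
  have "L\<^sup>2 * \<eta>\<^sup>2 \<le> L\<^sup>2 * \<eta>"
    using \<eta>(1,3) L2 by (intro mult_left_mono) (auto simp: power2_eq_square mult_le_cancel_left1)
  also have "\<dots> \<le> \<delta> / 4" using \<eta>(4) L2 by (simp add: field_simps)
  finally have \<eta>2: "(L * \<eta>)\<^sup>2 \<le> \<delta> / 4" by (simp add: power_mult_distrib)
  define A where "A = {u \<in> F. nrm u (\<lambda>_. 0) \<le> K}"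
  have AB: "\<bar>u i\<bar> \<le> K" if "u \<in> A" "i < N" for u i
    using coord_le_nrm[OF that(2), of u "\<lambda>_. 0"] that(1) by (simp add: A_def)
  obtain S where S: "finite S" "S \<subseteq> A" "\<And>u. u \<in> A \<Longrightarrow> \<exists>w\<in>S. nrm u w < \<eta>"
    using Euclidean_finite_net[of A N K \<eta>] AB \<eta>(1) by blast
  have "\<forall>w\<in>S. \<exists>x. conv x w" using S(2) by (auto simp: A_def F_def)
  then obtain x where x: "\<And>w. w \<in> S \<Longrightarrow> conv (x w) w" by metis
  have "eventually (\<lambda>j. \<forall>w\<in>S. nrm (E j (x w j)) w < \<eta>) U"
    by (intro eventually_ball_finite S(1) ballI order_tendstoD(2)[OF conv_nrm[OF x] \<eta>(1)])
  moreover have "eventually (\<lambda>j. \<forall>w\<in>S. \<forall>z\<in>S. \<bar>D j (x w j) (x z j) - dh w z\<bar> < \<eta>) U"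
  proof (intro eventually_ball_finite S(1) ballI)
    fix w z assume "w \<in> S" "z \<in> S"
    then have "((\<lambda>j. D j (x w j) (x z j)) \<longlongrightarrow> dh w z) U" by (intro dh x)
    then show "eventually (\<lambda>j. \<bar>D j (x w j) (x z j) - dh w z\<bar> < \<eta>) U"
      using \<eta>(1) by (auto simp: tendsto_iff dist_real_def)
  qed
  ultimately show ?thesis
  proof eventually_elim
    case (elim j)
    show ?case
    proof (intro ballI impI)
      fix u v assume uv: "u \<in> F" "v \<in> F" "nrm u (\<lambda>_. 0) \<le> K \<and> nrm v (\<lambda>_. 0) \<le> K"
      obtain w z where w: "w \<in> S" "nrm u w < \<eta>" and z: "z \<in> S" "nrm v z < \<eta>"
        using S(3)[of u] S(3)[of v] uv by (auto simp: A_def)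
      have wz: "w \<in> F" "z \<in> F" using w(1) z(1) S(2) by (auto simp: A_def)
      have "nrm (E j (x w j)) w < \<eta>" "nrm (E j (x z j)) z < \<eta>" using elim(1) w(1) z(1) by blast+
      then have "nrm (E j (x w j)) u < \<delta>" "nrm (E j (x z j)) v < \<delta>"
        using w(2) z(2) nrm_triangle[of "E j (x w j)" u w] nrm_triangle[of "E j (x z j)" v z]
          nrm_commute[of w u] nrm_commute[of z v] \<eta>(2) by linarith+
      moreover have "\<bar>D j (x w j) (x z j) - dh u v\<bar> < \<delta>"
      proof -
        have small: "dh a b \<le> \<delta> / 4" if "a \<in> F" "b \<in> F" "nrm a b < \<eta>" for a b
        proof -
          have "(L * nrm a b)\<^sup>2 \<le> (L * \<eta>)\<^sup>2"
            using that(3) L L2_set_nonneg by (intro power_mono mult_left_mono) auto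
          then show ?thesis using dh_le[OF that(1,2)] \<eta>2 by linarith
        qed
        have "dh u v \<le> dh u w + dh w z + dh v z" "dh w z \<le> dh u w + dh u v + dh v z"
          using dh_triangle[OF uv(1) wz(1) uv(2)] dh_triangle[OF wz uv(2)] dh_triangle[OF wz(1) uv(1) wz(2)]
            dh_triangle[OF uv(1,2) wz(2)] dh_commute[OF uv(2) wz(2)] dh_commute[OF uv(1) wz(1)]
          by linarith+
        moreover have "\<bar>D j (x w j) (x z j) - dh w z\<bar> < \<eta>" using elim(2) w(1) z(1) by blast
        ultimately show ?thesis
          using small[OF uv(1) wz(1) w(2)] small[OF uv(2) wz(2) z(2)] \<eta>(2) unfolding abs_less_iff by linarith
      qed
      ultimately show "\<exists>x\<in>mspace X. \<exists>y\<in>mspace X. nrm (E j x) u < \<delta> \<and> nrm (E j y) v < \<delta> \<and> \<bar>D j x y - dh u v\<bar> < \<delta>"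
        using conv_mem[OF x[OF w(1)]] conv_mem[OF x[OF z(1)]] by blast
    qed
  qed
qed

text \<open>A point \<open>u\<close> of the closure has distance tending to \<open>0\<close>, along \<open>U\<close>, from the embedded spaces, so
  almost nearest points of these spaces converge to \<open>u\<close>.\<close>

lemma F_closed:
  assumes \<sigma>: "\<And>n. \<sigma> n \<in> F" and u: "\<And>i. N \<le> i \<Longrightarrow> u i = 0" and lim: "(\<lambda>n. nrm (\<sigma> n) u) \<longlonglongrightarrow> 0"
  shows "u \<in> F"
proof -
  \<comment> \<open>The distance from \<open>u\<close> to the \<open>j\<close>-th embedded space.\<close>
  define h where "h j = Inf ((\<lambda>x. nrm (E j x) u) ` mspace X)" for j
  have bdd: "bdd_below ((\<lambda>x. nrm (E j x) u) ` mspace X)" for j by (rule bdd_belowI[of _ 0]) auto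
  have "\<exists>x\<in>mspace X. nrm (E j x) u < h j + 1 / real (Suc j)" for j
  proof -
    have ne: "(\<lambda>x. nrm (E j x) u) ` mspace X \<noteq> {}" using p by blast
    have "Inf ((\<lambda>x. nrm (E j x) u) ` mspace X) < h j + 1 / real (Suc j)" by (simp add: h_def)
    from cInf_lessD[OF ne this] show ?thesis by blast
  qed
  then obtain x where x: "\<And>j. x j \<in> mspace X" "\<And>j. nrm (E j (x j)) u < h j + 1 / real (Suc j)" by metis
  have h0: "0 \<le> h j" for j unfolding h_def using p by (intro cInf_greatest) auto
  have "(h \<longlongrightarrow> 0) U"
  proof (rule tendstoI)
    fix \<eta> :: real assume \<eta>: "0 < \<eta>"
    have "eventually (\<lambda>n. nrm (\<sigma> n) u < \<eta> / 2) sequentially" using order_tendstoD(2)[OF lim, of "\<eta> / 2"] \<eta> by simp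
    then obtain n where n: "nrm (\<sigma> n) u < \<eta> / 2" by (auto dest: eventually_happens)
    obtain y where y: "conv y (\<sigma> n)" using \<sigma>[of n] by (auto simp: F_def)
    have "eventually (\<lambda>j. nrm (E j (y j)) (\<sigma> n) < \<eta> / 2) U" using order_tendstoD(2)[OF conv_nrm[OF y], of "\<eta> / 2"] \<eta> by simp
    then show "eventually (\<lambda>j. dist (h j) 0 < \<eta>) U"
    proof (rule eventually_mono)
      fix j assume "nrm (E j (y j)) (\<sigma> n) < \<eta> / 2"
      then have "nrm (E j (y j)) u < \<eta>" using nrm_triangle[of "E j (y j)" u "\<sigma> n"] n by linarith
      moreover have "h j \<le> nrm (E j (y j)) u" unfolding h_def using conv_mem[OF y] bdd by (intro cInf_lower) auto
      ultimately show "dist (h j) 0 < \<eta>" using h0[of j] by simp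
    qed
  qed
  moreover have "((\<lambda>j. 1 / real (Suc j)) \<longlongrightarrow> 0) U"
    by (rule tendsto_mono[OF U_seq]) (rule LIMSEQ_Suc[OF lim_1_over_n])
  ultimately have "((\<lambda>j. h j + 1 / real (Suc j)) \<longlongrightarrow> 0 + 0) U" by (rule tendsto_add)
  then have lim: "((\<lambda>j. h j + 1 / real (Suc j)) \<longlongrightarrow> 0) U" by simp
  have "((\<lambda>j. nrm (E j (x j)) u) \<longlongrightarrow> 0) U"
    using x(2) by (intro Lim_null_comparison[OF _ lim] always_eventually) (auto intro: less_imp_le)
  then have "conv x u" using x(1) u by (intro nrm_zero_conv) auto
  then show ?thesis by (auto simp: F_def)
qed

lemma limitin_Euclidean:
  "limitin (mtopology_of (Euclidean_metric N)) \<sigma> u sequentially \<Longrightarrow> (\<lambda>n. nrm (\<sigma> n) u) \<longlonglongrightarrow> 0"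
proof -
  interpret Eu: Metric_space "mspace (Euclidean_metric N)" "mdist (Euclidean_metric N)"
    by (rule Metric_space_mspace_mdist)
  assume "limitin (mtopology_of (Euclidean_metric N)) \<sigma> u sequentially"
  then have "(\<lambda>n. mdist (Euclidean_metric N) (\<sigma> n) u) \<longlonglongrightarrow> 0"
    unfolding mtopology_of_def Eu.limitin_metric_dist_null by blast
  then show ?thesis by simp
qed

lemma closedin_EuclideanI:
  assumes "\<And>u i. u \<in> A \<Longrightarrow> N \<le> i \<Longrightarrow> u i = 0"
    and "\<And>\<sigma> u. (\<And>n. \<sigma> n \<in> A) \<Longrightarrow> (\<And>i. N \<le> i \<Longrightarrow> u i = 0) \<Longrightarrow> (\<lambda>n. nrm (\<sigma> n) u) \<longlonglongrightarrow> 0 \<Longrightarrow> u \<in> A"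
  shows "closedin (mtopology_of (Euclidean_metric N)) A"
proof -
  interpret Eu: Metric_space "mspace (Euclidean_metric N)" "mdist (Euclidean_metric N)"
    by (rule Metric_space_mspace_mdist)
  show ?thesis
    unfolding mtopology_of_def Eu.metric_closedin_iff_sequentially_closed
  proof (intro conjI allI impI)
    show "A \<subseteq> mspace (Euclidean_metric N)" using assms(1) by auto
    fix \<sigma> :: "nat \<Rightarrow> nat \<Rightarrow> real" and u
    assume "range \<sigma> \<subseteq> A \<and> limitin Eu.mtopology \<sigma> u sequentially"
    then have \<sigma>: "range \<sigma> \<subseteq> A" and lim: "limitin Eu.mtopology \<sigma> u sequentially" by auto
    show "u \<in> A"
    proof (rule assms(2)[of \<sigma>])
      show "\<sigma> n \<in> A" for n using \<sigma> by auto
      show "u i = 0" if "N \<le> i" for i using Eu.limitin_mspace[OF lim] that by simp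
      show "(\<lambda>n. nrm (\<sigma> n) u) \<longlonglongrightarrow> 0" using lim by (intro limitin_Euclidean) (simp add: mtopology_of_def)
    qed
  qed
qed

text \<open>By the lower bound of the embedding, a sequence whose image converges is Cauchy, and so it has a
  limit in the complete space \<open>X\<close>.\<close>

lemma E_image_closed: "closedin (mtopology_of (Euclidean_metric N)) (E j ` mspace X)"
proof (rule closedin_EuclideanI)
  interpret X: Metric_space "mspace X" "mdist X" by simp
  fix \<sigma> u assume \<sigma>: "\<And>n. \<sigma> n \<in> E j ` mspace X" and u: "\<And>i. N \<le> i \<Longrightarrow> u i = 0"
    and lim: "(\<lambda>n. nrm (\<sigma> n) u) \<longlonglongrightarrow> 0"
  have "\<forall>n. \<exists>x\<in>mspace X. \<sigma> n = E j x" using \<sigma> by blast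
  then obtain x where x: "\<And>n. x n \<in> mspace X" "\<And>n. \<sigma> n = E j (x n)" by metis
  have "X.MCauchy x"
    unfolding X.MCauchy_def
  proof (intro conjI allI impI)
    show "range x \<subseteq> mspace X" using x by auto
    fix \<eta> :: real assume \<eta>: "0 < \<eta>"
    define \<delta> where "\<delta> = sqrt (lam j * \<eta>) / (4 * L)"
    have \<delta>: "0 < \<delta>" using \<eta> lam[of j] L by (simp add: \<delta>_def)
    obtain n0 where n0: "\<And>n. n0 \<le> n \<Longrightarrow> nrm (\<sigma> n) u < \<delta>"
      using order_tendstoD(2)[OF lim \<delta>] by (auto simp: eventually_sequentially)
    show "\<exists>n0. \<forall>n n'. n0 \<le> n \<longrightarrow> n0 \<le> n' \<longrightarrow> mdist X (x n) (x n') < \<eta>"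
    proof (intro exI[of _ n0] allI impI)
      fix n n' assume n: "n0 \<le> n" "n0 \<le> n'"
      have "nrm (\<sigma> n) (\<sigma> n') \<le> 2 * \<delta>"
        using nrm_triangle[of "\<sigma> n" "\<sigma> n'" u] n0[OF n(1)] n0[OF n(2)] nrm_commute[of u "\<sigma> n'"] by linarith
      then have "(L * nrm (\<sigma> n) (\<sigma> n'))\<^sup>2 \<le> (L * (2 * \<delta>))\<^sup>2"
        using L by (intro power_mono mult_left_mono mult_nonneg_nonneg) auto
      moreover have "L * (2 * \<delta>) = sqrt (lam j * \<eta>) / 2" using L by (simp add: \<delta>_def)
      then have "(L * (2 * \<delta>))\<^sup>2 = lam j * \<eta> / 4"
        using lam[of j] \<eta> by (simp only: power_divide) simp
      ultimately have "D j (x n) (x n') \<le> lam j * \<eta> / 4"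
        using D_le[OF x(1)[of n] x(1)[of n'], of j] by (simp add: x(2))
      then have "lam j * mdist X (x n) (x n') < lam j * \<eta>"
        using mult_pos_pos[OF lam[of j] \<eta>] by linarith
      then show "mdist X (x n) (x n') < \<eta>" using lam[of j] by simp
    qed
  qed
  then obtain z where z: "limitin X.mtopology x z sequentially"
    using complete unfolding mcomplete_of_def X.mcomplete_def by blast
  then have zX: "z \<in> mspace X" and zlim: "(\<lambda>n. mdist X (x n) z) \<longlonglongrightarrow> 0"
    unfolding X.limitin_metric_dist_null by auto
  have "(\<lambda>n. L * sqrt (D j (x n) z) + nrm (\<sigma> n) u) \<longlonglongrightarrow> L * sqrt (lam j * 0) + 0"
    by (intro tendsto_intros zlim lim)
  then have l0: "(\<lambda>n. L * sqrt (D j (x n) z) + nrm (\<sigma> n) u) \<longlonglongrightarrow> 0" by simp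
  have "nrm (E j z) u \<le> L * sqrt (D j (x n) z) + nrm (\<sigma> n) u" for n
    using nrm_triangle[of "E j z" u "\<sigma> n"] E_bilipschitz(2)[OF x(1)[of n] zX, of j]
      nrm_commute[of "E j z" "\<sigma> n"] by (simp add: x(2))
  then have "nrm (E j z) u \<le> 0" by (intro LIMSEQ_le_const[OF l0]) auto
  then have "E j z i = u i" for i
    using coord_le_nrm[of i "E j z" u] u[of i] by (cases "i < N") (auto simp: E_ge)
  then have "E j z = u" by blast
  then show "u \<in> E j ` mspace X" using zX by blast
qed (auto simp: E_ge)

text \<open>For each accuracy \<open>1 / (k + 1)\<close> the approximation properties hold for \<open>U\<close>-almost all \<open>j\<close>, hence
  for some index \<open>J k\<close>. The spaces with the indices \<open>J k\<close> then converge to \<open>T\<close> in the ordinary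
  sense. Their order is immaterial, as any sequence of factors and base points is admitted in a
  weak tangent.\<close>

lemma weak_tangent_T: "weak_tangent X T (\<lambda>_. 0)"
proof -
  \<comment> \<open>At accuracy \<open>1 / (k + 1)\<close> and in the ball of radius \<open>k\<close>, both the set \<open>F\<close> and its distance function
    are approximated.\<close>
  define good where "good k j \<longleftrightarrow>
    (\<forall>x\<in>mspace X. nrm (E j x) (\<lambda>_. 0) \<le> real k \<longrightarrow> (\<exists>u\<in>F. nrm (E j x) u < 1 / real (Suc k))) \<and>
    (\<forall>u\<in>F. \<forall>v\<in>F. nrm u (\<lambda>_. 0) \<le> real k \<and> nrm v (\<lambda>_. 0) \<le> real k \<longrightarrow>
      (\<exists>x\<in>mspace X. \<exists>y\<in>mspace X. nrm (E j x) u < 1 / real (Suc k) \<and> nrm (E j y) v < 1 / real (Suc k) \<and>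
        \<bar>D j x y - dh u v\<bar> < 1 / real (Suc k)))" for k j
  have "\<exists>j. good k j" for k
  proof -
    have "eventually (good k) U"
      unfolding good_def by (intro eventually_conj F_approx dh_approx) auto
    then show ?thesis using U_bot by (auto dest: eventually_happens')
  qed
  then obtain J where J: "\<And>k. good k (J k)" by metis
  define Xk where "Xk k = scaled_metric (lam (J k)) X" for k
  define ek where "ek k = E (J k)" for k
  have Xk [simp]: "mspace (Xk k) = mspace X" "mdist (Xk k) x y = D (J k) x y" for k x y
    using lam by (simp_all add: Xk_def)
  let ?Eu = "Euclidean_metric N"
  have inj: "inj_on (ek k) (mspace X)" for k
  proof (rule inj_onI)
    fix x y assume xy: "x \<in> mspace X" "y \<in> mspace X" "ek k x = ek k y"
    then have "D (J k) x y \<le> 0" using D_le[OF xy(1,2), of "J k"] by (simp add: ek_def L2_set_def)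
    then have "mdist X x y \<le> 0" using lam[of "J k"] by (simp add: mult_le_0_iff)
    then show "x = y" using xy mdist_nonneg[of X x y] by (metis antisym mdist_zero)
  qed
  have tr: "transported_dist (Xk k) (ek k) (ek k x, ek k y) = D (J k) x y"
    if "x \<in> mspace X" "y \<in> mspace X" for k x y
    using that inj[of k] by (simp add: transported_dist_def)
  have inv_id: "inv_into F (\<lambda>u. u) u = u" if "u \<in> F" for u
    using that by (intro inv_into_f_eq) auto
  have trT: "transported_dist T (\<lambda>u. u) (u, v) = dh u v" if "u \<in> F" "v \<in> F" for u v
    using that by (simp add: transported_dist_def mdist_T inv_id)
  have zF: "(\<lambda>_. 0) \<in> F" using conv_p by (auto simp: F_def)
  have emb: "bilipschitz_embedding L (snowflake_metric (1 / 2) (Xk k)) ?Eu (ek k)" for k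
    using E_bilipschitz by (auto simp: bilipschitz_embedding_def ek_def E_ge powr_half_sqrt D_nonneg)
  have embT: "bilipschitz_embedding L (snowflake_metric (1 / 2) T) ?Eu (\<lambda>u. u)"
    using dh_bilipschitz F_ge by (auto simp: bilipschitz_embedding_def mdist_T powr_half_sqrt)
  have to0: "(\<lambda>k. ennreal (1 / real (Suc k))) \<longlonglongrightarrow> 0"
    using tendsto_ennrealI[OF LIMSEQ_Suc[OF lim_1_over_n]] by simp
  have dts: "dist_to_set ?Eu x A \<le> ennreal r" if "y \<in> A" "nrm x y \<le> r" for x y A r
    unfolding dist_to_set_def using that by (intro INF_lower2[OF that(1)]) (simp add: ennreal_leI)
  have sets: "sets_converge N (\<lambda>k. ek k ` mspace (Xk k)) (F)"
    unfolding sets_converge_def Let_def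
  proof (intro conjI allI impI)
    show "ek k ` mspace (Xk k) \<noteq> {}" for k using p by auto
    show "closedin (mtopology_of ?Eu) (ek k ` mspace (Xk k))" for k
      unfolding ek_def Xk by (rule E_image_closed)
    show "F \<noteq> {}" using zF by blast
    show "closedin (mtopology_of ?Eu) F" by (rule closedin_EuclideanI) (auto simp: F_ge intro: F_closed)
    fix R :: real
    have "eventually (\<lambda>k. (SUP x\<in>ek k ` mspace (Xk k) \<inter> mball_of ?Eu (\<lambda>_. 0) R. dist_to_set ?Eu x F)
        \<le> ennreal (1 / real (Suc k))) sequentially"
      using eventually_ge_at_top[of "nat \<lceil>R\<rceil>"]
    proof (rule eventually_mono)
      fix k assume "nat \<lceil>R\<rceil> \<le> k"
      then have k: "R \<le> real k" by linarith
      show "(SUP x\<in>ek k ` mspace (Xk k) \<inter> mball_of ?Eu (\<lambda>_. 0) R. dist_to_set ?Eu x F) \<le> ennreal (1 / real (Suc k))"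
      proof (rule SUP_least)
        fix z assume "z \<in> ek k ` mspace (Xk k) \<inter> mball_of ?Eu (\<lambda>_. 0) R"
        then obtain x where x: "x \<in> mspace X" "z = E (J k) x" "nrm (\<lambda>_. 0) z < R" by (auto simp: ek_def)
        then have "nrm (E (J k) x) (\<lambda>_. 0) \<le> real k" using k nrm_commute[of z "\<lambda>_. 0"] by simp
        then obtain u where "u \<in> F" "nrm z u < 1 / real (Suc k)"
          using J[of k] x unfolding good_def by blast
        then show "dist_to_set ?Eu z F \<le> ennreal (1 / real (Suc k))" by (intro dts[of u]) auto
      qed
    qed
    then show "(\<lambda>k. SUP x\<in>ek k ` mspace (Xk k) \<inter> mball_of ?Eu (\<lambda>_. 0) R. dist_to_set ?Eu x F) \<longlonglongrightarrow> 0"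
      by (intro tendsto_sandwich[OF _ _ tendsto_const to0]) auto
    have "eventually (\<lambda>k. (SUP u\<in>F \<inter> mball_of ?Eu (\<lambda>_. 0) R. dist_to_set ?Eu u (ek k ` mspace (Xk k)))
        \<le> ennreal (1 / real (Suc k))) sequentially"
      using eventually_ge_at_top[of "nat \<lceil>R\<rceil>"]
    proof (rule eventually_mono)
      fix k assume "nat \<lceil>R\<rceil> \<le> k"
      then have k: "R \<le> real k" by linarith
      show "(SUP u\<in>F \<inter> mball_of ?Eu (\<lambda>_. 0) R. dist_to_set ?Eu u (ek k ` mspace (Xk k))) \<le> ennreal (1 / real (Suc k))"
      proof (rule SUP_least)
        fix u assume "u \<in> F \<inter> mball_of ?Eu (\<lambda>_. 0) R"
        then have u: "u \<in> F" "nrm (\<lambda>_. 0) u < R" by auto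
        then have "nrm u (\<lambda>_. 0) \<le> real k" using k nrm_commute[of u "\<lambda>_. 0"] by simp
        then obtain x where "x \<in> mspace X" "nrm (E (J k) x) u < 1 / real (Suc k)"
          using J[of k] u unfolding good_def by blast
        then show "dist_to_set ?Eu u (ek k ` mspace (Xk k)) \<le> ennreal (1 / real (Suc k))"
          by (intro dts[of "ek k x"]) (auto simp: ek_def nrm_commute[of u])
      qed
    qed
    then show "(\<lambda>k. SUP u\<in>F \<inter> mball_of ?Eu (\<lambda>_. 0) R. dist_to_set ?Eu u (ek k ` mspace (Xk k))) \<longlonglongrightarrow> 0"
      by (intro tendsto_sandwich[OF _ _ tendsto_const to0]) auto
  qed
  have maps: "maps_converge (prod_metric ?Eu ?Eu) (euclidean_metric :: real metric)
      (\<lambda>k. ek k ` mspace (Xk k) \<times> ek k ` mspace (Xk k)) (\<lambda>k. transported_dist (Xk k) (ek k))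
      (F \<times> F) (transported_dist T (\<lambda>u. u))"
    unfolding maps_converge_def
  proof (intro allI impI, elim conjE)
    fix z z' assume z: "\<forall>k. z k \<in> ek k ` mspace (Xk k) \<times> ek k ` mspace (Xk k)" and z': "z' \<in> F \<times> F"
      and lim: "limitin (mtopology_of (prod_metric ?Eu ?Eu)) z z' sequentially"
    obtain u v where uv: "z' = (u, v)" "u \<in> F" "v \<in> F" using z' by auto
    have "\<forall>k. \<exists>x\<in>mspace X. \<exists>y\<in>mspace X. z k = (ek k x, ek k y)" using z by fastforce
    then obtain x y where xy: "\<And>k. x k \<in> mspace X" "\<And>k. y k \<in> mspace X" "\<And>k. z k = (ek k (x k), ek k (y k))"
      by metis
    interpret M: Metric_space12 "mspace ?Eu" "mdist ?Eu" "mspace ?Eu" "mdist ?Eu"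
      by (rule Metric_space12_mspace_mdist)
    have "mtopology_of (prod_metric ?Eu ?Eu) = prod_topology (mtopology_of ?Eu) (mtopology_of ?Eu)"
      using M.mtopology_prod_metric by (simp add: prod_metric_def mtopology_of_def del: mspace_Euclidean_metric mdist_Euclidean_metric)
    then have "limitin (mtopology_of ?Eu) (\<lambda>k. ek k (x k)) u sequentially"
      "limitin (mtopology_of ?Eu) (\<lambda>k. ek k (y k)) v sequentially"
      using lim uv xy(3) by (simp_all add: limitin_pairwise o_def)
    then have lims: "(\<lambda>k. nrm (E (J k) (x k)) u) \<longlonglongrightarrow> 0" "(\<lambda>k. nrm (E (J k) (y k)) v) \<longlonglongrightarrow> 0"
      by (auto dest: limitin_Euclidean simp: ek_def)
    define bd where "bd k = (L * (nrm (E (J k) (x k)) u + 1 / real (Suc k)))\<^sup>2 +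
        (L * (nrm (E (J k) (y k)) v + 1 / real (Suc k)))\<^sup>2 + 1 / real (Suc k)" for k
    have "bd \<longlonglongrightarrow> (L * (0 + 0))\<^sup>2 + (L * (0 + 0))\<^sup>2 + 0"
      unfolding bd_def by (intro tendsto_intros lims LIMSEQ_Suc[OF lim_1_over_n])
    then have bd: "bd \<longlonglongrightarrow> 0" by simp
    have "eventually (\<lambda>k. norm (D (J k) (x k) (y k) - dh u v) \<le> bd k) sequentially"
      using eventually_ge_at_top[of "nat \<lceil>max (nrm u (\<lambda>_. 0)) (nrm v (\<lambda>_. 0))\<rceil>"]
    proof (rule eventually_mono)
      fix k assume "nat \<lceil>max (nrm u (\<lambda>_. 0)) (nrm v (\<lambda>_. 0))\<rceil> \<le> k"
      then have "nrm u (\<lambda>_. 0) \<le> real k \<and> nrm v (\<lambda>_. 0) \<le> real k" by linarith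
      then obtain x' y' where x': "x' \<in> mspace X" "y' \<in> mspace X" "nrm (E (J k) x') u < 1 / real (Suc k)"
          "nrm (E (J k) y') v < 1 / real (Suc k)" "\<bar>D (J k) x' y' - dh u v\<bar> < 1 / real (Suc k)"
        using J[of k] uv unfolding good_def by blast
      have close: "D (J k) a b \<le> (L * (nrm (E (J k) a) w + 1 / real (Suc k)))\<^sup>2"
        if "a \<in> mspace X" "b \<in> mspace X" "nrm (E (J k) b) w < 1 / real (Suc k)" for a b w
      proof -
        have "nrm (E (J k) a) (E (J k) b) \<le> nrm (E (J k) a) w + 1 / real (Suc k)"
          using nrm_triangle[of "E (J k) a" "E (J k) b" w] that(3) nrm_commute[of w "E (J k) b"] by linarith
        then have "(L * nrm (E (J k) a) (E (J k) b))\<^sup>2 \<le> (L * (nrm (E (J k) a) w + 1 / real (Suc k)))\<^sup>2"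
          using L by (intro power_mono mult_left_mono mult_nonneg_nonneg) auto
        then show ?thesis using D_le[OF that(1,2), of "J k"] by linarith
      qed
      have "D (J k) (x k) (y k) \<le> D (J k) (x k) x' + D (J k) x' y' + D (J k) (y k) y'"
        "D (J k) x' y' \<le> D (J k) (x k) x' + D (J k) (x k) (y k) + D (J k) (y k) y'"
        using D_triangle[of "x k" x' "y k" "J k"] D_triangle[of x' y' "y k" "J k"]
          D_triangle[of x' "x k" y' "J k"] D_triangle[of "x k" "y k" y' "J k"] xy x'
        by (simp_all add: mdist_commute)
      then show "norm (D (J k) (x k) (y k) - dh u v) \<le> bd k"
        using close[OF xy(1)[of k] x'(1,3)] close[OF xy(2)[of k] x'(2,4)] x'(5) unfolding bd_def real_norm_def
        by linarith
    qed
    from Lim_null_comparison[OF this bd] have "(\<lambda>k. D (J k) (x k) (y k)) \<longlonglongrightarrow> dh u v" by (simp add: LIM_zero_iff)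
    then show "limitin (mtopology_of euclidean_metric) (\<lambda>k. transported_dist (Xk k) (ek k) (z k))
        (transported_dist T (\<lambda>u. u) z') sequentially"
      using uv xy by (simp add: tr trT)
  qed
  have "pointed_spaces_converge Xk (\<lambda>k. p (J k)) T (\<lambda>_. 0)"
    unfolding pointed_spaces_converge_def
  proof (intro conjI)
    show "\<forall>j. p (J j) \<in> mspace (Xk j)" using p by simp
    show "(\<lambda>_. 0) \<in> mspace T" using zF by simp
  qed (rule exI[of _ "1 / 2"], rule exI[of _ N], rule exI[of _ L], rule exI[of _ ek], rule exI[of _ "\<lambda>u. u"],
      use L emb embT sets maps in \<open>simp add: ek_def E_p fun_eq_iff\<close>)
  then show ?thesis
    unfolding weak_tangent_def Xk_def using lam p by (intro exI[of _ "\<lambda>k. lam (J k)"] exI[of _ "\<lambda>k. p (J k)"]) auto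
qed

end

section \<open>Lipschitz light maps and their limits\<close>

text \<open>Lipschitz lightness with its constant made visible and with components replaced by the paths that
  form them. Paths are finite objects, which is what makes limits accessible. By \<open>1 \<le> C\<close> a path of mesh \<open>r\<close> also has
  mesh \<open>C * r\<close>.\<close>

definition path_light :: "real \<Rightarrow> 'a metric \<Rightarrow> 'b metric \<Rightarrow> ('a \<Rightarrow> 'b) \<Rightarrow> bool" where
  "path_light C X Y f \<longleftrightarrow> f \<in> mspace X \<rightarrow> mspace Y \<and> 1 \<le> C \<and>
     (\<forall>x\<in>mspace X. \<forall>y\<in>mspace X. mdist Y (f x) (f y) \<le> C * mdist X x y) \<and>
     (\<forall>r>0. \<forall>xs. is_rpath X r xs \<and> (\<forall>x\<in>set xs. \<forall>y\<in>set xs. mdist Y (f x) (f y) \<le> r) \<longrightarrow>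
        (\<forall>x\<in>set xs. \<forall>y\<in>set xs. mdist X x y \<le> C * r))"

lemma path_lightD:
  assumes "path_light C X Y f"
  shows "x \<in> mspace X \<Longrightarrow> f x \<in> mspace Y" "1 \<le> C"
    "x \<in> mspace X \<Longrightarrow> y \<in> mspace X \<Longrightarrow> mdist Y (f x) (f y) \<le> C * mdist X x y"
    "0 < r \<Longrightarrow> is_rpath X r xs \<Longrightarrow> (\<And>x y. x \<in> set xs \<Longrightarrow> y \<in> set xs \<Longrightarrow> mdist Y (f x) (f y) \<le> r) \<Longrightarrow>
      x \<in> set xs \<Longrightarrow> y \<in> set xs \<Longrightarrow> mdist X x y \<le> C * r"
  using assms unfolding path_light_def by blast+

text \<open>All points of an \<open>r\<close>-component are joined to one base point \<open>x\<close> by paths over \<open>W\<close>; the factor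
  \<open>2\<close> comes from passing through \<open>x\<close>.\<close>

lemma path_light_imp_lipschitz_light:
  assumes "path_light C X Y f"
  shows "lipschitz_light X Y f"
proof -
  note f = path_lightD[OF assms]
  have "ediam X K \<le> ennreal (2 * C * r)"
    if r: "0 < r" and W: "W \<subseteq> mspace Y" "ediam Y W \<le> ennreal r"
      and K: "K \<in> rcomponents (submetric X (f -` W)) r" for r W K
  proof -
    obtain x where x: "K = {y. same_rcomponent (submetric X (f -` W)) r x y}"
      using K by (auto simp: rcomponents_def)
    have Wr: "mdist Y u v \<le> r" if "u \<in> W" "v \<in> W" for u v
      using W(2) r that by (subst (asm) ediam_le_iff) auto
    have near: "mdist X x y \<le> C * r \<and> x \<in> mspace X \<and> y \<in> mspace X" if y: "y \<in> K" for y
    proof -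
      obtain xs where xs: "is_rpath (submetric X (f -` W)) r xs" "x \<in> set xs" "y \<in> set xs"
        using y unfolding x same_rcomponent_def by blast
      then have "is_rpath X r xs" "set xs \<subseteq> f -` W" by (auto simp: is_rpath_def)
      moreover have "set xs \<subseteq> mspace X" using xs(1) by (auto simp: is_rpath_def)
      ultimately show ?thesis using f(4)[OF r, of xs x y] Wr xs(2,3) by blast
    qed
    have "mdist X y z \<le> 2 * C * r" if "y \<in> K" "z \<in> K" for y z
      using near[OF that(1)] near[OF that(2)] mdist_triangle[of y X x z] mdist_commute[of X x y] by auto
    then show ?thesis using r f(2) by (subst ediam_le_iff) auto
  qed
  moreover have "mdist Y (f x) (f y) \<le> 2 * C * mdist X x y" if "x \<in> mspace X" "y \<in> mspace X" for x y
  proof -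
    have "C * mdist X x y \<le> 2 * C * mdist X x y" using f(2) by (intro mult_right_mono) auto
    with f(3)[OF that] show ?thesis by linarith
  qed
  ultimately show ?thesis
    unfolding lipschitz_light_def using f(1,2) by (intro conjI exI[of _ "2 * C"]) auto
qed

text \<open>A path lies in one component over the set \<open>W\<close> of the images of its own points.\<close>

lemma lipschitz_light_imp_path_light:
  assumes "lipschitz_light X Y f"
  obtains C where "path_light C X Y f"
proof -
  obtain C where C: "C > 0" "\<forall>x\<in>mspace X. \<forall>y\<in>mspace X. mdist Y (f x) (f y) \<le> C * mdist X x y"
    "\<forall>r>0. \<forall>W\<subseteq>mspace Y. ediam Y W \<le> ennreal r \<longrightarrow>
         (\<forall>K\<in>rcomponents (submetric X (f -` W)) r. ediam X K \<le> ennreal (C * r))"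
    and f: "f \<in> mspace X \<rightarrow> mspace Y"
    using assms unfolding lipschitz_light_def by blast
  have "mdist X x y \<le> max 1 C * r"
    if r: "0 < r" and xs: "is_rpath X r xs" "\<forall>x\<in>set xs. \<forall>y\<in>set xs. mdist Y (f x) (f y) \<le> r"
      and xy: "x \<in> set xs" "y \<in> set xs" for r xs x y
  proof -
    have X: "set xs \<subseteq> mspace X" using xs(1) by (simp add: is_rpath_def)
    let ?S = "submetric X (f -` (f ` set xs))"
    have "is_rpath ?S r xs" using xs(1) by (auto simp: is_rpath_def)
    then have same: "same_rcomponent ?S r x x" "same_rcomponent ?S r x y"
      using xy by (auto simp: same_rcomponent_def)
    have "{y. same_rcomponent ?S r x y} \<in> rcomponents ?S r"
      unfolding rcomponents_def using xy X by auto
    moreover have "ediam Y (f ` set xs) \<le> ennreal r" using xs(2) r by (subst ediam_le_iff) auto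
    moreover have "f ` set xs \<subseteq> mspace Y" using f X by auto
    ultimately have "ediam X {y. same_rcomponent ?S r x y} \<le> ennreal (C * r)" using C(3) r by blast
    then have "mdist X x y \<le> C * r" using same C(1) r by (subst (asm) ediam_le_iff) auto
    also have "\<dots> \<le> max 1 C * r" using r by (intro mult_right_mono) auto
    finally show ?thesis .
  qed
  moreover have "mdist Y (f x) (f y) \<le> max 1 C * mdist X x y" if "x \<in> mspace X" "y \<in> mspace X" for x y
  proof -
    have "C * mdist X x y \<le> max 1 C * mdist X x y" by (intro mult_right_mono) auto
    with C(2) that show ?thesis by fastforce
  qed
  ultimately have "path_light (max 1 C) X Y f"
    unfolding path_light_def using f by auto
  then show thesis by (rule that)
qed

lemma is_rpath_mono: "is_rpath X r xs \<Longrightarrow> r \<le> r' \<Longrightarrow> is_rpath X r' xs"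
  unfolding is_rpath_def by (meson order_trans)

text \<open>If the image of a path of mesh \<open>r\<close> under \<open>g \<circ> f\<close> is small, then its image under \<open>f\<close> is a path
  of mesh \<open>C * r\<close> over a small set, hence of diameter at most \<open>C' * (C * r)\<close>; now \<open>f\<close> is applied at
  that larger scale.\<close>

lemma path_light_compose:
  assumes f: "path_light C X Y f" and g: "path_light C' Y W g"
  shows "path_light (C * (C' * C)) X W (g \<circ> f)"
  unfolding path_light_def
proof (intro conjI ballI allI impI, goal_cases)
  note f = path_lightD[OF f] and g = path_lightD[OF g]
  have C: "1 \<le> C" "1 \<le> C'" "0 \<le> C" "0 \<le> C'" using f(2) g(2) by auto
  have CC: "1 \<le> C' * C" using mult_mono[of 1 C' 1 C] C by simp
  { case 1 then show ?case using f(1) g(1) by auto }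
  { case 2 then show ?case using mult_mono[of 1 C 1 "C' * C"] C CC by simp }
  { case (3 x y)
    have "mdist W ((g \<circ> f) x) ((g \<circ> f) y) \<le> C' * (C * mdist X x y)"
      using g(3)[of "f x" "f y"] f(1)[OF 3(1)] f(1)[OF 3(2)] mult_left_mono[OF f(3)[OF 3] C(4)] by simp
    also have "\<dots> \<le> C * (C' * (C * mdist X x y))"
      using mult_right_mono[OF C(1), of "C' * (C * mdist X x y)"] C by simp
    finally show ?case by (simp add: mult_ac) }
  { case (4 r xs x y)
    then have xs: "is_rpath X r xs" and close: "\<And>x y. x \<in> set xs \<Longrightarrow> y \<in> set xs \<Longrightarrow> mdist W (g (f x)) (g (f y)) \<le> r"
      by auto
    have X: "set xs \<subseteq> mspace X" using xs by (simp add: is_rpath_def)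
    have rC: "r \<le> C * r" using C 4(1) by simp
    have "is_rpath Y (C * r) (map f xs)"
      unfolding is_rpath_def
    proof (intro conjI allI impI)
      show "set (map f xs) \<subseteq> mspace Y" using X f(1) by auto
      fix i assume i: "Suc i < length (map f xs)"
      then have "xs ! i \<in> mspace X" "xs ! Suc i \<in> mspace X" using X by (auto simp: subset_iff)
      from f(3)[OF this] have "mdist Y (f (xs ! i)) (f (xs ! Suc i)) \<le> C * mdist X (xs ! i) (xs ! Suc i)" .
      also have "\<dots> \<le> C * r" using xs i C by (intro mult_left_mono) (auto simp: is_rpath_def)
      finally show "mdist Y (map f xs ! i) (map f xs ! Suc i) \<le> C * r" using i by simp
    qed
    moreover have "mdist W (g u) (g v) \<le> C * r" if "u \<in> set (map f xs)" "v \<in> set (map f xs)" for u v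
      using close that rC by fastforce
    ultimately have im: "mdist Y u v \<le> C' * (C * r)" if "u \<in> set (map f xs)" "v \<in> set (map f xs)" for u v
      using g(4)[of "C * r" "map f xs" u v] that C 4(1) by auto
    have "r \<le> (C' * C) * r" using CC 4(1) by simp
    then have "is_rpath X (C' * (C * r)) xs" using xs by (intro is_rpath_mono[OF xs]) (simp add: mult.assoc)
    then have "mdist X x y \<le> C * (C' * (C * r))"
      using f(4)[of "C' * (C * r)" xs x y] im 4 C by auto
    then show ?case by (simp add: mult_ac) }
qed

lemma lipschitz_dim_le:
  assumes "\<And>k f. lipschitz_light Y (Euclidean_metric k) f \<Longrightarrow> \<exists>h. lipschitz_light X (Euclidean_metric k) h"
  shows "lipschitz_dim X \<le> lipschitz_dim Y"
  unfolding lipschitz_dim_def by (rule INF_superset_mono) (use assms in auto)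

text \<open>Along a path of mesh \<open>r\<close> the distance to \<open>x\<close> takes, up to an error \<open>r\<close>, every value between \<open>0\<close>
  and the distance of \<open>x\<close> and \<open>y\<close>. The values \<open>3 * r\<close>, \<open>6 * r\<close>, and so on up to \<open>3 * r * (m + 1)\<close> give separated points.\<close>

lemma rpath_separated_points:
  assumes xs: "is_rpath X r xs" and r: "0 < r" and xy: "x \<in> set xs" "y \<in> set xs"
    and far: "3 * r * (real m + 1) \<le> mdist X x y"
  obtains v :: "nat \<Rightarrow> 'a" where "\<And>k. k \<le> m \<Longrightarrow> v k \<in> set xs"
    "\<And>k l. k \<le> m \<Longrightarrow> l \<le> m \<Longrightarrow> k \<noteq> l \<Longrightarrow> 2 * r \<le> mdist X (v k) (v l)"
proof -
  have X: "set xs \<subseteq> mspace X" and step: "\<And>i. Suc i < length xs \<Longrightarrow> mdist X (xs ! i) (xs ! Suc i) \<le> r"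
    using xs by (auto simp: is_rpath_def)
  have xyX: "x \<in> mspace X" "y \<in> mspace X" using X xy by auto
  have ivt: "\<exists>z\<in>set xs. c \<le> mdist X x z \<and> mdist X x z \<le> c + r" if c: "0 < c" "c \<le> mdist X x y" for c
  proof (rule ccontr)
    assume "\<not> ?thesis"
    then have gap: "\<And>z. z \<in> set xs \<Longrightarrow> mdist X x z < c \<or> c + r < mdist X x z" by force
    \<comment> \<open>Without a value in the window, no single step can cross it.\<close>
    have "mdist X x (xs ! i) < c \<longleftrightarrow> mdist X x (xs ! 0) < c" if "i < length xs" for i
      using that
    proof (induction i)
      case (Suc i)
      have m: "xs ! i \<in> mspace X" "xs ! Suc i \<in> mspace X" using Suc.prems X by (auto simp: subset_iff)
      have "mdist X x (xs ! i) < c \<longleftrightarrow> mdist X x (xs ! Suc i) < c"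
        using gap[of "xs ! i"] gap[of "xs ! Suc i"] step[OF Suc.prems] Suc.prems r
          mdist_triangle[OF xyX(1) m] mdist_triangle[OF xyX(1) m(2,1)] mdist_commute[of X "xs ! i" "xs ! Suc i"]
        by auto
      then show ?case using Suc by simp
    qed simp
    then have "mdist X x x < c \<longleftrightarrow> mdist X x y < c" using xy by (metis in_set_conv_nth)
    then show False using c xyX by simp
  qed
  have "\<exists>z. k \<le> m \<longrightarrow> z \<in> set xs \<and> 3 * r * (real k + 1) \<le> mdist X x z \<and> mdist X x z \<le> 3 * r * (real k + 1) + r" for k
  proof (cases "k \<le> m")
    case True
    then have "3 * r * (real k + 1) \<le> 3 * r * (real m + 1)" using r by (intro mult_left_mono) auto
    moreover have "0 < 3 * r * (real k + 1)" using r by (intro mult_pos_pos) auto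
    ultimately show ?thesis using ivt[of "3 * r * (real k + 1)"] far by auto
  qed simp
  then obtain v where v: "\<And>k. k \<le> m \<Longrightarrow> v k \<in> set xs"
    "\<And>k. k \<le> m \<Longrightarrow> 3 * r * (real k + 1) \<le> mdist X x (v k)"
    "\<And>k. k \<le> m \<Longrightarrow> mdist X x (v k) \<le> 3 * r * (real k + 1) + r" by metis
  have sep: "2 * r \<le> mdist X (v k) (v l)" if "k < l" "l \<le> m" for k l
  proof -
    have "3 * r * (real k + 2) \<le> 3 * r * (real l + 1)" using r that(1) by (intro mult_left_mono) auto
    then have "3 * r * (real k + 1) + 3 * r \<le> 3 * r * (real l + 1)" by (simp add: algebra_simps)
    moreover have "mdist X x (v l) \<le> mdist X x (v k) + mdist X (v k) (v l)"
      using X xyX v(1)[of k] v(1)[of l] that by (intro mdist_triangle) auto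
    ultimately show ?thesis using v(2)[of l] v(3)[of k] that by linarith
  qed
  show thesis
  proof (rule that[OF v(1)])
    fix k l assume "k \<le> m" "l \<le> m" "k \<noteq> l"
    then show "2 * r \<le> mdist X (v k) (v l)"
      using sep[of k l] sep[of l k] by (cases k l rule: linorder_cases) (auto simp: mdist_commute)
  qed
qed

lemma ultralimitD:
  assumes "ultralimit U X lam p T conv"
  shows "conv x u \<Longrightarrow> x j \<in> mspace X" "conv x u \<Longrightarrow> u \<in> mspace T"
    "u \<in> mspace T \<Longrightarrow> \<exists>x. conv x u"
    "conv x u \<Longrightarrow> conv y v \<Longrightarrow> ((\<lambda>j. lam j * mdist X (x j) (y j)) \<longlongrightarrow> mdist T u v) U"
    "(\<And>j. x j \<in> mspace X) \<Longrightarrow> eventually (\<lambda>j. lam j * mdist X (x j) (p j) \<le> B) U \<Longrightarrow> \<exists>u. conv x u"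
    "conv x u \<Longrightarrow> (\<And>j. y j \<in> mspace X) \<Longrightarrow> ((\<lambda>j. lam j * mdist X (x j) (y j)) \<longlongrightarrow> 0) U \<Longrightarrow> conv y u"
  using assms unfolding ultralimit_def by (blast, blast, blast, blast, blast, blast)

text \<open>The limit of a Lipschitz map along good scales. The map extends to the whole limit space because
  \<open>Z\<close> is asymptotically dense. It is light because a long path of mesh \<open>r\<close> over a set of diameter
  \<open>r\<close> would contain \<open>M + 1\<close> points that are \<open>2 * r\<close>-separated; the points of \<open>Z\<close> approximating them
  would then violate the bound \<open>M\<close> on the multiplicity at the radius \<open>3 / 2 * r\<close>, which leaves room
  on both sides for the error.\<close>

lemma light_ultralimit_map:
  assumes T: "ultralimit U X lam p T conv" and T': "ultralimit U Y lam (g \<circ> p) T' conv'"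
    and U: "free_ultrafilter U" and lam: "\<And>j. 0 < lam j" and Z: "Z \<subseteq> mspace X" and p: "\<And>j. p j \<in> Z"
    and g: "g \<in> Z \<rightarrow> mspace Y" and L: "1 \<le> L"
    and lip: "\<And>x y. x \<in> Z \<Longrightarrow> y \<in> Z \<Longrightarrow> mdist Y (g x) (g y) \<le> L * mdist X x y"
    and dense: "\<And>j x. x \<in> mspace X \<Longrightarrow> lam j * mdist X (p j) x \<le> real (Suc j) \<Longrightarrow> \<exists>z\<in>Z. lam j * mdist X x z < 1 / real (Suc j)"
    and mult: "\<And>j r S. 1 / real (Suc j) \<le> r \<Longrightarrow> r \<le> real (Suc j) \<Longrightarrow> S \<subseteq> Z \<Longrightarrow>
      (\<And>z. z \<in> S \<Longrightarrow> lam j * mdist X (p j) z \<le> Suc j) \<Longrightarrow>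
      (\<And>z w. z \<in> S \<Longrightarrow> w \<in> S \<Longrightarrow> z \<noteq> w \<Longrightarrow> r \<le> lam j * mdist X z w) \<Longrightarrow>
      (\<And>z w. z \<in> S \<Longrightarrow> w \<in> S \<Longrightarrow> lam j * mdist Y (g z) (g w) \<le> r) \<Longrightarrow> card S \<le> M"
  obtains f C where "path_light C T T' f"
proof -
  note T = ultralimitD[OF T] and T' = ultralimitD[OF T']
  have U_bot: "U \<noteq> bot" and U_seq: "U \<le> sequentially" using U by (auto simp: free_ultrafilter_def)
  have pX: "p j \<in> mspace X" for j using p Z by auto
  have "\<exists>t. conv p t" using T(5)[of p 0] pX by simp
  then obtain t where t: "conv p t" by blast
  have large: "eventually (\<lambda>j. B \<le> real (Suc j)) U" for B
    by (rule filter_leD[OF U_seq]) (use eventually_ge_at_top[of "nat \<lceil>B\<rceil>"] in \<open>rule eventually_mono\<close>, linarith)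
  have bounded: "eventually (\<lambda>j. lam j * mdist X (p j) (x j) \<le> real (Suc j)) U" if "conv x u" for x u
  proof -
    have "eventually (\<lambda>j. lam j * mdist X (p j) (x j) < mdist T t u + 1) U"
      using T(4)[OF t that] by (rule order_tendstoD) simp
    with large[of "mdist T t u + 1"] show ?thesis by eventually_elim linarith
  qed
  have inv: "((\<lambda>j. 1 / real (Suc j)) \<longlongrightarrow> 0) U"
    by (rule tendsto_mono[OF U_seq]) (rule LIMSEQ_Suc[OF lim_1_over_n])
  have inZ: "\<exists>z. (\<forall>j. z j \<in> Z) \<and> conv z u" if u: "u \<in> mspace T" for u
  proof -
    obtain x where x: "conv x u" using T(3)[OF u] by blast
    have "\<forall>j. \<exists>z\<in>Z. lam j * mdist X (p j) (x j) \<le> Suc j \<longrightarrow> lam j * mdist X (x j) z < 1 / Suc j"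
      using dense T(1)[OF x] p by blast
    then obtain z where z: "\<And>j. z j \<in> Z"
      "\<And>j. lam j * mdist X (p j) (x j) \<le> Suc j \<Longrightarrow> lam j * mdist X (x j) (z j) < 1 / Suc j" by metis
    have "((\<lambda>j. lam j * mdist X (x j) (z j)) \<longlongrightarrow> 0) U"
    proof (rule Lim_null_comparison[OF _ inv])
      show "eventually (\<lambda>j. norm (lam j * mdist X (x j) (z j)) \<le> 1 / real (Suc j)) U"
        using bounded[OF x]
      proof (rule eventually_mono)
        fix j assume "lam j * mdist X (p j) (x j) \<le> real (Suc j)"
        from z(2)[OF this] show "norm (lam j * mdist X (x j) (z j)) \<le> 1 / real (Suc j)"
          using lam[of j] by simp
      qed
    qed
    then have "conv z u" using T(6)[OF x, of z] z(1) Z by blast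
    with z(1) show ?thesis by blast
  qed
  have "\<exists>z w. (\<forall>j. z j \<in> Z) \<and> conv z u \<and> conv' (g \<circ> z) w" if u: "u \<in> mspace T" for u
  proof -
    obtain z where z: "\<And>j. z j \<in> Z" "conv z u" using inZ[OF u] by blast
    have gz: "(g \<circ> z) j \<in> mspace Y" for j using g z(1)[of j] by auto
    have "eventually (\<lambda>j. lam j * mdist X (z j) (p j) < mdist T u t + 1) U"
      using T(4)[OF z(2) t] by (rule order_tendstoD) simp
    then have "eventually (\<lambda>j. lam j * mdist Y ((g \<circ> z) j) ((g \<circ> p) j) \<le> L * (mdist T u t + 1)) U"
    proof (rule eventually_mono)
      fix j assume j: "lam j * mdist X (z j) (p j) < mdist T u t + 1"
      have "lam j * mdist Y (g (z j)) (g (p j)) \<le> lam j * (L * mdist X (z j) (p j))"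
        using lip[OF z(1) p] lam[of j] by (intro mult_left_mono) auto
      also have "\<dots> = L * (lam j * mdist X (z j) (p j))" by simp
      also have "\<dots> \<le> L * (mdist T u t + 1)" using j L by (intro mult_left_mono) auto
      finally show "lam j * mdist Y ((g \<circ> z) j) ((g \<circ> p) j) \<le> L * (mdist T u t + 1)" by simp
    qed
    from T'(5)[OF gz this] z show ?thesis by blast
  qed
  then obtain zz f where zf: "\<And>u j. u \<in> mspace T \<Longrightarrow> zz u j \<in> Z" "\<And>u. u \<in> mspace T \<Longrightarrow> conv (zz u) u"
    "\<And>u. u \<in> mspace T \<Longrightarrow> conv' (g \<circ> zz u) (f u)" by metis
  define C where "C = max L (3 * (real M + 1))"
  have "path_light C T T' f"
    unfolding path_light_def
  proof (intro conjI ballI allI impI, goal_cases)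
    case 1
    show ?case using zf(3) T'(2) by blast
  next
    case 2
    show ?case using L by (simp add: C_def)
  next
    case (3 u v)
    have "mdist T' (f u) (f v) \<le> L * mdist T u v"
    proof (rule tendsto_le[OF U_bot])
      show "((\<lambda>j. L * (lam j * mdist X (zz u j) (zz v j))) \<longlongrightarrow> L * mdist T u v) U"
        using T(4)[OF zf(2)[OF 3(1)] zf(2)[OF 3(2)]] by (intro tendsto_mult tendsto_const)
      show "((\<lambda>j. lam j * mdist Y ((g \<circ> zz u) j) ((g \<circ> zz v) j)) \<longlongrightarrow> mdist T' (f u) (f v)) U"
        using T'(4)[OF zf(3)[OF 3(1)] zf(3)[OF 3(2)]] .
      have "lam j * mdist Y (g (zz u j)) (g (zz v j)) \<le> lam j * (L * mdist X (zz u j) (zz v j))" for j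
        using lip[OF zf(1)[OF 3(1)] zf(1)[OF 3(2)]] lam[of j] by (intro mult_left_mono) auto
      then show "eventually (\<lambda>j. lam j * mdist Y ((g \<circ> zz u) j) ((g \<circ> zz v) j) \<le> L * (lam j * mdist X (zz u j) (zz v j))) U"
        by (intro always_eventually) (simp add: mult_ac)
    qed
    also have "\<dots> \<le> C * mdist T u v" by (intro mult_right_mono) (auto simp: C_def)
    finally show ?case .
  next
    case (4 r xs x y)
    show ?case
    proof (rule ccontr)
      assume "\<not> mdist T x y \<le> C * r"
      moreover have "3 * (real M + 1) * r \<le> C * r" using 4(1) by (intro mult_right_mono) (auto simp: C_def)
      ultimately have far: "3 * r * (real M + 1) \<le> mdist T x y" by (simp add: mult_ac)
      have rp: "is_rpath T r xs" and im: "\<And>a b. a \<in> set xs \<Longrightarrow> b \<in> set xs \<Longrightarrow> mdist T' (f a) (f b) \<le> r"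
        using 4(2) by auto
      obtain v where v: "\<And>k. k \<le> M \<Longrightarrow> v k \<in> set xs"
        "\<And>k l. k \<le> M \<Longrightarrow> l \<le> M \<Longrightarrow> k \<noteq> l \<Longrightarrow> 2 * r \<le> mdist T (v k) (v l)"
        using rpath_separated_points[OF rp 4(1) 4(3,4) far] by blast
      have vT: "v k \<in> mspace T" if "k \<le> M" for k using v(1)[OF that] rp by (auto simp: is_rpath_def)
      \<comment> \<open>Strictly between the bound \<open>r\<close> on the images and the separation \<open>2 * r\<close>.\<close>
      define r' where "r' = 3 / 2 * r"
      have r': "0 < r'" "r' < 2 * r" "r < r'" using 4(1) by (auto simp: r'_def)
      have "eventually (\<lambda>j. \<forall>k\<in>{..M}. lam j * mdist X (p j) (zz (v k) j) \<le> real (Suc j)) U"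
        using bounded[OF zf(2)[OF vT]] by (intro eventually_ball_finite) auto
      moreover have "eventually (\<lambda>j. \<forall>k\<in>{..M}. \<forall>l\<in>{..M}. k \<noteq> l \<longrightarrow> r' < lam j * mdist X (zz (v k) j) (zz (v l) j)) U"
      proof (intro eventually_ball_finite finite_atMost ballI)
        fix k l assume kl: "k \<in> {..M}" "l \<in> {..M}"
        show "eventually (\<lambda>j. k \<noteq> l \<longrightarrow> r' < lam j * mdist X (zz (v k) j) (zz (v l) j)) U"
        proof (cases "k = l")
          case False
          have "r' < mdist T (v k) (v l)" using v(2)[of k l] kl False r' by auto
          with T(4)[OF zf(2)[OF vT] zf(2)[OF vT], of k l] kl
          have "eventually (\<lambda>j. r' < lam j * mdist X (zz (v k) j) (zz (v l) j)) U" by (auto intro: order_tendstoD)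
          then show ?thesis by (rule eventually_mono) simp
        qed simp
      qed
      moreover have "eventually (\<lambda>j. \<forall>k\<in>{..M}. \<forall>l\<in>{..M}. lam j * mdist Y (g (zz (v k) j)) (g (zz (v l) j)) < r') U"
      proof (intro eventually_ball_finite finite_atMost ballI)
        fix k l assume kl: "k \<in> {..M}" "l \<in> {..M}"
        have "mdist T' (f (v k)) (f (v l)) < r'" using im[OF v(1) v(1), of k l] kl r' by auto
        with T'(4)[OF zf(3)[OF vT] zf(3)[OF vT], of k l] kl
        show "eventually (\<lambda>j. lam j * mdist Y (g (zz (v k) j)) (g (zz (v l) j)) < r') U"
          by (auto intro: order_tendstoD)
      qed
      ultimately have "eventually (\<lambda>j. False) U"
        using large[of r'] order_tendstoD(2)[OF inv r'(1)]
      proof eventually_elim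
        case (elim j)
        define S where "S = (\<lambda>k. zz (v k) j) ` {..M}"
        have "inj_on (\<lambda>k. zz (v k) j) {..M}"
        proof (rule inj_onI)
          fix k l assume kl: "k \<in> {..M}" "l \<in> {..M}" "zz (v k) j = zz (v l) j"
          have "zz (v l) j \<in> mspace X" using zf(1)[OF vT, of l j] kl Z by auto
          then have "lam j * mdist X (zz (v k) j) (zz (v l) j) = 0" using kl(3) by simp
          then show "k = l" using elim(2) kl r'(1) by fastforce
        qed
        then have "card S = Suc M" by (simp add: S_def card_image)
        moreover have "card S \<le> M"
        proof (rule mult[of j r'])
          show "1 / real (Suc j) \<le> r'" "r' \<le> real (Suc j)" using elim(4,5) by simp_all
          show "S \<subseteq> Z" using zf(1)[OF vT] by (auto simp: S_def)
          show "lam j * mdist X (p j) z \<le> real (Suc j)" if "z \<in> S" for z using elim(1) that by (auto simp: S_def)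
          show "lam j * mdist Y (g z) (g w) \<le> r'" if zw: "z \<in> S" "w \<in> S" for z w
            using elim(3) zw by (auto simp: S_def intro: less_imp_le)
          show "r' \<le> lam j * mdist X z w" if zw: "z \<in> S" "w \<in> S" "z \<noteq> w" for z w
          proof -
            obtain k l where "z = zz (v k) j" "w = zz (v l) j" "k \<in> {..M}" "l \<in> {..M}" using zw by (auto simp: S_def)
            with zw(3) elim(2) show ?thesis by (metis less_imp_le)
          qed
        qed
        ultimately show ?case by simp
      qed
      then show False using U_bot by (simp add: trivial_limit_def)
    qed
  qed
  then show thesis by (rule that)
qed

text \<open>The Lipschitz dimension does not increase in the limit. The maps \<open>\<phi>\<close>, rescaled and translated to
  vanish at the base points, are bounded on convergent sequences and so converge. A path over a
  small set is approximated by paths in \<open>Y\<close> with mesh and image at most twice as large, whence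
  the factor \<open>2\<close>.\<close>

lemma light_map_to_ultralimit:
  assumes T: "ultralimit U Y lam q T conv" and U: "free_ultrafilter U" and lam: "\<And>j. 0 < lam j"
    and q: "\<And>j. q j \<in> mspace Y" and \<phi>: "path_light C Y (Euclidean_metric m) \<phi>"
  obtains f where "path_light (2 * C) T (Euclidean_metric m) f"
proof -
  note T = ultralimitD[OF T] and \<phi> = path_lightD[OF \<phi>]
  have U_bot: "U \<noteq> bot" using U by (auto simp: free_ultrafilter_def)
  have C: "1 \<le> C" "0 \<le> C" using \<phi>(2) by auto
  have "\<exists>t. conv q t" using T(5)[of q 0] q by simp
  then obtain t where t: "conv q t" by blast
  obtain yy where yy: "\<And>u. u \<in> mspace T \<Longrightarrow> conv (yy u) u" using T(3) by metis
  define \<Phi> where "\<Phi> j y i = lam j * (\<phi> y i - \<phi> (q j) i)" for j y i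
  have \<Phi>_dist: "L2_set (\<lambda>i. \<Phi> j y i - \<Phi> j z i) {..<m} = lam j * mdist (Euclidean_metric m) (\<phi> y) (\<phi> z)" for j y z
  proof -
    have "(\<lambda>i. \<Phi> j y i - \<Phi> j z i) = (\<lambda>i. lam j * (\<phi> y i - \<phi> z i))" by (auto simp: \<Phi>_def algebra_simps)
    then show ?thesis using lam[of j] by (simp add: L2_set_right_distrib)
  qed
  have \<Phi>_lip: "lam j * mdist (Euclidean_metric m) (\<phi> y) (\<phi> z) \<le> C * (lam j * mdist Y y z)"
    if "y \<in> mspace Y" "z \<in> mspace Y" for j y z
    using mult_left_mono[OF \<phi>(3)[OF that], of "lam j"] lam[of j] by (simp add: mult_ac)
  have "\<exists>l. ((\<lambda>j. \<Phi> j (yy u j) i) \<longlongrightarrow> l) U" if u: "u \<in> mspace T" for u i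
  proof (cases "i < m")
    case True
    have "eventually (\<lambda>j. lam j * mdist Y (yy u j) (q j) < mdist T u t + 1) U"
      using T(4)[OF yy[OF u] t] by (rule order_tendstoD) simp
    then have ev: "eventually (\<lambda>j. \<bar>\<Phi> j (yy u j) i\<bar> \<le> C * (mdist T u t + 1)) U"
    proof (rule eventually_mono)
      fix j assume j: "lam j * mdist Y (yy u j) (q j) < mdist T u t + 1"
      have "\<bar>\<Phi> j (yy u j) i\<bar> = \<bar>\<Phi> j (yy u j) i - \<Phi> j (q j) i\<bar>" by (simp add: \<Phi>_def)
      also have "\<dots> \<le> L2_set (\<lambda>i. \<Phi> j (yy u j) i - \<Phi> j (q j) i) {..<m}"
        using member_le_L2_set[of "{..<m}" i "\<lambda>i. \<bar>\<Phi> j (yy u j) i - \<Phi> j (q j) i\<bar>"] True by (simp add: L2_set_def)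
      also have "\<dots> \<le> C * (lam j * mdist Y (yy u j) (q j))"
        unfolding \<Phi>_dist by (rule \<Phi>_lip[OF T(1)[OF yy[OF u]] q])
      also have "\<dots> \<le> C * (mdist T u t + 1)" using j C by (intro mult_left_mono) auto
      finally show "\<bar>\<Phi> j (yy u j) i\<bar> \<le> C * (mdist T u t + 1)" .
    qed
    show ?thesis using ultrafilter_bounded_convergent[OF U ev] by blast
  next
    case False
    then have "\<Phi> j (yy u j) i = 0" for j
      using \<phi>(1)[OF q[of j]] \<phi>(1)[OF T(1)[OF yy[OF u], of j]] by (simp add: \<Phi>_def)
    then show ?thesis by (auto intro!: exI[of _ 0])
  qed
  then obtain f where f: "\<And>u i. u \<in> mspace T \<Longrightarrow> ((\<lambda>j. \<Phi> j (yy u j) i) \<longlongrightarrow> f u i) U" by metis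
  have dist: "((\<lambda>j. lam j * mdist (Euclidean_metric m) (\<phi> (yy u j)) (\<phi> (yy v j))) \<longlongrightarrow>
      mdist (Euclidean_metric m) (f u) (f v)) U" if "u \<in> mspace T" "v \<in> mspace T" for u v
    unfolding \<Phi>_dist[symmetric] unfolding mdist_Euclidean_metric L2_set_def
    using that by (intro tendsto_intros f) auto
  have "path_light (2 * C) T (Euclidean_metric m) f"
    unfolding path_light_def
  proof (intro conjI ballI allI impI, goal_cases)
    case 1
    have "f u i = 0" if "u \<in> mspace T" "m \<le> i" for u i
    proof -
      have "\<Phi> j (yy u j) i = 0" for j
        using \<phi>(1)[OF q[of j]] \<phi>(1)[OF T(1)[OF yy[OF that(1)], of j]] that(2) by (simp add: \<Phi>_def)
      then show ?thesis using f[OF that(1), of i] U_bot by (simp add: tendsto_const_iff)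
    qed
    then show ?case by auto
  next
    case 2
    show ?case using C by simp
  next
    case (3 u v)
    have "mdist (Euclidean_metric m) (f u) (f v) \<le> C * mdist T u v"
    proof (rule tendsto_le[OF U_bot _ dist[OF 3]])
      show "((\<lambda>j. C * (lam j * mdist Y (yy u j) (yy v j))) \<longlongrightarrow> C * mdist T u v) U"
        using T(4)[OF yy[OF 3(1)] yy[OF 3(2)]] by (intro tendsto_mult tendsto_const)
      show "eventually (\<lambda>j. lam j * mdist (Euclidean_metric m) (\<phi> (yy u j)) (\<phi> (yy v j)) \<le>
          C * (lam j * mdist Y (yy u j) (yy v j))) U"
        by (intro always_eventually allI \<Phi>_lip T(1)[OF yy] 3)
    qed
    also have "\<dots> \<le> 2 * C * mdist T u v" using C by (intro mult_right_mono) auto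
    finally show ?case .
  next
    case (4 r xs x y)
    then have rp: "is_rpath T r xs" and im: "\<And>a b. a \<in> set xs \<Longrightarrow> b \<in> set xs \<Longrightarrow> mdist (Euclidean_metric m) (f a) (f b) \<le> r"
      by auto
    have XT: "a \<in> mspace T" if "a \<in> set xs" for a using that rp by (auto simp: is_rpath_def)
    have r2: "r < 2 * r" using 4(1) by simp
    have "eventually (\<lambda>j. \<forall>i\<in>{i. Suc i < length xs}. lam j * mdist Y (yy (xs ! i) j) (yy (xs ! Suc i) j) < 2 * r) U"
    proof (intro eventually_ball_finite ballI)
      have "{i. Suc i < length xs} \<subseteq> {..<length xs}" by auto
      then show "finite {i. Suc i < length xs}" by (rule finite_subset) simp
      fix i assume i: "i \<in> {i. Suc i < length xs}"
      then have "mdist T (xs ! i) (xs ! Suc i) \<le> r" using rp by (auto simp: is_rpath_def)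
      then have "mdist T (xs ! i) (xs ! Suc i) < 2 * r" using r2 by linarith
      moreover have "xs ! i \<in> set xs" "xs ! Suc i \<in> set xs" using i by auto
      then have "((\<lambda>j. lam j * mdist Y (yy (xs ! i) j) (yy (xs ! Suc i) j)) \<longlongrightarrow> mdist T (xs ! i) (xs ! Suc i)) U"
        by (intro T(4) yy XT)
      ultimately show "eventually (\<lambda>j. lam j * mdist Y (yy (xs ! i) j) (yy (xs ! Suc i) j) < 2 * r) U"
        by (intro order_tendstoD(2))
    qed
    moreover have "eventually (\<lambda>j. \<forall>a\<in>set xs. \<forall>b\<in>set xs.
        lam j * mdist (Euclidean_metric m) (\<phi> (yy a j)) (\<phi> (yy b j)) < 2 * r) U"
    proof (intro eventually_ball_finite ballI finite_set)
      fix a b assume ab: "a \<in> set xs" "b \<in> set xs"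
      have "mdist (Euclidean_metric m) (f a) (f b) < 2 * r" using im[OF ab] r2 by linarith
      then show "eventually (\<lambda>j. lam j * mdist (Euclidean_metric m) (\<phi> (yy a j)) (\<phi> (yy b j)) < 2 * r) U"
        by (intro order_tendstoD(2)[OF dist] XT ab)
    qed
    ultimately have "eventually (\<lambda>j. lam j * mdist Y (yy x j) (yy y j) \<le> 2 * C * r) U"
    proof eventually_elim
      case (elim j)
      define \<rho> where "\<rho> = 2 * r / lam j"
      have \<rho>: "0 < \<rho>" "\<And>d. lam j * d < 2 * r \<Longrightarrow> d \<le> \<rho>"
        using 4(1) lam[of j] by (auto simp: \<rho>_def field_simps)
      define ys where "ys = map (\<lambda>a. yy a j) xs"
      have "is_rpath Y \<rho> ys"
        unfolding is_rpath_def
      proof (intro conjI allI impI)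
        show "set ys \<subseteq> mspace Y" using T(1)[OF yy[OF XT]] by (auto simp: ys_def)
        fix i assume "Suc i < length ys"
        then show "mdist Y (ys ! i) (ys ! Suc i) \<le> \<rho>" using elim(1) by (intro \<rho>(2)) (auto simp: ys_def)
      qed
      moreover have "mdist (Euclidean_metric m) (\<phi> a) (\<phi> b) \<le> \<rho>" if "a \<in> set ys" "b \<in> set ys" for a b
        using elim(2) that by (intro \<rho>(2)) (auto simp: ys_def simp del: mdist_Euclidean_metric)
      moreover have "yy x j \<in> set ys" "yy y j \<in> set ys" using 4(3,4) by (auto simp: ys_def)
      ultimately have "mdist Y (yy x j) (yy y j) \<le> C * \<rho>" using \<phi>(4)[OF \<rho>(1), of ys] by blast
      then show ?case using lam[of j] by (simp add: \<rho>_def field_simps)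
    qed
    then show "mdist T x y \<le> 2 * C * r"
      by (intro tendsto_upperbound[OF T(4)[OF yy[OF XT] yy[OF XT]] _ U_bot] 4(3,4))
  qed
  then show thesis by (rule that)
qed

section \<open>Lipschitz dimension of tangents\<close>

text \<open>The Assouad embedding provides the data that the construction of the limit starts from.\<close>

lemma weak_tangent_exists:
  assumes "free_ultrafilter U" "mcomplete_of X" "packing_bound X M"
    and "\<And>j. 0 < lam j" "\<And>j. p j \<in> mspace X"
  obtains T :: "(nat \<Rightarrow> real) metric" and t conv where
    "weak_tangent X T t" "ultralimit U X lam p T conv"
proof (rule assouad_embedding[OF assms(3)])
  fix N :: nat and L :: real and e :: "'a \<Rightarrow> nat \<Rightarrow> real"
  assume e: "1 \<le> L" "\<And>x i. N \<le> i \<Longrightarrow> e x i = 0"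
    "\<And>x y. x \<in> mspace X \<Longrightarrow> y \<in> mspace X \<Longrightarrow>
      sqrt (mdist X x y) / L \<le> mdist (Euclidean_metric N) (e x) (e y) \<and>
      mdist (Euclidean_metric N) (e x) (e y) \<le> L * sqrt (mdist X x y)"
  interpret blowup U X lam p e N L
    by (rule blowup.intro[OF assms(1,2,4,5) e])
  show thesis by (rule that[OF weak_tangent_T ultralimit_T])
qed

theorem corollary8p10:
  fixes X :: "'a metric" and Y :: "'b metric" and Z :: "'a set" and n :: real
    and g :: "'a \<Rightarrow> 'b"
  assumes "0 \<le> n"
    and "mcomplete_of X" and "ahlfors_regular n X"
    and "mcomplete_of Y" and "doubling_metric Y"
    and "compactin (mtopology_of X) Z"
    and "Lipschitz_continuous_map (submetric X Z) Y g"
    and "hausdorff_measure Y n (g ` Z) > 0"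
  shows "(\<exists>(Xh :: (nat \<Rightarrow> real) metric) xh (Yh :: (nat \<Rightarrow> real) metric) yh.
            weak_tangent X Xh xh \<and> weak_tangent Y Yh yh \<and> lipschitz_dim Xh \<le> lipschitz_dim Yh) \<and>
         (\<forall>m::nat. lipschitz_dim Y \<le> enat m \<longrightarrow>
            (\<exists>(Xh :: (nat \<Rightarrow> real) metric) xh. weak_tangent X Xh xh \<and> lipschitz_dim Xh \<le> enat m))"
proof -
  have Z: "Z \<subseteq> mspace X" using compactin_subset_topspace[OF assms(6)] by simp
  then have ZX: "Z \<inter> mspace X = Z" by blast
  obtain B where g: "g \<in> Z \<rightarrow> mspace Y" and B: "\<forall>x\<in>Z. \<forall>y\<in>Z. mdist Y (g x) (g y) \<le> B * mdist X x y"
    using assms(7) unfolding Lipschitz_continuous_map_def mspace_submetric mdist_submetric ZX by blast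
  define L where "L = max 1 B"
  have L: "1 \<le> L" by (simp add: L_def)
  have lip: "mdist Y (g x) (g y) \<le> L * mdist X x y" if "x \<in> Z" "y \<in> Z" for x y
  proof -
    have "B * mdist X x y \<le> L * mdist X x y" by (intro mult_right_mono) (auto simp: L_def)
    with B that show ?thesis by fastforce
  qed
  obtain \<delta> where \<delta>: "0 < \<delta>" "hausdorff_content Y n \<delta> (g ` Z) > 0"
    using assms(8) unfolding hausdorff_measure_def less_SUP_iff by auto
  obtain M where M: "\<And>\<epsilon>. 0 < \<epsilon> \<Longrightarrow> \<epsilon> \<le> 1 \<Longrightarrow> \<exists>p\<in>Z. \<exists>s>0. good_scale X Y g Z M \<epsilon> p s"
    using good_scales_exist[OF assms(1,3) Z assms(6) g L lip \<delta>] by blast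
  have "\<exists>p s. p \<in> Z \<and> 0 < s \<and> good_scale X Y g Z M (1 / real (Suc j)) p s" for j
    using M[of "1 / real (Suc j)"] by auto
  then obtain p s where p: "\<And>j. p j \<in> Z" and s: "\<And>j. 0 < s j"
    and good: "\<And>j. good_scale X Y g Z M (1 / real (Suc j)) (p j) (s j)"
    by metis
  have div: "s j / (1 / real (Suc j)) = s j * Suc j" "1 / real (Suc j) * s j = s j / Suc j" for j by simp_all
  have near: "\<exists>z\<in>Z. mdist X x z < s j / Suc j"
    if "x \<in> mspace X" "mdist X (p j) x \<le> s j * Suc j" for j x
    using good[of j] that unfolding good_scale_def div by blast
  have mult: "card S \<le> M" if "s j / Suc j \<le> r" "r \<le> s j * Suc j" "S \<subseteq> Z"
      "\<And>z. z \<in> S \<Longrightarrow> mdist X (p j) z \<le> s j * Suc j"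
      "\<And>z w. z \<in> S \<Longrightarrow> w \<in> S \<Longrightarrow> z \<noteq> w \<Longrightarrow> r \<le> mdist X z w"
      "\<And>z w. z \<in> S \<Longrightarrow> w \<in> S \<Longrightarrow> mdist Y (g z) (g w) \<le> r" for j r S
  proof -
    have all: "\<forall>r S. s j / Suc j \<le> r \<and> r \<le> s j * Suc j \<and> S \<subseteq> Z \<and> (\<forall>z\<in>S. mdist X (p j) z \<le> s j * Suc j) \<and>
        (\<forall>z\<in>S. \<forall>w\<in>S. (z \<noteq> w \<longrightarrow> r \<le> mdist X z w) \<and> mdist Y (g z) (g w) \<le> r) \<longrightarrow> card S \<le> M"
      using good[of j] unfolding good_scale_def div by (rule conjunct2)
    show ?thesis by (rule mp[OF spec[OF spec[OF all, of r], of S]]) (use that in simp)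
  qed
  define lam where "lam j = 1 / s j" for j
  have lam: "0 < lam j" for j using s by (simp add: lam_def)
  have lam_iff: "lam j * d \<le> c \<longleftrightarrow> d \<le> s j * c" "lam j * d < c \<longleftrightarrow> d < s j * c" "c \<le> lam j * d \<longleftrightarrow> s j * c \<le> d" for j c d
    using s[of j] by (auto simp: lam_def field_simps)
  have pX: "p j \<in> mspace X" and gpY: "(g \<circ> p) j \<in> mspace Y" for j using p[of j] Z g by auto
  obtain U where U: "free_ultrafilter U" using free_ultrafilter_exists by blast
  obtain MX where MX: "packing_bound X MX" using ahlfors_imp_packing_bound[OF assms(3,1)] by blast
  obtain MY where MY: "packing_bound Y MY" using doubling_imp_packing_bound[OF assms(5)] by blast
  obtain Xh :: "(nat \<Rightarrow> real) metric" and xh convX where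
    Xh: "weak_tangent X Xh xh" "ultralimit U X lam p Xh convX"
    by (rule weak_tangent_exists[where p = p, OF U assms(2) MX lam pX])
  obtain Yh :: "(nat \<Rightarrow> real) metric" and yh convY where
    Yh: "weak_tangent Y Yh yh" "ultralimit U Y lam (g \<circ> p) Yh convY"
    by (rule weak_tangent_exists[where p = "g \<circ> p", OF U assms(4) MY lam gpY])
  obtain f C where f: "path_light C Xh Yh f"
  proof (rule light_ultralimit_map[OF Xh(2) Yh(2) U lam Z p g L lip])
    show "\<exists>z\<in>Z. lam j * mdist X x z < 1 / real (Suc j)"
      if "x \<in> mspace X" "lam j * mdist X (p j) x \<le> real (Suc j)" for j x
      using near[OF that(1), of j] that(2) by (simp add: lam_iff)
    fix j r S assume *: "1 / real (Suc j) \<le> r" "r \<le> real (Suc j)" "S \<subseteq> Z"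
      "\<And>z. z \<in> S \<Longrightarrow> lam j * mdist X (p j) z \<le> real (Suc j)"
      "\<And>z w. z \<in> S \<Longrightarrow> w \<in> S \<Longrightarrow> z \<noteq> w \<Longrightarrow> r \<le> lam j * mdist X z w"
      "\<And>z w. z \<in> S \<Longrightarrow> w \<in> S \<Longrightarrow> lam j * mdist Y (g z) (g w) \<le> r"
    have "s j * (1 / real (Suc j)) \<le> s j * r" "s j * r \<le> s j * real (Suc j)"
      using *(1,2) s[of j] by (intro mult_left_mono; simp)+
    then show "card S \<le> M" using mult[of j "s j * r" S] *(3-6) by (simp add: lam_iff)
  qed
  have "\<exists>h. lipschitz_light Xh (Euclidean_metric k) h" if \<phi>: "lipschitz_light Yh (Euclidean_metric k) \<phi>" for k \<phi>
  proof -
    obtain D where "path_light D Yh (Euclidean_metric k) \<phi>" by (rule lipschitz_light_imp_path_light[OF \<phi>])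
    from path_light_imp_lipschitz_light[OF path_light_compose[OF f this]] show ?thesis by blast
  qed
  then have dims: "lipschitz_dim Xh \<le> lipschitz_dim Yh" by (rule lipschitz_dim_le)
  have "\<exists>h. lipschitz_light Yh (Euclidean_metric k) h" if \<phi>: "lipschitz_light Y (Euclidean_metric k) \<phi>" for k \<phi>
  proof -
    obtain D where "path_light D Y (Euclidean_metric k) \<phi>" by (rule lipschitz_light_imp_path_light[OF \<phi>])
    then obtain h where "path_light (2 * D) Yh (Euclidean_metric k) h"
      by (rule light_map_to_ultralimit[OF Yh(2) U lam gpY])
    then show ?thesis by (intro exI[of _ h] path_light_imp_lipschitz_light)
  qed
  then have "lipschitz_dim Yh \<le> lipschitz_dim Y" by (rule lipschitz_dim_le)
  then have "lipschitz_dim Xh \<le> enat m" if "lipschitz_dim Y \<le> enat m" for m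
    using dims that by (meson order_trans)
  with Xh(1) Yh(1) dims show ?thesis by (intro conjI allI impI exI) assumption+
qed

end
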